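(* Let $\mathrm{C}$ be a category enriched in Kan complexes with objects $x,y$, and let $\mathfrak{N}(\mathrm{C})$ be its homotopy coherent nerve. Then precomposition with the isomorphisms $\tau$ and $\rho_n$ described in the context induces isomorphisms of simplicial sets \[ \operatorname{Hom}^{\mathrm{R}}_{\mathfrak{N}(\mathrm{C})}(x,y)\cong \operatorname{Hom}^{\mathrm{L}}_{\mathfrak{N}(\mathrm{C})}(x,y)^{\mathrm{op}} \quad\text{and}\quad \operatorname{Hom}_{\mathfrak{N}(\mathrm{C})}(x,y)\cong \operatorname{Hom}_{\mathfrak{N}(\mathrm{C})}(x,y)^{\mathrm{op}} . \]
   Context: Coherent nerve. $\mathfrak{C}[\Delta^n]$ is the simplicially enriched category with objects $0,\dots,n$, mapping objects $\mathfrak{C}[\Delta^n](k,l)$ the nerve of the poset $\{T\subseteq[k,l]\mid k,l\in T\}$ ordered by inclusion, and composition given by union; $\mathfrak{C}\colon\mathrm{sSet}\to\mathrm{Cat}^{\mathrm{sSet}}$ is its colimit extension and $\mathfrak{N}$ the right adjoint, $\mathfrak{N}(\mathrm{C})_n=\operatorname{Hom}(\mathfrak{C}[\Delta^n],\mathrm{C})$. Mapping spaces. For a quasi-category $\mathcal{C}$, $\operatorname{Hom}^{\mathrm L}_{\mathcal{C}}(x,y)$ is the fibre of $\mathcal{C}_{/y}\to\mathcal{C}$ over $x$ (its $n$-simplices are maps $\Delta^n*\Delta^0\to\mathcal{C}$ constant with value $x$ on $\Delta^n$ and sending the last vertex to $y$); $\operatorname{Hom}^{\mathrm R}_{\mathcal{C}}(x,y)$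 is the fibre of $\mathcal{C}_{x/}\to\mathcal{C}$ over $y$ (its $n$-simplices are maps $\Delta^0*\Delta^n\to\mathcal{C}$ sending the first vertex to $x$ and constant with value $y$ on $\Delta^n$); $\operatorname{Hom}_{\mathcal{C}}(x,y)$ is the fibre of $\mathcal{C}^{\Delta^1}\to\mathcal{C}\times\mathcal{C}$ over $(x,y)$ (its $n$-simplices are maps $\Delta^n\times\Delta^1\to\mathcal{C}$ constant with value $x$ on $\Delta^n\times\{0\}$ and constant with value $y$ on $\Delta^n\times\{1\}$). For a simplicial set $X$, $X^{\mathrm{op}}$ is the opposite simplicial set, i.e. $X$ precomposed with the non-trivial automorphism of the simplex category. The objects $\mathrm{Q}_{i,j}$ and $\mathrm{W}_n$. Put $\mathrm{J}_{i,j}=(\Delta^i*\Delta^j)\amalg_{\Delta^i\amalg\Delta^j}(\Delta^0\amalg\Delta^0)$, with vertices $0,1$, and $\mathrm{Q}_{i,j}=\mathfrak{C}(\mathrm{J}_{i,j})(0,1)$. It is identified with the quotient of the nerve of the poset $\{S\subseteq[i]*[j]\mid S\cap[i]\ne\emptyset\ne S\cap[j]\}$ in which two chains $S_0\subseteq\dots\subseteq S_n$ and $S_0'\subseteq\dots\subseteq S_n'$ are identified if there are $i_0\in[i]$, $j_0\in[j]$ with $\{i_0,j_0\}\subseteq S_0\cap S_0'$ and $S_k\cap[i_0,j_0]=S_k'\cap[i_0,j_0]$ for all $k$. Let $S\Delta^n=(\Delta^n\times\Delta^1)\amalg_{\Delta^n\times\{0,1\}}\{0,1\}$ and $\mathrm{W}_n=\mathfrak{C}(S\Delta^n)(0,1)$.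 Each map $f\colon\Delta^i*\Delta^j\to\Delta^n$, together with $\Delta^i*\Delta^j\to\Delta^0*\Delta^0=\Delta^1$, yields a map $\mathrm{J}_{i,j}\to S\Delta^n$ and so a map $\iota_f\colon\mathrm{Q}_{i,j}\to\mathrm{W}_n$; these exhibit $\mathrm{W}_n$ as the colimit of the $\mathrm{Q}_{i,j}$ over the category of all triples $(i,j,f)$. By adjunction, naturally in $n$, the $n$-simplices of $\operatorname{Hom}^{\mathrm L}_{\mathfrak{N}(\mathrm{C})}(x,y)$, $\operatorname{Hom}^{\mathrm R}_{\mathfrak{N}(\mathrm{C})}(x,y)$ and $\operatorname{Hom}_{\mathfrak{N}(\mathrm{C})}(x,y)$ correspond to maps from $\mathrm{Q}_{n,0}$, $\mathrm{Q}_{0,n}$ and $\mathrm{W}_n$ to $\mathrm{C}(x,y)$, respectively. The isomorphisms. Let $\tau\colon[i]*[j]\to[j]*[i]$ be the order-reversing bijection $\tau(k_l)=(i-k)_r$, $\tau(k_r)=(j-k)_l$ (subscripts $l,r$ denote the left and right join factor). Taking images $S\mapsto\tau(S)$ induces an isomorphism $\tau\colon\mathrm{Q}_{i,j}\cong\mathrm{Q}_{j,i}$. Let $r_n\colon[n]\to[n]$, $k\mapsto n-k$. The isomorphism $\rho_n\colon\mathrm{W}_n\to\mathrm{W}_n$ is determined by $\rho_n\circ\iota_f=\iota_{r_n f\tau^{-1}}\circ\tau$ for all $f\colon[i]*[j]\to[n]$. *)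

theory Defs
  imports Main "HOL-Library.FuncSet"
begin

section \<open>Simplicial sets\<close>

text \<open>Functions on the underlying set of [m] = {..m} are always taken extensional
  (undefined outside the domain), so that equality of functions is equality of morphisms.\<close>

definition mon :: "nat \<Rightarrow> nat \<Rightarrow> (nat \<Rightarrow> nat) set" where
  "mon m n = {\<alpha> \<in> {..m} \<rightarrow>\<^sub>E {..n}. mono_on {..m} \<alpha>}"

definition constm :: "nat \<Rightarrow> nat \<Rightarrow> nat \<Rightarrow> nat" where
  "constm m k = (\<lambda>_\<in>{..m}. k)"

text \<open>\<open>act X m n \<alpha>\<close> is the map from n-simplices to m-simplices induced by \<open>\<alpha> : [m] \<rightarrow> [n]\<close>.\<close>

record 'a sset =
  simps :: "nat \<Rightarrow> 'a set"
  act :: "nat \<Rightarrow> nat \<Rightarrow> (nat \<Rightarrow> nat) \<Rightarrow> 'a \<Rightarrow> 'a"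

definition is_sset :: "'a sset \<Rightarrow> bool" where
  "is_sset X \<longleftrightarrow>
     (\<forall>m n. \<forall>\<alpha>\<in>mon m n. \<forall>s\<in>simps X n. act X m n \<alpha> s \<in> simps X m) \<and>
     (\<forall>n. \<forall>s\<in>simps X n. act X n n (\<lambda>k\<in>{..n}. k) s = s) \<and>
     (\<forall>l m n. \<forall>\<beta>\<in>mon l m. \<forall>\<alpha>\<in>mon m n. \<forall>s\<in>simps X n.
        act X l m \<beta> (act X m n \<alpha> s) = act X l n (compose {..l} \<alpha> \<beta>) s)"

definition smaps :: "'a sset \<Rightarrow> 'b sset \<Rightarrow> (nat \<Rightarrow> 'a \<Rightarrow> 'b) set" where
  "smaps X Y = {g. (\<forall>n. g n \<in> simps X n \<rightarrow>\<^sub>E simps Y n) \<and>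
     (\<forall>m n. \<forall>\<alpha>\<in>mon m n. \<forall>s\<in>simps X n. g m (act X m n \<alpha> s) = act Y m n \<alpha> (g n s))}"

definition smap_comp ::
  "'a sset \<Rightarrow> (nat \<Rightarrow> 'b \<Rightarrow> 'c) \<Rightarrow> (nat \<Rightarrow> 'a \<Rightarrow> 'b) \<Rightarrow> nat \<Rightarrow> 'a \<Rightarrow> 'c" where
  "smap_comp X g f = (\<lambda>m. \<lambda>s\<in>simps X m. g m (f m s))"

definition sisos :: "'a sset \<Rightarrow> 'b sset \<Rightarrow> (nat \<Rightarrow> 'a \<Rightarrow> 'b) set" where
  "sisos X Y = {g \<in> smaps X Y. \<forall>n. bij_betw (g n) (simps X n) (simps Y n)}"

definition opp :: "'a sset \<Rightarrow> 'a sset" where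
  "opp X = \<lparr>simps = simps X, act = (\<lambda>m n \<alpha>. act X m n (\<lambda>k\<in>{..m}. n - \<alpha> (m - k)))\<rparr>"

definition degen :: "'a sset \<Rightarrow> nat \<Rightarrow> 'a \<Rightarrow> 'a" where
  "degen X m v = act X m 0 (constm m 0) v"

definition vertex :: "'a sset \<Rightarrow> nat \<Rightarrow> 'a \<Rightarrow> nat \<Rightarrow> 'a" where
  "vertex X p s k = act X 0 p (constm 0 k) s"

definition std :: "nat \<Rightarrow> (nat \<Rightarrow> nat) sset" where
  "std n = \<lparr>simps = (\<lambda>m. mon m n), act = (\<lambda>l m \<beta> \<alpha>. compose {..l} \<alpha> \<beta>)\<rparr>"

definition std_map :: "nat \<Rightarrow> nat \<Rightarrow> (nat \<Rightarrow> nat) \<Rightarrow> nat \<Rightarrow> (nat \<Rightarrow> nat) \<Rightarrow> (nat \<Rightarrow> nat)" where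
  "std_map m n \<alpha> = (\<lambda>p. \<lambda>\<beta>\<in>simps (std m) p. compose {..p} \<alpha> \<beta>)"

definition sprod :: "'a sset \<Rightarrow> 'b sset \<Rightarrow> ('a \<times> 'b) sset" where
  "sprod X Y = \<lparr>simps = (\<lambda>m. simps X m \<times> simps Y m),
     act = (\<lambda>l m \<beta> s. (act X l m \<beta> (fst s), act Y l m \<beta> (snd s)))\<rparr>"

text \<open>Quotient by a family of equivalence relations compatible with the simplicial operators.\<close>

definition quot :: "'a sset \<Rightarrow> (nat \<Rightarrow> ('a \<times> 'a) set) \<Rightarrow> 'a set sset" where
  "quot X R = \<lparr>simps = (\<lambda>m. simps X m // R m), act = (\<lambda>l m \<beta> c. R l `` (act X l m \<beta> ` c))\<rparr>"

text \<open>The map induced on the quotient by a map that is constant on classes.\<close>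

definition descend ::
  "'a sset \<Rightarrow> (nat \<Rightarrow> ('a \<times> 'a) set) \<Rightarrow> (nat \<Rightarrow> 'a \<Rightarrow> 'b) \<Rightarrow> nat \<Rightarrow> 'a set \<Rightarrow> 'b" where
  "descend X R g = (\<lambda>m. \<lambda>c\<in>simps (quot X R) m. the_elem (g m ` c))"

text \<open>If A and B are disjoint simplicial subsets of X, both nonempty in every degree, the quotient
  by this relation is the pushout of X along the (surjective) map from the coproduct of A and B
  to two points.\<close>

definition collapse_rel ::
  "'a sset \<Rightarrow> (nat \<Rightarrow> 'a set) \<Rightarrow> (nat \<Rightarrow> 'a set) \<Rightarrow> nat \<Rightarrow> ('a \<times> 'a) set" where
  "collapse_rel X A B m = {(s, t). s \<in> simps X m \<and> t \<in> simps X m \<and>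
     (s = t \<or> s \<in> A m \<and> t \<in> A m \<or> s \<in> B m \<and> t \<in> B m)}"

text \<open>The nerve of a set of sets, ordered by inclusion.\<close>

definition nerve :: "'b set set \<Rightarrow> (nat \<Rightarrow> 'b set) sset" where
  "nerve P = \<lparr>simps = (\<lambda>m. {T \<in> {..m} \<rightarrow>\<^sub>E P. mono_on {..m} T}),
     act = (\<lambda>l m \<beta> T. compose {..l} T \<beta>)\<rparr>"

definition horn :: "nat \<Rightarrow> nat \<Rightarrow> (nat \<Rightarrow> nat) sset" where
  "horn n k = \<lparr>simps = (\<lambda>m. {\<alpha> \<in> mon m n. \<not> {..n} \<subseteq> insert k (\<alpha> ` {..m})}), act = act (std n)\<rparr>"

definition kan :: "'a sset \<Rightarrow> bool" where
  "kan X \<longleftrightarrow> is_sset X \<and>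
     (\<forall>n\<ge>1. \<forall>k\<le>n. \<forall>h\<in>smaps (horn n k) X. \<exists>g\<in>smaps (std n) X.
        \<forall>m. \<forall>\<alpha>\<in>simps (horn n k) m. g m \<alpha> = h m \<alpha>)"


section \<open>Simplicially enriched categories\<close>

text \<open>\<open>mcomp C x y z m g f\<close> is the composite of the m-simplices g of \<open>mhom C y z\<close> and f of
  \<open>mhom C x y\<close>; \<open>mid C x\<close> is a vertex of \<open>mhom C x x\<close>.\<close>

record ('o, 'm) scat =
  obs :: "'o set"
  mhom :: "'o \<Rightarrow> 'o \<Rightarrow> 'm sset"
  mcomp :: "'o \<Rightarrow> 'o \<Rightarrow> 'o \<Rightarrow> nat \<Rightarrow> 'm \<Rightarrow> 'm \<Rightarrow> 'm"
  mid :: "'o \<Rightarrow> 'm"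

definition is_scat :: "('o, 'm) scat \<Rightarrow> bool" where
  "is_scat C \<longleftrightarrow>
     (\<forall>x\<in>obs C. \<forall>y\<in>obs C. is_sset (mhom C x y)) \<and>
     (\<forall>x\<in>obs C. mid C x \<in> simps (mhom C x x) 0) \<and>
     (\<forall>x\<in>obs C. \<forall>y\<in>obs C. \<forall>z\<in>obs C. \<forall>m.
        \<forall>g\<in>simps (mhom C y z) m. \<forall>f\<in>simps (mhom C x y) m.
          mcomp C x y z m g f \<in> simps (mhom C x z) m \<and>
          (\<forall>l. \<forall>\<beta>\<in>mon l m. act (mhom C x z) l m \<beta> (mcomp C x y z m g f) =
             mcomp C x y z l (act (mhom C y z) l m \<beta> g) (act (mhom C x y) l m \<beta> f))) \<and>
     (\<forall>w\<in>obs C. \<forall>x\<in>obs C. \<forall>y\<in>obs C. \<forall>z\<in>obs C. \<forall>m.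
        \<forall>h\<in>simps (mhom C y z) m. \<forall>g\<in>simps (mhom C x y) m. \<forall>f\<in>simps (mhom C w x) m.
          mcomp C w y z m h (mcomp C w x y m g f) = mcomp C w x z m (mcomp C x y z m h g) f) \<and>
     (\<forall>x\<in>obs C. \<forall>y\<in>obs C. \<forall>m. \<forall>f\<in>simps (mhom C x y) m.
        mcomp C x y y m (degen (mhom C y y) m (mid C y)) f = f \<and>
        mcomp C x x y m f (degen (mhom C x x) m (mid C x)) = f)"

definition kan_enriched :: "('o, 'm) scat \<Rightarrow> bool" where
  "kan_enriched C \<longleftrightarrow> is_scat C \<and> (\<forall>x\<in>obs C. \<forall>y\<in>obs C. kan (mhom C x y))"

text \<open>A simplicial functor is a pair of its action on objects and on mapping spaces, the latter
  made extensional also in the pair of objects.\<close>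

type_synonym ('o, 'm, 'p, 'n) sfun = "('o \<Rightarrow> 'p) \<times> ('o \<Rightarrow> 'o \<Rightarrow> nat \<Rightarrow> 'm \<Rightarrow> 'n)"

definition hom_restrict ::
  "('o, 'm) scat \<Rightarrow> ('o \<Rightarrow> 'o \<Rightarrow> nat \<Rightarrow> 'm \<Rightarrow> 'n) \<Rightarrow> 'o \<Rightarrow> 'o \<Rightarrow> nat \<Rightarrow> 'm \<Rightarrow> 'n" where
  "hom_restrict D F = (\<lambda>x y m.
     if x \<in> obs D \<and> y \<in> obs D then (\<lambda>c\<in>simps (mhom D x y) m. F x y m c) else (\<lambda>c. undefined))"

definition sfunctors :: "('o, 'm) scat \<Rightarrow> ('p, 'n) scat \<Rightarrow> ('o, 'm, 'p, 'n) sfun set" where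
  "sfunctors D C = {F. fst F \<in> obs D \<rightarrow>\<^sub>E obs C \<and> hom_restrict D (snd F) = snd F \<and>
     (\<forall>x\<in>obs D. \<forall>y\<in>obs D. snd F x y \<in> smaps (mhom D x y) (mhom C (fst F x) (fst F y))) \<and>
     (\<forall>x\<in>obs D. snd F x x 0 (mid D x) = mid C (fst F x)) \<and>
     (\<forall>x\<in>obs D. \<forall>y\<in>obs D. \<forall>z\<in>obs D. \<forall>m.
        \<forall>g\<in>simps (mhom D y z) m. \<forall>f\<in>simps (mhom D x y) m.
          snd F x z m (mcomp D x y z m g f) =
          mcomp C (fst F x) (fst F y) (fst F z) m (snd F y z m g) (snd F x y m f))}"

definition sfun_comp ::
  "('o, 'm) scat \<Rightarrow> ('p, 'n, 'q, 'r) sfun \<Rightarrow> ('o, 'm, 'p, 'n) sfun \<Rightarrow> ('o, 'm, 'q, 'r) sfun" where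
  "sfun_comp D G F = (compose (obs D) (fst G) (fst F),
     hom_restrict D (\<lambda>x y m c. snd G (fst F x) (fst F y) m (snd F x y m c)))"


section \<open>Rigidification and homotopy coherent nerve\<close>

definition cdelta :: "nat \<Rightarrow> (nat, nat \<Rightarrow> nat set) scat" where
  "cdelta n = \<lparr>obs = {..n},
     mhom = (\<lambda>k l. nerve {T. T \<subseteq> {k..l} \<and> k \<in> T \<and> l \<in> T}),
     mcomp = (\<lambda>j k l m U T. \<lambda>a\<in>{..m}. T a \<union> U a),
     mid = (\<lambda>k. \<lambda>_\<in>{..0}. {k})\<rparr>"

definition cdelta_map :: "nat \<Rightarrow> (nat \<Rightarrow> nat) \<Rightarrow> (nat, nat \<Rightarrow> nat set, nat, nat \<Rightarrow> nat set) sfun" where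
  "cdelta_map m \<alpha> = (\<alpha>, hom_restrict (cdelta m) (\<lambda>k l p T. \<lambda>a\<in>{..p}. \<alpha> ` T a))"

definition cnerve :: "('o, 'm) scat \<Rightarrow> (nat, nat \<Rightarrow> nat set, 'o, 'm) sfun sset" where
  "cnerve C = \<lparr>simps = (\<lambda>n. sfunctors (cdelta n) C),
     act = (\<lambda>m n \<alpha> F. sfun_comp (cdelta m) F (cdelta_map m \<alpha>))\<rparr>"

text \<open>The vertex of the coherent nerve given by an object.\<close>

definition cnerve_obj :: "('o, 'm) scat \<Rightarrow> 'o \<Rightarrow> (nat, nat \<Rightarrow> nat set, 'o, 'm) sfun" where
  "cnerve_obj C x = ((\<lambda>_\<in>{..0}. x), hom_restrict (cdelta 0) (\<lambda>k l m T. degen (mhom C x x) m (mid C x)))"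

text \<open>The rigidification of a simplicial set X is the colimit of the simplicial categories
  \<open>cdelta p\<close> over all simplices \<open>\<Delta>\<^sup>p \<rightarrow> X\<close>. It is computed degreewise: the m-simplices of its
  mapping spaces are the morphisms of the category with object set \<open>X\<^sub>0\<close> generated by symbols
  \<open>Gen p s k l T\<close> (the image under s of the m-simplex T of \<open>mhom (cdelta p) k l\<close>), subject to the
  relations below: compatibility with operators \<open>[p] \<rightarrow> [q]\<close>, and functoriality of each
  \<open>cdelta p \<rightarrow> colim\<close>. Paths are listed from source to target.\<close>

datatype 'a gen = Gen nat 'a nat nat "nat \<Rightarrow> nat set"

inductive cpath :: "'a sset \<Rightarrow> nat \<Rightarrow> 'a \<Rightarrow> 'a \<Rightarrow> 'a gen list \<Rightarrow> bool" for X m where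
  cpath_Nil: "x \<in> simps X 0 \<Longrightarrow> cpath X m x x []"
| cpath_Cons: "s \<in> simps X p \<Longrightarrow> k \<le> p \<Longrightarrow> l \<le> p \<Longrightarrow> T \<in> simps (mhom (cdelta p) k l) m \<Longrightarrow>
     cpath X m (vertex X p s l) y u \<Longrightarrow> cpath X m (vertex X p s k) y (Gen p s k l T # u)"

inductive ccong :: "'a sset \<Rightarrow> nat \<Rightarrow> 'a \<Rightarrow> 'a \<Rightarrow> 'a gen list \<Rightarrow> 'a gen list \<Rightarrow> bool" for X m where
  ccong_refl: "cpath X m x y u \<Longrightarrow> ccong X m x y u u"
| ccong_sym: "ccong X m x y u v \<Longrightarrow> ccong X m x y v u"
| ccong_trans: "ccong X m x y u v \<Longrightarrow> ccong X m x y v w \<Longrightarrow> ccong X m x y u w"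
| ccong_append: "ccong X m x y u v \<Longrightarrow> ccong X m y z u' v' \<Longrightarrow> ccong X m x z (u @ u') (v @ v')"
| ccong_operator: "s \<in> simps X q \<Longrightarrow> \<alpha> \<in> mon p q \<Longrightarrow> k \<le> p \<Longrightarrow> l \<le> p \<Longrightarrow>
     T \<in> simps (mhom (cdelta p) k l) m \<Longrightarrow>
     ccong X m (vertex X q s (\<alpha> k)) (vertex X q s (\<alpha> l))
       [Gen p (act X p q \<alpha> s) k l T] [Gen q s (\<alpha> k) (\<alpha> l) (snd (cdelta_map p \<alpha>) k l m T)]"
| ccong_comp: "s \<in> simps X p \<Longrightarrow> j \<le> p \<Longrightarrow> k \<le> p \<Longrightarrow> l \<le> p \<Longrightarrow>
     T \<in> simps (mhom (cdelta p) j k) m \<Longrightarrow> U \<in> simps (mhom (cdelta p) k l) m \<Longrightarrow>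
     ccong X m (vertex X p s j) (vertex X p s l)
       [Gen p s j k T, Gen p s k l U] [Gen p s j l (mcomp (cdelta p) j k l m U T)]"
| ccong_id: "s \<in> simps X p \<Longrightarrow> k \<le> p \<Longrightarrow>
     ccong X m (vertex X p s k) (vertex X p s k)
       [Gen p s k k (degen (mhom (cdelta p) k k) m (mid (cdelta p) k))] []"

definition crel :: "'a sset \<Rightarrow> nat \<Rightarrow> 'a \<Rightarrow> 'a \<Rightarrow> ('a gen list \<times> 'a gen list) set" where
  "crel X m x y = {(u, v). ccong X m x y u v}"

fun gen_act :: "nat \<Rightarrow> nat \<Rightarrow> (nat \<Rightarrow> nat) \<Rightarrow> 'a gen \<Rightarrow> 'a gen" where
  "gen_act l m \<beta> (Gen p s j k T) = Gen p s j k (act (mhom (cdelta p) j k) l m \<beta> T)"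

fun gen_map :: "(nat \<Rightarrow> 'a \<Rightarrow> 'b) \<Rightarrow> 'a gen \<Rightarrow> 'b gen" where
  "gen_map \<phi> (Gen p s k l T) = Gen p (\<phi> p s) k l T"

definition rigid :: "'a sset \<Rightarrow> ('a, 'a gen list set) scat" where
  "rigid X = \<lparr>obs = simps X 0,
     mhom = (\<lambda>x y. \<lparr>simps = (\<lambda>m. {u. cpath X m x y u} // crel X m x y),
               act = (\<lambda>l m \<beta> c. crel X l x y `` (map (gen_act l m \<beta>) ` c))\<rparr>),
     mcomp = (\<lambda>x y z m d c. crel X m x z `` {u @ v |u v. u \<in> c \<and> v \<in> d}),
     mid = (\<lambda>x. crel X 0 x x `` {[]})\<rparr>"

definition rigid_map ::
  "'a sset \<Rightarrow> 'b sset \<Rightarrow> (nat \<Rightarrow> 'a \<Rightarrow> 'b) \<Rightarrow> ('a, 'a gen list set, 'b, 'b gen list set) sfun" where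
  "rigid_map X Y \<phi> = (restrict (\<phi> 0) (simps X 0),
     hom_restrict (rigid X) (\<lambda>x y m c. crel Y m (\<phi> 0 x) (\<phi> 0 y) `` (map (gen_map \<phi>) ` c)))"

text \<open>The structure map \<open>cdelta p \<rightarrow> rigid X\<close> of the colimit at a p-simplex s; as a function of s
  this is the unit \<open>X \<rightarrow> cnerve (rigid X)\<close> of the adjunction.\<close>

definition rigid_unit ::
  "'a sset \<Rightarrow> nat \<Rightarrow> 'a \<Rightarrow> (nat, nat \<Rightarrow> nat set, 'a, 'a gen list set) sfun" where
  "rigid_unit X p s = ((\<lambda>k\<in>{..p}. vertex X p s k),
     hom_restrict (cdelta p)
       (\<lambda>k l m T. crel X m (vertex X p s k) (vertex X p s l) `` {[Gen p s k l T]}))"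

text \<open>The functor \<open>rigid X \<rightarrow> C\<close> adjoint to a map \<open>g : X \<rightarrow> cnerve C\<close>.\<close>

definition adjoint_functor ::
  "'a sset \<Rightarrow> ('o, 'm) scat \<Rightarrow> (nat \<Rightarrow> 'a \<Rightarrow> (nat, nat \<Rightarrow> nat set, 'o, 'm) sfun) \<Rightarrow>
   ('a, 'a gen list set, 'o, 'm) sfun" where
  "adjoint_functor X C g = (THE G. G \<in> sfunctors (rigid X) C \<and>
     (\<forall>p. \<forall>s\<in>simps X p. sfun_comp (cdelta p) G (rigid_unit X p s) = g p s))"


section \<open>Joins and mapping spaces\<close>

text \<open>The join [i] * [j] is [i + j + 1]: \<open>k\<^sub>l\<close> is k and \<open>k\<^sub>r\<close> is \<open>i + 1 + k\<close>. Accordingly the join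
  of \<open>\<Delta>\<^sup>i\<close> and \<open>\<Delta>\<^sup>j\<close> is \<open>std (i + j + 1)\<close>.\<close>

definition join_map :: "nat \<Rightarrow> nat \<Rightarrow> nat \<Rightarrow> (nat \<Rightarrow> nat) \<Rightarrow> (nat \<Rightarrow> nat) \<Rightarrow> nat \<Rightarrow> nat" where
  "join_map i j i' \<alpha> \<beta> = (\<lambda>k\<in>{..i + j + 1}. if k \<le> i then \<alpha> k else i' + 1 + \<beta> (k - (i + 1)))"

definition join_left :: "nat \<Rightarrow> nat \<Rightarrow> nat \<Rightarrow> (nat \<Rightarrow> nat) set" where
  "join_left i j m = {\<alpha> \<in> mon m (i + j + 1). \<alpha> ` {..m} \<subseteq> {..i}}"

definition join_right :: "nat \<Rightarrow> nat \<Rightarrow> nat \<Rightarrow> (nat \<Rightarrow> nat) set" where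
  "join_right i j m = {\<alpha> \<in> mon m (i + j + 1). \<alpha> ` {..m} \<subseteq> {i<..i + j + 1}}"

definition HomL :: "'a sset \<Rightarrow> 'a \<Rightarrow> 'a \<Rightarrow> (nat \<Rightarrow> (nat \<Rightarrow> nat) \<Rightarrow> 'a) sset" where
  "HomL S x y = \<lparr>
     simps = (\<lambda>n. {g \<in> smaps (std (n + 0 + 1)) S.
       (\<forall>m. \<forall>\<alpha>\<in>join_left n 0 m. g m \<alpha> = degen S m x) \<and> g 0 (constm 0 (n + 1)) = y}),
     act = (\<lambda>m n \<alpha> g. smap_comp (std (m + 0 + 1)) g
       (std_map (m + 0 + 1) (n + 0 + 1) (join_map m 0 n \<alpha> (constm 0 0))))\<rparr>"

definition HomR :: "'a sset \<Rightarrow> 'a \<Rightarrow> 'a \<Rightarrow> (nat \<Rightarrow> (nat \<Rightarrow> nat) \<Rightarrow> 'a) sset" where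
  "HomR S x y = \<lparr>
     simps = (\<lambda>n. {g \<in> smaps (std (0 + n + 1)) S.
       g 0 (constm 0 0) = x \<and> (\<forall>m. \<forall>\<alpha>\<in>join_right 0 n m. g m \<alpha> = degen S m y)}),
     act = (\<lambda>m n \<alpha> g. smap_comp (std (0 + m + 1)) g
       (std_map (0 + m + 1) (0 + n + 1) (join_map 0 m 0 (constm 0 0) \<alpha>)))\<rparr>"

definition cyl :: "nat \<Rightarrow> ((nat \<Rightarrow> nat) \<times> (nat \<Rightarrow> nat)) sset" where
  "cyl n = sprod (std n) (std 1)"

definition cyl_end :: "nat \<Rightarrow> nat \<Rightarrow> nat \<Rightarrow> ((nat \<Rightarrow> nat) \<times> (nat \<Rightarrow> nat)) set" where
  "cyl_end n e m = mon m n \<times> {constm m e}"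

definition Hom :: "'a sset \<Rightarrow> 'a \<Rightarrow> 'a \<Rightarrow> (nat \<Rightarrow> (nat \<Rightarrow> nat) \<times> (nat \<Rightarrow> nat) \<Rightarrow> 'a) sset" where
  "Hom S x y = \<lparr>
     simps = (\<lambda>n. {g \<in> smaps (cyl n) S.
       (\<forall>m. \<forall>s\<in>cyl_end n 0 m. g m s = degen S m x) \<and>
       (\<forall>m. \<forall>s\<in>cyl_end n 1 m. g m s = degen S m y)}),
     act = (\<lambda>m n \<alpha> g. smap_comp (cyl m) g
       (\<lambda>p. \<lambda>s\<in>simps (cyl m) p. (std_map m n \<alpha> p (fst s), snd s)))\<rparr>"


section \<open>The mapping spaces Q and W\<close>

definition J_rel :: "nat \<Rightarrow> nat \<Rightarrow> nat \<Rightarrow> ((nat \<Rightarrow> nat) \<times> (nat \<Rightarrow> nat)) set" where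
  "J_rel i j = collapse_rel (std (i + j + 1)) (join_left i j) (join_right i j)"

definition Jsset :: "nat \<Rightarrow> nat \<Rightarrow> (nat \<Rightarrow> nat) set sset" where
  "Jsset i j = quot (std (i + j + 1)) (J_rel i j)"

definition J0 :: "nat \<Rightarrow> nat \<Rightarrow> (nat \<Rightarrow> nat) set" where
  "J0 i j = J_rel i j 0 `` {constm 0 0}"

definition J1 :: "nat \<Rightarrow> nat \<Rightarrow> (nat \<Rightarrow> nat) set" where
  "J1 i j = J_rel i j 0 `` {constm 0 (i + j + 1)}"

definition Qspace :: "nat \<Rightarrow> nat \<Rightarrow> (nat \<Rightarrow> nat) set gen list set sset" where
  "Qspace i j = mhom (rigid (Jsset i j)) (J0 i j) (J1 i j)"

definition S_rel :: "nat \<Rightarrow> nat \<Rightarrow> (((nat \<Rightarrow> nat) \<times> (nat \<Rightarrow> nat)) \<times> ((nat \<Rightarrow> nat) \<times> (nat \<Rightarrow> nat))) set" where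
  "S_rel n = collapse_rel (cyl n) (cyl_end n 0) (cyl_end n 1)"

definition Susp :: "nat \<Rightarrow> ((nat \<Rightarrow> nat) \<times> (nat \<Rightarrow> nat)) set sset" where
  "Susp n = quot (cyl n) (S_rel n)"

definition S_vertex :: "nat \<Rightarrow> nat \<Rightarrow> ((nat \<Rightarrow> nat) \<times> (nat \<Rightarrow> nat)) set" where
  "S_vertex n e = S_rel n 0 `` {(constm 0 0, constm 0 e)}"

definition Wspace :: "nat \<Rightarrow> ((nat \<Rightarrow> nat) \<times> (nat \<Rightarrow> nat)) set gen list set sset" where
  "Wspace n = mhom (rigid (Susp n)) (S_vertex n 0) (S_vertex n 1)"

definition J_to_S ::
  "nat \<Rightarrow> nat \<Rightarrow> nat \<Rightarrow> (nat \<Rightarrow> nat) \<Rightarrow> nat \<Rightarrow> (nat \<Rightarrow> nat) set \<Rightarrow> ((nat \<Rightarrow> nat) \<times> (nat \<Rightarrow> nat)) set" where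
  "J_to_S i j n f = descend (std (i + j + 1)) (J_rel i j) (\<lambda>m \<alpha>. S_rel n m ``
     {(compose {..m} f \<alpha>, compose {..m} (join_map i j 0 (constm i 0) (constm j 0)) \<alpha>)})"

definition iota ::
  "nat \<Rightarrow> nat \<Rightarrow> nat \<Rightarrow> (nat \<Rightarrow> nat) \<Rightarrow> nat \<Rightarrow>
   (nat \<Rightarrow> nat) set gen list set \<Rightarrow> ((nat \<Rightarrow> nat) \<times> (nat \<Rightarrow> nat)) set gen list set" where
  "iota i j n f = snd (rigid_map (Jsset i j) (Susp n) (J_to_S i j n f)) (J0 i j) (J1 i j)"

text \<open>The quotient of the nerve of a poset with which \<open>Qspace i j\<close> is identified.\<close>

definition meeting_both :: "nat \<Rightarrow> nat \<Rightarrow> nat set set" where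
  "meeting_both i j = {A. A \<subseteq> {..i + j + 1} \<and> A \<inter> {..i} \<noteq> {} \<and> A \<inter> {i<..i + j + 1} \<noteq> {}}"

definition P_rel :: "nat \<Rightarrow> nat \<Rightarrow> nat \<Rightarrow> ((nat \<Rightarrow> nat set) \<times> (nat \<Rightarrow> nat set)) set" where
  "P_rel i j m = {(T, T').
     T \<in> simps (nerve (meeting_both i j)) m \<and>
     T' \<in> simps (nerve (meeting_both i j)) m \<and>
     (\<exists>a\<in>{..i}. \<exists>b\<in>{i<..i + j + 1}. {a, b} \<subseteq> T 0 \<inter> T' 0 \<and>
        (\<forall>k\<le>m. T k \<inter> {a..b} = T' k \<inter> {a..b}))}"

definition Pquot :: "nat \<Rightarrow> nat \<Rightarrow> (nat \<Rightarrow> nat set) set sset" where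
  "Pquot i j = quot (nerve (meeting_both i j)) (P_rel i j)"

text \<open>The identification sends the class of a chain T to the image, under the quotient map from
  \<open>std (i + j + 1)\<close> to \<open>Jsset i j\<close>, of the chain of all \<open>T k \<inter> {a..b}\<close> in \<open>mhom (cdelta (i + j + 1)) a b\<close>;
  here a and b are any elements of \<open>T 0\<close> in the left and right join factor.\<close>

definition P_to_Q ::
  "nat \<Rightarrow> nat \<Rightarrow> nat \<Rightarrow> (nat \<Rightarrow> nat set) set \<Rightarrow> (nat \<Rightarrow> nat) set gen list set" where
  "P_to_Q i j = (\<lambda>m. \<lambda>c\<in>simps (Pquot i j) m. crel (Jsset i j) m (J0 i j) (J1 i j) ``
     {[Gen (i + j + 1) (J_rel i j (i + j + 1) `` {\<lambda>k\<in>{..i + j + 1}. k}) a b (\<lambda>k\<in>{..m}. T k \<inter> {a..b})]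
       |T a b. T \<in> c \<and> a \<in> T 0 \<inter> {..i} \<and> b \<in> T 0 \<inter> {i<..i + j + 1}})"


section \<open>The isomorphisms\<close>

definition tau :: "nat \<Rightarrow> nat \<Rightarrow> nat \<Rightarrow> nat" where
  "tau i j = (\<lambda>p\<in>{..i + j + 1}. if p \<le> i then j + 1 + (i - p) else j - (p - (i + 1)))"

definition tau_P :: "nat \<Rightarrow> nat \<Rightarrow> nat \<Rightarrow> (nat \<Rightarrow> nat set) set \<Rightarrow> (nat \<Rightarrow> nat set) set" where
  "tau_P i j = descend
     (nerve (meeting_both i j)) (P_rel i j)
     (\<lambda>m T. P_rel j i m `` {\<lambda>k\<in>{..m}. tau i j ` T k})"

definition tau_Q ::
  "nat \<Rightarrow> nat \<Rightarrow> nat \<Rightarrow> (nat \<Rightarrow> nat) set gen list set \<Rightarrow> (nat \<Rightarrow> nat) set gen list set" where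
  "tau_Q i j = (\<lambda>m. \<lambda>q\<in>simps (Qspace i j) m.
     P_to_Q j i m (tau_P i j m (the_inv_into (simps (Pquot i j) m) (P_to_Q i j m) q)))"

definition rho ::
  "nat \<Rightarrow> nat \<Rightarrow> ((nat \<Rightarrow> nat) \<times> (nat \<Rightarrow> nat)) set gen list set \<Rightarrow>
   ((nat \<Rightarrow> nat) \<times> (nat \<Rightarrow> nat)) set gen list set" where
  "rho n = (THE \<rho>. \<rho> \<in> smaps (Wspace n) (Wspace n) \<and>
     (\<forall>i j. \<forall>f\<in>mon (i + j + 1) n.
        smap_comp (Qspace i j) \<rho> (iota i j n f) =
        smap_comp (Qspace i j)
          (iota j i n (\<lambda>p\<in>{..j + i + 1}. n - f (the_inv_into {..i + j + 1} (tau i j) p)))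
          (tau_Q i j)))"

text \<open>The map \<open>Qspace i j \<rightarrow> C(x, y)\<close> corresponding to a map from the join of \<open>\<Delta>\<^sup>i\<close> and \<open>\<Delta>\<^sup>j\<close> to
  \<open>cnerve C\<close> that is constant with value x on \<open>\<Delta>\<^sup>i\<close> and constant with value y on \<open>\<Delta>\<^sup>j\<close>,
  and the map \<open>Wspace n \<rightarrow> C(x, y)\<close> corresponding to an n-simplex of \<open>Hom (cnerve C) x y\<close>.\<close>

definition Q_transpose ::
  "('o, 'm) scat \<Rightarrow> nat \<Rightarrow> nat \<Rightarrow> (nat \<Rightarrow> (nat \<Rightarrow> nat) \<Rightarrow> (nat, nat \<Rightarrow> nat set, 'o, 'm) sfun) \<Rightarrow>
   nat \<Rightarrow> (nat \<Rightarrow> nat) set gen list set \<Rightarrow> 'm" where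
  "Q_transpose C i j g = snd
     (adjoint_functor (Jsset i j) C (descend (std (i + j + 1)) (J_rel i j) g)) (J0 i j) (J1 i j)"

definition W_transpose ::
  "('o, 'm) scat \<Rightarrow> nat \<Rightarrow>
   (nat \<Rightarrow> (nat \<Rightarrow> nat) \<times> (nat \<Rightarrow> nat) \<Rightarrow> (nat, nat \<Rightarrow> nat set, 'o, 'm) sfun) \<Rightarrow>
   nat \<Rightarrow> ((nat \<Rightarrow> nat) \<times> (nat \<Rightarrow> nat)) set gen list set \<Rightarrow> 'm" where
  "W_transpose C n g = snd
     (adjoint_functor (Susp n) C (descend (cyl n) (S_rel n) g)) (S_vertex n 0) (S_vertex n 1)"

end

theory Submission
  imports Defs
begin

text \<open>
  The map \<open>k \<mapsto> p - k\<close> carries chains of subsets of \<open>[k, l]\<close> to chains of subsets of \<open>[p - l, p - k]\<close>. It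
  preserves inclusions, so it leaves the simplicial direction of the mapping spaces of \<^term>\<open>cdelta p\<close> alone,
  but it exchanges the order of composition: it identifies \<^term>\<open>cdelta p\<close> with its opposite enriched
  category. In general a functor \<open>cdelta p \<rightarrow> C\<close> can therefore be reversed only at the price of replacing \<open>C\<close>
  by its opposite. The functors that occur in the mapping spaces of the coherent nerve are
  special: they send an initial segment of the vertices to \<open>x\<close>, the rest to \<open>y\<close>, and everything within
  one segment to identities. Among the morphisms in the image no two non-identities are ever composed,
  so reversing the chains between the two segments gives again a functor to \<open>C\<close>
  (\<open>bipartite_flip_functor\<close>). This flip is an involution and natural up to the automorphism of
  the simplex category, which produces the opposites in the theorem (\<open>flip_flip_map\<close>,
  \<open>flip_map_natural\<close>).

  It remains to see that the flip is precomposition with \<open>\<tau>\<close> and \<open>\<rho>\<close>. Joins and cylinders, with the two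
  ends to be collapsed, are treated together as bipartite simplicial sets. In the rigidification of
  the collapsed simplicial set every morphism from the first to the second point is the class of
  a single generator, a simplex with a chain between vertices on different sides (\<open>hom_cases\<close>). By
  the universal property of the rigidification, the transpose of a map to the coherent nerve evaluates the
  given functors on these generators (\<open>transpose_gcls\<close>). In particular transposition is injective,
  whence uniqueness, and the claim becomes the statement that \<open>\<tau>\<close> and \<open>\<rho>\<close> reverse generators
  (\<open>tau_Q_gcls\<close>, \<open>rho_reversing\<close>).

  For this, functors out of the rigidification have to be constructed in two places, and in both the
  universal property supplies them. To compute \<open>\<tau>\<close>, which is defined through the identification of \<open>Q\<^sub>i\<^sub>,\<^sub>j\<close>
  with a quotient of the nerve of a poset, this identification has to be injective. A functor to
  the category with two objects whose mapping space is that quotient provides a left inverse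
  (\<open>P_to_Q_inj\<close>). The map \<open>\<rho>\<close> exists because it is the transpose of the flip of the unit \<open>S \<rightarrow> N(C(S))\<close>,
  where \<open>S\<close> is the suspension; it is unique because each generator for the suspension comes from one for
  a join.
\<close>

text \<open>Degree \<open>0\<close> is treated like any other degree, so \<open>{..0}\<close> has to keep the shape \<open>{..m}\<close>.\<close>

declare atMost_0 [simp del]

section \<open>Monotone maps and chains of subsets\<close>

lemma mon_iff:
  "\<alpha> \<in> mon m n \<longleftrightarrow> \<alpha> \<in> extensional {..m} \<and> (\<forall>k\<le>m. \<alpha> k \<le> n) \<and> (\<forall>j k. j \<le> k \<longrightarrow> k \<le> m \<longrightarrow> \<alpha> j \<le> \<alpha> k)"
  unfolding mon_def by (auto simp: PiE_def Pi_def mono_on_def extensional_def)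

lemma mon_le: "\<alpha> \<in> mon m n \<Longrightarrow> k \<le> m \<Longrightarrow> \<alpha> k \<le> n"
  and mon_mono: "\<alpha> \<in> mon m n \<Longrightarrow> j \<le> k \<Longrightarrow> k \<le> m \<Longrightarrow> \<alpha> j \<le> \<alpha> k"
  and mon_ext: "\<alpha> \<in> mon m n \<Longrightarrow> \<alpha> \<in> extensional {..m}"
  by (auto simp: mon_iff)

lemma mon_comp: "\<alpha> \<in> mon m n \<Longrightarrow> \<beta> \<in> mon l m \<Longrightarrow> compose {..l} \<alpha> \<beta> \<in> mon l n"
  by (auto simp: mon_iff compose_def)

lemma mon_id: "(\<lambda>k\<in>{..n}. k) \<in> mon n n"
  by (auto simp: mon_iff)

lemma mon_const: "k \<le> n \<Longrightarrow> constm m k \<in> mon m n"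
  by (auto simp: mon_iff constm_def)

lemma constm_apply [simp]: "a \<le> m \<Longrightarrow> constm m k a = k"
  by (simp add: constm_def)

lemma compose_const: "\<alpha> \<in> mon m n \<Longrightarrow> k \<le> m \<Longrightarrow> compose {..l} \<alpha> (constm l k) = constm l (\<alpha> k)"
  by (auto simp: compose_def constm_def)

lemma const_compose: "\<beta> \<in> mon l m \<Longrightarrow> compose {..l} (constm m k) \<beta> = constm l k"
  by (auto simp: compose_def constm_def mon_iff)

text \<open>The action on morphisms of the non-trivial automorphism of the simplex category.\<close>

definition reflect :: "nat \<Rightarrow> nat \<Rightarrow> (nat \<Rightarrow> nat) \<Rightarrow> nat \<Rightarrow> nat" where
  "reflect m n \<alpha> = (\<lambda>k\<in>{..m}. n - \<alpha> (m - k))"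

lemma reflect_apply [simp]: "k \<le> m \<Longrightarrow> reflect m n \<alpha> k = n - \<alpha> (m - k)"
  by (simp add: reflect_def)

lemma reflect_mon: "\<alpha> \<in> mon m n \<Longrightarrow> reflect m n \<alpha> \<in> mon m n"
  by (auto simp: mon_iff reflect_def intro!: diff_le_mono2)

lemma reflect_reflect: "\<alpha> \<in> mon m n \<Longrightarrow> reflect m n (reflect m n \<alpha>) = \<alpha>"
  by (rule extensionalityI[of _ "{..m}"]) (auto simp: mon_iff reflect_def)

lemma reflect_compose:
  "\<alpha> \<in> mon m n \<Longrightarrow> \<beta> \<in> mon l m \<Longrightarrow>
   reflect l n (compose {..l} \<alpha> \<beta>) = compose {..l} (reflect m n \<alpha>) (reflect l m \<beta>)"
  by (rule extensionalityI[of _ "{..l}"]) (auto simp: mon_iff reflect_def compose_def)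

text \<open>The \<open>m\<close>-simplices of a mapping space of \<^term>\<open>cdelta p\<close>. They depend on the
  endpoints \<open>k\<close> and \<open>l\<close> only, which makes it possible to restrict a chain to a face and to move it
  along a map \<open>[p] \<rightarrow> [q]\<close> without keeping track of \<open>p\<close>.\<close>

definition subset_chains :: "nat \<Rightarrow> nat \<Rightarrow> nat \<Rightarrow> (nat \<Rightarrow> nat set) set" where
  "subset_chains k l m = {T \<in> extensional {..m}. (\<forall>a\<le>m. T a \<subseteq> {k..l} \<and> k \<in> T a \<and> l \<in> T a) \<and>
     (\<forall>a b. a \<le> b \<longrightarrow> b \<le> m \<longrightarrow> T a \<subseteq> T b)}"

definition img :: "(nat \<Rightarrow> nat) \<Rightarrow> nat \<Rightarrow> (nat \<Rightarrow> nat set) \<Rightarrow> nat \<Rightarrow> nat set" where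
  "img \<alpha> m T = (\<lambda>a\<in>{..m}. \<alpha> ` T a)"

definition cup :: "nat \<Rightarrow> (nat \<Rightarrow> nat set) \<Rightarrow> (nat \<Rightarrow> nat set) \<Rightarrow> nat \<Rightarrow> nat set" where
  "cup m T U = (\<lambda>a\<in>{..m}. T a \<union> U a)"

lemma simps_nerve_iff:
  "T \<in> simps (nerve P) m \<longleftrightarrow>
     T \<in> extensional {..m} \<and> (\<forall>a\<le>m. T a \<in> P) \<and> (\<forall>a b. a \<le> b \<longrightarrow> b \<le> m \<longrightarrow> T a \<subseteq> T b)"
  by (auto simp: nerve_def PiE_def Pi_def mono_on_def) (meson order_trans subsetD)+

lemma act_nerve [simp]: "act (nerve P) l m \<beta> T = compose {..l} T \<beta>"
  by (simp add: nerve_def)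

lemma nerve_compose: "\<beta> \<in> mon l m \<Longrightarrow> T \<in> simps (nerve P) m \<Longrightarrow> compose {..l} T \<beta> \<in> simps (nerve P) l"
  by (auto simp: simps_nerve_iff mon_iff compose_def)

lemma cdelta_obs [simp]: "obs (cdelta n) = {..n}"
  by (simp add: cdelta_def)

lemma cdelta_simps [simp]: "simps (mhom (cdelta n) k l) m = subset_chains k l m"
  unfolding set_eq_iff by (simp add: cdelta_def simps_nerve_iff subset_chains_def)

lemma cdelta_act [simp]: "act (mhom (cdelta n) k l) p m \<beta> T = compose {..p} T \<beta>"
  by (simp add: cdelta_def)

lemma cdelta_mcomp [simp]: "mcomp (cdelta n) j k l m U T = cup m T U"
  by (simp add: cdelta_def cup_def)

lemma cdelta_mid [simp]: "mid (cdelta n) k = (\<lambda>_\<in>{..0}. {k})"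
  by (simp add: cdelta_def)

lemma cdelta_degen: "degen (mhom (cdelta n) k k) m (mid (cdelta n) k) = (\<lambda>_\<in>{..m}. {k})"
  by (auto simp: degen_def compose_def constm_def fun_eq_iff)

lemma chains_le: "T \<in> subset_chains k l m \<Longrightarrow> k \<le> l"
  unfolding subset_chains_def by fastforce

lemma chains_compose: "T \<in> subset_chains k l m \<Longrightarrow> \<beta> \<in> mon p m \<Longrightarrow> compose {..p} T \<beta> \<in> subset_chains k l p"
  by (auto simp: subset_chains_def mon_iff compose_def)

lemma chains_singleton: "(\<lambda>_\<in>{..m}. {k}) \<in> subset_chains k k m"
  by (auto simp: subset_chains_def)

lemma chainsI:
  assumes "T \<in> extensional {..m}" "\<And>a x. a \<le> m \<Longrightarrow> x \<in> T a \<Longrightarrow> k \<le> x \<and> x \<le> l"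
    "\<And>a. a \<le> m \<Longrightarrow> k \<in> T a \<and> l \<in> T a" "\<And>a b. a \<le> b \<Longrightarrow> b \<le> m \<Longrightarrow> T a \<subseteq> T b"
  shows "T \<in> subset_chains k l m"
  using assms by (auto simp: subset_chains_def)

lemma chains_ends: "T \<in> subset_chains k l m \<Longrightarrow> a \<le> m \<Longrightarrow> k \<in> T a \<and> l \<in> T a"
  and chains_bounds: "T \<in> subset_chains k l m \<Longrightarrow> a \<le> m \<Longrightarrow> x \<in> T a \<Longrightarrow> k \<le> x \<and> x \<le> l"
  and chains_mono: "T \<in> subset_chains k l m \<Longrightarrow> a \<le> b \<Longrightarrow> b \<le> m \<Longrightarrow> T a \<subseteq> T b"
  and chains_ext: "T \<in> subset_chains k l m \<Longrightarrow> T \<in> extensional {..m}"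
  unfolding subset_chains_def by force+

lemma chains_cup:
  assumes T: "T \<in> subset_chains j k m" and U: "U \<in> subset_chains k l m"
  shows "cup m T U \<in> subset_chains j l m"
proof (rule chainsI)
  have jk: "j \<le> k" "k \<le> l" using assms chains_le by auto
  show "j \<le> x \<and> x \<le> l" if "a \<le> m" "x \<in> cup m T U a" for a x
    using that jk chains_bounds[OF T, of a x] chains_bounds[OF U, of a x] by (auto simp: cup_def)
  show "cup m T U a \<subseteq> cup m T U b" if "a \<le> b" "b \<le> m" for a b
    using that chains_mono[OF T, of a b] chains_mono[OF U, of a b] by (auto simp: cup_def)
qed (use chains_ends[OF T] chains_ends[OF U] in \<open>auto simp: cup_def\<close>)

lemma chains_img:
  assumes \<alpha>: "\<alpha> \<in> mon p q" and T: "T \<in> subset_chains k l m" and l: "l \<le> p"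
  shows "img \<alpha> m T \<in> subset_chains (\<alpha> k) (\<alpha> l) m"
proof (rule chainsI)
  show "\<alpha> k \<le> x \<and> x \<le> \<alpha> l" if x: "a \<le> m" "x \<in> img \<alpha> m T a" for a x
  proof -
    obtain y where "y \<in> T a" "x = \<alpha> y" using x by (auto simp: img_def)
    then show ?thesis using chains_bounds[OF T x(1), of y] l
      by (auto intro!: mon_mono[OF \<alpha>])
  qed
  show "img \<alpha> m T a \<subseteq> img \<alpha> m T b" if "a \<le> b" "b \<le> m" for a b
    using that chains_mono[OF T, of a b] by (auto simp: img_def)
qed (use chains_ends[OF T] in \<open>auto simp: img_def\<close>)

lemma img_compose: "img \<alpha> l (compose {..l} T \<beta>) = compose {..l} (img \<alpha> m T) \<beta>" if "\<beta> \<in> mon l m"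
  using that by (auto simp: img_def compose_def mon_iff fun_eq_iff)

lemma img_cup: "img \<alpha> m (cup m T U) = cup m (img \<alpha> m T) (img \<alpha> m U)"
  by (auto simp: img_def cup_def fun_eq_iff)

lemma img_comp:
  assumes "T \<in> subset_chains k l m" "l \<le> n"
  shows "img (compose {..n} \<alpha> \<beta>) m T = img \<alpha> m (img \<beta> m T)"
proof -
  have "compose {..n} \<alpha> \<beta> ` T a = \<alpha> ` \<beta> ` T a" if "a \<le> m" for a
  proof -
    have "T a \<subseteq> {..n}" using assms that by (force simp: subset_chains_def)
    then show ?thesis by (auto simp: compose_def image_iff subset_iff Bex_def)
  qed
  then show ?thesis by (auto simp: img_def fun_eq_iff)
qed

lemma img_id:
  assumes "T \<in> subset_chains k l m" "l \<le> n"
  shows "img (\<lambda>a\<in>{..n}. a) m T = T"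
proof (rule extensionalityI[of _ "{..m}"])
  fix a assume "a \<in> {..m}"
  then have "T a \<subseteq> {..n}" using assms by (force simp: subset_chains_def)
  then show "img (\<lambda>a\<in>{..n}. a) m T a = T a" using \<open>a \<in> {..m}\<close>
    by (auto simp: img_def image_iff subset_iff Bex_def)
qed (use assms in \<open>auto simp: img_def subset_chains_def\<close>)

text \<open>Taking images under \<open>k \<mapsto> p - k\<close> preserves inclusions, so unlike on the simplices of \<open>\<Delta>\<^sup>p\<close> the
  reversal acts on chains of subsets without reversing the index \<open>a\<close> of the chain. It exchanges the
  two endpoints, and with them the order of composition.\<close>

abbreviation rev_chain :: "nat \<Rightarrow> nat \<Rightarrow> (nat \<Rightarrow> nat set) \<Rightarrow> nat \<Rightarrow> nat set" where
  "rev_chain p m T \<equiv> img (\<lambda>a. p - a) m T"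

lemma rev_chain_chains:
  assumes T: "T \<in> subset_chains k l m" and l: "l \<le> p"
  shows "rev_chain p m T \<in> subset_chains (p - l) (p - k) m"
proof (rule chainsI)
  show "p - l \<le> x \<and> x \<le> p - k" if "a \<le> m" "x \<in> rev_chain p m T a" for a x
    using that chains_bounds[OF T] l by (fastforce simp: img_def)
  show "rev_chain p m T a \<subseteq> rev_chain p m T b" if "a \<le> b" "b \<le> m" for a b
    using that chains_mono[OF T, of a b] by (auto simp: img_def)
qed (use chains_ends[OF T] in \<open>auto simp: img_def\<close>)

lemma rev_chain_rev_chain:
  assumes "T \<in> subset_chains k l m" "l \<le> p"
  shows "rev_chain p m (rev_chain p m T) = T"
proof (rule extensionalityI[of _ "{..m}"])
  fix a assume a: "a \<in> {..m}"
  then have "T a \<subseteq> {..p}" using assms by (force simp: subset_chains_def)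
  then show "rev_chain p m (rev_chain p m T) a = T a" using a
    by (auto simp: img_def image_image image_iff subset_iff Bex_def) 
qed (use assms in \<open>auto simp: img_def subset_chains_def\<close>)

text \<open>Reversal of chains is natural in \<open>[p]\<close> if the operators are reflected.\<close>

lemma img_reflect:
  assumes "\<alpha> \<in> mon p q" "T \<in> subset_chains k l m" "l \<le> p"
  shows "img (reflect p q \<alpha>) m (rev_chain p m T) = rev_chain q m (img \<alpha> m T)"
proof -
  have "reflect p q \<alpha> ` (\<lambda>a. p - a) ` T a = (\<lambda>a. q - a) ` \<alpha> ` T a" if "a \<le> m" for a
  proof -
    have "T a \<subseteq> {..p}" using assms that by (force simp: subset_chains_def)
    then have "x \<le> p" if "x \<in> T a" for x using that by auto
    then show ?thesis by (auto simp: image_image intro!: image_cong)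
  qed
  then show ?thesis by (auto simp: img_def fun_eq_iff)
qed

lemma cdelta_map_hom:
  "k \<le> m \<Longrightarrow> l \<le> m \<Longrightarrow> T \<in> subset_chains k l p \<Longrightarrow> snd (cdelta_map m \<alpha>) k l p T = img \<alpha> p T"
  by (simp add: cdelta_map_def hom_restrict_def img_def)

lemma cdelta_map_obj [simp]: "fst (cdelta_map m \<alpha>) = \<alpha>"
  by (simp add: cdelta_map_def)

section \<open>Simplicial sets and simplicial categories\<close>

lemma act_in: "is_sset X \<Longrightarrow> \<alpha> \<in> mon m n \<Longrightarrow> s \<in> simps X n \<Longrightarrow> act X m n \<alpha> s \<in> simps X m"
  and act_id: "is_sset X \<Longrightarrow> s \<in> simps X n \<Longrightarrow> act X n n (\<lambda>k\<in>{..n}. k) s = s"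
  and act_act: "is_sset X \<Longrightarrow> \<beta> \<in> mon l m \<Longrightarrow> \<alpha> \<in> mon m n \<Longrightarrow> s \<in> simps X n \<Longrightarrow>
        act X l m \<beta> (act X m n \<alpha> s) = act X l n (compose {..l} \<alpha> \<beta>) s"
  unfolding is_sset_def by blast+

lemma vertex_in: "is_sset X \<Longrightarrow> s \<in> simps X p \<Longrightarrow> k \<le> p \<Longrightarrow> vertex X p s k \<in> simps X 0"
  by (simp add: vertex_def act_in mon_const)

lemma vertex_act:
  "is_sset X \<Longrightarrow> s \<in> simps X q \<Longrightarrow> \<alpha> \<in> mon p q \<Longrightarrow> k \<le> p \<Longrightarrow>
   vertex X p (act X p q \<alpha> s) k = vertex X q s (\<alpha> k)"
  by (simp add: vertex_def act_act mon_const compose_const)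

lemma vertex_0: "is_sset X \<Longrightarrow> s \<in> simps X 0 \<Longrightarrow> vertex X 0 s 0 = s"
  using act_id[of X s 0] by (simp add: vertex_def constm_def) (metis (no_types, lifting) atMost_0 restrict_ext singletonD)

lemma degen_in: "is_sset X \<Longrightarrow> v \<in> simps X 0 \<Longrightarrow> degen X m v \<in> simps X m"
  by (simp add: degen_def act_in mon_const)

lemma act_degen:
  "is_sset X \<Longrightarrow> v \<in> simps X 0 \<Longrightarrow> \<beta> \<in> mon l m \<Longrightarrow> act X l m \<beta> (degen X m v) = degen X l v"
  by (simp add: degen_def act_act mon_const const_compose)

lemma degen_0: "is_sset X \<Longrightarrow> v \<in> simps X 0 \<Longrightarrow> degen X 0 v = v"
  using vertex_0 by (fastforce simp: degen_def vertex_def)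

lemma smaps_in: "g \<in> smaps X Y \<Longrightarrow> s \<in> simps X n \<Longrightarrow> g n s \<in> simps Y n"
  and smaps_act: "g \<in> smaps X Y \<Longrightarrow> \<alpha> \<in> mon m n \<Longrightarrow> s \<in> simps X n \<Longrightarrow>
     g m (act X m n \<alpha> s) = act Y m n \<alpha> (g n s)"
  and smaps_ext: "g \<in> smaps X Y \<Longrightarrow> g n \<in> extensional (simps X n)"
  unfolding smaps_def by (auto simp: PiE_def)

lemma smapsI:
  assumes "\<And>n s. s \<in> simps X n \<Longrightarrow> g n s \<in> simps Y n"
    and "\<And>n. g n \<in> extensional (simps X n)"
    and "\<And>m n \<alpha> s. \<alpha> \<in> mon m n \<Longrightarrow> s \<in> simps X n \<Longrightarrow> g m (act X m n \<alpha> s) = act Y m n \<alpha> (g n s)"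
  shows "g \<in> smaps X Y"
  using assms unfolding smaps_def by (auto simp: PiE_def)

lemma smaps_eqI:
  assumes "g \<in> smaps X Y" "h \<in> smaps X Z" "\<And>n s. s \<in> simps X n \<Longrightarrow> g n s = h n s"
  shows "g = h"
proof
  fix n show "g n = h n"
    using assms by (intro extensionalityI[OF smaps_ext smaps_ext]) auto
qed

lemma smap_comp_apply [simp]: "s \<in> simps X m \<Longrightarrow> smap_comp X g f m s = g m (f m s)"
  by (simp add: smap_comp_def)

lemma smap_comp_eqI:
  assumes "h \<in> smaps X Y" "\<And>m s. s \<in> simps X m \<Longrightarrow> h m s = g m (f m s)"
  shows "h = smap_comp X g f"
proof
  fix m show "h m = smap_comp X g f m"
    by (rule extensionalityI[OF smaps_ext[OF assms(1)]]) (auto simp: smap_comp_def assms(2))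
qed

lemma smap_comp_smaps: "f \<in> smaps X Y \<Longrightarrow> g \<in> smaps Y Z \<Longrightarrow> is_sset X \<Longrightarrow> smap_comp X g f \<in> smaps X Z"
  by (rule smapsI) (auto simp: smaps_in smaps_act smap_comp_def act_in)

lemma is_sset_nerve: "is_sset (nerve P)"
  unfolding is_sset_def
proof (intro conjI allI ballI)
  fix n T assume "T \<in> simps (nerve P) n"
  then show "act (nerve P) n n (\<lambda>k\<in>{..n}. k) T = T"
    by (intro extensionalityI[of _ "{..n}"]) (auto simp: simps_nerve_iff compose_def)
qed (auto simp: nerve_compose, auto simp: compose_def fun_eq_iff mon_iff)

lemma is_sset_std: "is_sset (std n)"
  unfolding is_sset_def
proof (intro conjI allI ballI)
  fix m \<alpha> assume "\<alpha> \<in> simps (std n) m"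
  then show "act (std n) m m (\<lambda>k\<in>{..m}. k) \<alpha> = \<alpha>"
    by (intro extensionalityI[of _ "{..m}"]) (auto simp: std_def mon_iff compose_def)
qed (auto simp: std_def mon_comp, auto simp: compose_def fun_eq_iff mon_iff)

lemma is_sset_sprod: "is_sset X \<Longrightarrow> is_sset Y \<Longrightarrow> is_sset (sprod X Y)"
  unfolding is_sset_def by (auto simp: sprod_def)

lemma simps_std [simp]: "simps (std n) m = mon m n"
  and act_std [simp]: "act (std n) l m \<beta> \<alpha> = compose {..l} \<alpha> \<beta>"
  by (simp_all add: std_def)

lemma std_map_smaps: "\<alpha> \<in> mon m n \<Longrightarrow> std_map m n \<alpha> \<in> smaps (std m) (std n)"
  by (rule smapsI) (auto simp: std_map_def mon_comp, auto simp: compose_def fun_eq_iff mon_iff)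

lemma scat_sset: "is_scat C \<Longrightarrow> x \<in> obs C \<Longrightarrow> y \<in> obs C \<Longrightarrow> is_sset (mhom C x y)"
  and scat_mid: "is_scat C \<Longrightarrow> x \<in> obs C \<Longrightarrow> mid C x \<in> simps (mhom C x x) 0"
  and scat_comp_in: "is_scat C \<Longrightarrow> x \<in> obs C \<Longrightarrow> y \<in> obs C \<Longrightarrow> z \<in> obs C \<Longrightarrow>
    g \<in> simps (mhom C y z) m \<Longrightarrow> f \<in> simps (mhom C x y) m \<Longrightarrow>
    mcomp C x y z m g f \<in> simps (mhom C x z) m"
  and scat_comp_act: "is_scat C \<Longrightarrow> x \<in> obs C \<Longrightarrow> y \<in> obs C \<Longrightarrow> z \<in> obs C \<Longrightarrow>
    g \<in> simps (mhom C y z) m \<Longrightarrow> f \<in> simps (mhom C x y) m \<Longrightarrow> \<beta> \<in> mon l m \<Longrightarrow>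
    act (mhom C x z) l m \<beta> (mcomp C x y z m g f) =
      mcomp C x y z l (act (mhom C y z) l m \<beta> g) (act (mhom C x y) l m \<beta> f)"
  and scat_assoc: "is_scat C \<Longrightarrow> w \<in> obs C \<Longrightarrow> x \<in> obs C \<Longrightarrow> y \<in> obs C \<Longrightarrow> z \<in> obs C \<Longrightarrow>
    h \<in> simps (mhom C y z) m \<Longrightarrow> g \<in> simps (mhom C x y) m \<Longrightarrow> f \<in> simps (mhom C w x) m \<Longrightarrow>
    mcomp C w y z m h (mcomp C w x y m g f) = mcomp C w x z m (mcomp C x y z m h g) f"
  and scat_id_left: "is_scat C \<Longrightarrow> x \<in> obs C \<Longrightarrow> y \<in> obs C \<Longrightarrow> f \<in> simps (mhom C x y) m \<Longrightarrow>
    mcomp C x y y m (degen (mhom C y y) m (mid C y)) f = f"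
  and scat_id_right: "is_scat C \<Longrightarrow> x \<in> obs C \<Longrightarrow> y \<in> obs C \<Longrightarrow> f \<in> simps (mhom C x y) m \<Longrightarrow>
    mcomp C x x y m f (degen (mhom C x x) m (mid C x)) = f"
  by (simp_all add: is_scat_def)

lemma scat_id_in: "is_scat C \<Longrightarrow> x \<in> obs C \<Longrightarrow> degen (mhom C x x) m (mid C x) \<in> simps (mhom C x x) m"
  by (simp add: degen_in scat_sset scat_mid)

lemma scat_id_act: "is_scat C \<Longrightarrow> x \<in> obs C \<Longrightarrow> \<beta> \<in> mon l m \<Longrightarrow>
   act (mhom C x x) l m \<beta> (degen (mhom C x x) m (mid C x)) = degen (mhom C x x) l (mid C x)"
  by (simp add: act_degen scat_sset scat_mid)

lemma hom_restrict_apply [simp]: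
  "x \<in> obs D \<Longrightarrow> y \<in> obs D \<Longrightarrow> c \<in> simps (mhom D x y) m \<Longrightarrow> hom_restrict D F x y m c = F x y m c"
  by (simp add: hom_restrict_def)

lemma hom_restrict_idem [simp]: "hom_restrict D (hom_restrict D F) = hom_restrict D F"
  by (auto simp: hom_restrict_def fun_eq_iff)

lemma hom_restrict_cong:
  assumes "\<And>x y m c. x \<in> obs D \<Longrightarrow> y \<in> obs D \<Longrightarrow> c \<in> simps (mhom D x y) m \<Longrightarrow> F x y m c = G x y m c"
  shows "hom_restrict D F = hom_restrict D G"
  using assms by (auto simp: hom_restrict_def fun_eq_iff)

lemma functor_obj: "F \<in> sfunctors D C \<Longrightarrow> x \<in> obs D \<Longrightarrow> fst F x \<in> obs C"
  and functor_smap: "F \<in> sfunctors D C \<Longrightarrow> x \<in> obs D \<Longrightarrow> y \<in> obs D \<Longrightarrow>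
    snd F x y \<in> smaps (mhom D x y) (mhom C (fst F x) (fst F y))"
  and functor_comp: "F \<in> sfunctors D C \<Longrightarrow> x \<in> obs D \<Longrightarrow> y \<in> obs D \<Longrightarrow> z \<in> obs D \<Longrightarrow>
    g \<in> simps (mhom D y z) m \<Longrightarrow> f \<in> simps (mhom D x y) m \<Longrightarrow>
    snd F x z m (mcomp D x y z m g f) =
      mcomp C (fst F x) (fst F y) (fst F z) m (snd F y z m g) (snd F x y m f)"
  unfolding sfunctors_def by (auto simp: PiE_def)

lemma functor_in: "F \<in> sfunctors D C \<Longrightarrow> x \<in> obs D \<Longrightarrow> y \<in> obs D \<Longrightarrow> c \<in> simps (mhom D x y) m \<Longrightarrow>
    snd F x y m c \<in> simps (mhom C (fst F x) (fst F y)) m"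
  and functor_act: "F \<in> sfunctors D C \<Longrightarrow> x \<in> obs D \<Longrightarrow> y \<in> obs D \<Longrightarrow> c \<in> simps (mhom D x y) m \<Longrightarrow>
    \<beta> \<in> mon l m \<Longrightarrow> snd F x y l (act (mhom D x y) l m \<beta> c) =
      act (mhom C (fst F x) (fst F y)) l m \<beta> (snd F x y m c)"
  by (auto dest: functor_smap intro: smaps_in smaps_act)

lemma functor_id: "F \<in> sfunctors D C \<Longrightarrow> x \<in> obs D \<Longrightarrow> mid D x \<in> simps (mhom D x x) 0 \<Longrightarrow>
    snd F x x m (degen (mhom D x x) m (mid D x)) =
    degen (mhom C (fst F x) (fst F x)) m (mid C (fst F x))"
  unfolding degen_def by (subst functor_act) (auto simp: mon_const sfunctors_def)

lemma sfunctorsI: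
  assumes "fst F \<in> extensional (obs D)" "hom_restrict D (snd F) = snd F"
    and "\<And>x. x \<in> obs D \<Longrightarrow> fst F x \<in> obs C"
    and "\<And>x y m c. x \<in> obs D \<Longrightarrow> y \<in> obs D \<Longrightarrow> c \<in> simps (mhom D x y) m \<Longrightarrow>
      snd F x y m c \<in> simps (mhom C (fst F x) (fst F y)) m"
    and "\<And>x y l m \<beta> c. x \<in> obs D \<Longrightarrow> y \<in> obs D \<Longrightarrow> c \<in> simps (mhom D x y) m \<Longrightarrow> \<beta> \<in> mon l m \<Longrightarrow>
      snd F x y l (act (mhom D x y) l m \<beta> c) =
      act (mhom C (fst F x) (fst F y)) l m \<beta> (snd F x y m c)"
    and "\<And>x. x \<in> obs D \<Longrightarrow> snd F x x 0 (mid D x) = mid C (fst F x)"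
    and "\<And>x y z m g f. x \<in> obs D \<Longrightarrow> y \<in> obs D \<Longrightarrow> z \<in> obs D \<Longrightarrow>
      g \<in> simps (mhom D y z) m \<Longrightarrow> f \<in> simps (mhom D x y) m \<Longrightarrow>
      snd F x z m (mcomp D x y z m g f) =
      mcomp C (fst F x) (fst F y) (fst F z) m (snd F y z m g) (snd F x y m f)"
  shows "F \<in> sfunctors D C"
proof -
  have "snd F x y m \<in> extensional (simps (mhom D x y) m)" if "x \<in> obs D" "y \<in> obs D" for x y m
    by (subst assms(2)[symmetric]) (use that in \<open>auto simp: hom_restrict_def\<close>)
  then show ?thesis using assms unfolding sfunctors_def
    by (auto simp: PiE_def intro!: smapsI)
qed

lemma functor_eqI:
  assumes "F \<in> sfunctors D C" "G \<in> sfunctors D C'"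
    and "\<And>x. x \<in> obs D \<Longrightarrow> fst F x = fst G x"
    and "\<And>x y m c. x \<in> obs D \<Longrightarrow> y \<in> obs D \<Longrightarrow> c \<in> simps (mhom D x y) m \<Longrightarrow> snd F x y m c = snd G x y m c"
  shows "F = G"
proof (rule prod_eqI)
  show "fst F = fst G" using assms(1,2,3)
    by (intro extensionalityI[of _ "obs D"]) (auto simp: sfunctors_def PiE_def)
  have "snd F = hom_restrict D (snd F)" "snd G = hom_restrict D (snd G)"
    using assms(1,2) by (auto simp: sfunctors_def)
  moreover have "hom_restrict D (snd F) = hom_restrict D (snd G)"
    by (rule hom_restrict_cong) (rule assms(4))
  ultimately show "snd F = snd G" by simp
qed

lemma sfun_comp_obj: "x \<in> obs D \<Longrightarrow> fst (sfun_comp D G F) x = fst G (fst F x)"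
  by (simp add: sfun_comp_def compose_def)

lemma sfun_comp_hom: "x \<in> obs D \<Longrightarrow> y \<in> obs D \<Longrightarrow> c \<in> simps (mhom D x y) m \<Longrightarrow>
    snd (sfun_comp D G F) x y m c = snd G (fst F x) (fst F y) m (snd F x y m c)"
  by (simp add: sfun_comp_def)

lemma sfun_comp_sfunctors:
  assumes F: "F \<in> sfunctors D C" and G: "G \<in> sfunctors C B"
    and D: "\<And>x. x \<in> obs D \<Longrightarrow> mid D x \<in> simps (mhom D x x) 0"
      "\<And>x y m c l \<beta>. x \<in> obs D \<Longrightarrow> y \<in> obs D \<Longrightarrow> c \<in> simps (mhom D x y) m \<Longrightarrow> \<beta> \<in> mon l m \<Longrightarrow>
        act (mhom D x y) l m \<beta> c \<in> simps (mhom D x y) l"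
      "\<And>x y z m g f. x \<in> obs D \<Longrightarrow> y \<in> obs D \<Longrightarrow> z \<in> obs D \<Longrightarrow>
      g \<in> simps (mhom D y z) m \<Longrightarrow> f \<in> simps (mhom D x y) m \<Longrightarrow> mcomp D x y z m g f \<in> simps (mhom D x z) m"
  shows "sfun_comp D G F \<in> sfunctors D B"
proof (rule sfunctorsI)
  show "fst (sfun_comp D G F) \<in> extensional (obs D)" by (simp add: sfun_comp_def)
  show "hom_restrict D (snd (sfun_comp D G F)) = snd (sfun_comp D G F)"
    by (simp add: sfun_comp_def)
  fix x assume x: "x \<in> obs D"
  show "snd (sfun_comp D G F) x x 0 (mid D x) = mid B (fst (sfun_comp D G F) x)"
    using x F G functor_obj[OF F x] by (simp add: sfun_comp_hom sfun_comp_obj D sfunctors_def)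
qed (use F G D in \<open>simp_all add: sfun_comp_obj sfun_comp_hom functor_obj functor_in functor_act functor_comp\<close>)

section \<open>The coherent nerve\<close>

lemma simps_cnerve [simp]: "simps (cnerve C) n = sfunctors (cdelta n) C"
  by (simp add: cnerve_def)

lemma act_cnerve_obj: "k \<le> m \<Longrightarrow> fst (act (cnerve C) m n \<alpha> F) k = fst F (\<alpha> k)"
  by (simp add: cnerve_def sfun_comp_obj)

lemma act_cnerve_hom: "k \<le> m \<Longrightarrow> l \<le> m \<Longrightarrow> T \<in> subset_chains k l p \<Longrightarrow>
   snd (act (cnerve C) m n \<alpha> F) k l p T = snd F (\<alpha> k) (\<alpha> l) p (img \<alpha> p T)"
  by (simp add: cnerve_def sfun_comp_hom cdelta_map_hom)

lemma cdelta_map_functor: "\<alpha> \<in> mon m n \<Longrightarrow> cdelta_map m \<alpha> \<in> sfunctors (cdelta m) (cdelta n)"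
proof (rule sfunctorsI)
  assume \<alpha>: "\<alpha> \<in> mon m n"
  show "hom_restrict (cdelta m) (snd (cdelta_map m \<alpha>)) = snd (cdelta_map m \<alpha>)"
    by (simp add: cdelta_map_def)
  show "fst (cdelta_map m \<alpha>) \<in> extensional (obs (cdelta m))" using \<alpha> by (simp add: mon_ext)
  show "snd (cdelta_map m \<alpha>) k k 0 (mid (cdelta m) k) = mid (cdelta n) (fst (cdelta_map m \<alpha>) k)"
    if "k \<in> obs (cdelta m)" for k
    using that by (simp add: cdelta_map_hom chains_singleton) (auto simp: img_def fun_eq_iff)
qed (auto simp: mon_le cdelta_map_hom chains_img chains_compose img_compose chains_cup img_cup)

lemma act_cnerve_in:
  "\<alpha> \<in> mon m n \<Longrightarrow> F \<in> sfunctors (cdelta n) C \<Longrightarrow> act (cnerve C) m n \<alpha> F \<in> sfunctors (cdelta m) C"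
  unfolding cnerve_def
  by (simp, rule sfun_comp_sfunctors[OF cdelta_map_functor])
    (auto simp: chains_compose chains_cup chains_singleton)

text \<open>Only pairs \<open>k \<le> l\<close> have to be compared, as the other mapping spaces of \<^term>\<open>cdelta n\<close> are empty.\<close>

lemma cdelta_functor_eqI:
  assumes "F \<in> sfunctors (cdelta n) C" "G \<in> sfunctors (cdelta n) C'"
    and "\<And>k. k \<le> n \<Longrightarrow> fst F k = fst G k"
    and "\<And>k l m T. k \<le> l \<Longrightarrow> l \<le> n \<Longrightarrow> T \<in> subset_chains k l m \<Longrightarrow> snd F k l m T = snd G k l m T"
  shows "F = G"
  using assms(1,2) by (rule functor_eqI) (auto simp: assms chains_le)

section \<open>Rigidification\<close>

text \<open>The morphism of the rigidification represented by a path. Nearly all arguments below compute with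
  these classes instead of the elements of a quotient.\<close>

definition pcls :: "'a sset \<Rightarrow> nat \<Rightarrow> 'a \<Rightarrow> 'a \<Rightarrow> 'a gen list \<Rightarrow> 'a gen list set" where
  "pcls X m x y u = crel X m x y `` {u}"

context
  fixes X :: "'a sset"
  assumes X: "is_sset X"
begin

lemma cpath_ends: "cpath X m x y u \<Longrightarrow> x \<in> simps X 0 \<and> y \<in> simps X 0"
  by (induction rule: cpath.induct) (auto simp: vertex_in X)

lemma cpath_append: "cpath X m x y u \<Longrightarrow> cpath X m y z v \<Longrightarrow> cpath X m x z (u @ v)"
  by (induction rule: cpath.induct) (auto intro: cpath_Cons)

lemma cpath_single:
  "s \<in> simps X p \<Longrightarrow> k \<le> p \<Longrightarrow> l \<le> p \<Longrightarrow> T \<in> subset_chains k l m \<Longrightarrow>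
   cpath X m (vertex X p s k) (vertex X p s l) [Gen p s k l T]"
  by (rule cpath_Cons) (auto intro: cpath_Nil simp: vertex_in X)

lemma cpath_act: "cpath X m x y u \<Longrightarrow> \<beta> \<in> mon l m \<Longrightarrow> cpath X l x y (map (gen_act l m \<beta>) u)"
  by (induction rule: cpath.induct) (auto intro!: cpath_Nil cpath_Cons simp: chains_compose)

lemma ccong_img:
  assumes "s \<in> simps X q" "\<alpha> \<in> mon p q" "k \<le> p" "l \<le> p" "T \<in> subset_chains k l m"
  shows "ccong X m (vertex X q s (\<alpha> k)) (vertex X q s (\<alpha> l))
    [Gen p (act X p q \<alpha> s) k l T] [Gen q s (\<alpha> k) (\<alpha> l) (img \<alpha> m T)]"
  using ccong_operator[of s X q \<alpha> p k l T m] assms by (simp add: cdelta_map_hom)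

lemma ccong_cup:
  assumes "s \<in> simps X p" "j \<le> p" "k \<le> p" "l \<le> p"
    "T \<in> subset_chains j k m" "U \<in> subset_chains k l m"
  shows "ccong X m (vertex X p s j) (vertex X p s l)
       [Gen p s j k T, Gen p s k l U] [Gen p s j l (cup m T U)]"
  using ccong_comp[of s X p j k l T m U] assms by simp

lemma ccong_unit:
  assumes "s \<in> simps X p" "k \<le> p"
  shows "ccong X m (vertex X p s k) (vertex X p s k) [Gen p s k k (\<lambda>_\<in>{..m}. {k})] []"
  using ccong_id[of s X p k m] assms unfolding cdelta_degen by simp

lemma ccong_cpath: "ccong X m x y u v \<Longrightarrow> cpath X m x y u \<and> cpath X m x y v"
proof (induction rule: ccong.induct)
  case (ccong_operator s q \<alpha> p k l T)
  then have "cpath X m (vertex X q s (\<alpha> k)) (vertex X q s (\<alpha> l)) [Gen p (act X p q \<alpha> s) k l T]"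
    using cpath_single[of "act X p q \<alpha> s" p k l T m] by (simp add: act_in vertex_act X)
  then show ?case using ccong_operator
    by (auto intro!: cpath_single simp: mon_le chains_img cdelta_map_hom)
next
  case (ccong_comp s p j k l T U)
  then show ?case
    using cpath_append[OF cpath_single[of s p j k T m] cpath_single[of s p k l U m]]
    by (auto intro!: cpath_single simp: chains_cup)
next
  case (ccong_id s p k)
  then show ?case unfolding cdelta_degen
    by (auto intro!: cpath_single cpath_Nil simp: chains_singleton vertex_in X)
qed (auto intro: cpath_append)

lemma compose_singleton: "\<beta> \<in> mon l m \<Longrightarrow> compose {..l} (\<lambda>_\<in>{..m}. {k}) \<beta> = (\<lambda>_\<in>{..l}. {k})"
  by (auto simp: compose_def fun_eq_iff mon_iff)

lemma compose_cup: "\<beta> \<in> mon l m \<Longrightarrow>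
   compose {..l} (cup m T U) \<beta> = cup l (compose {..l} T \<beta>) (compose {..l} U \<beta>)"
  by (auto simp: compose_def cup_def fun_eq_iff mon_iff)

text \<open>The generating relations are stable under simplicial operators, so the mapping spaces of the
  rigidification are simplicial sets.\<close>

lemma ccong_act:
  "ccong X m x y u v \<Longrightarrow> \<beta> \<in> mon l m \<Longrightarrow>
   ccong X l x y (map (gen_act l m \<beta>) u) (map (gen_act l m \<beta>) v)"
proof (induction rule: ccong.induct)
  case (ccong_refl x y u)
  then show ?case by (auto intro: ccong.ccong_refl cpath_act)
next
  case (ccong_sym x y u v)
  then show ?case by (auto intro: ccong.ccong_sym)
next
  case (ccong_trans x y u v w)
  then show ?case by (auto intro: ccong.ccong_trans)
next
  case (ccong_append x y u v z u' v')
  then show ?case by (auto intro: ccong.ccong_append)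
next
  case (ccong_operator s q \<alpha> p k l' T)
  then show ?case
    by (auto simp: cdelta_map_hom img_compose[symmetric] chains_compose intro!: ccong_img)
next
  case (ccong_comp s p j k l' T U)
  then show ?case by (auto simp: compose_cup chains_compose intro!: ccong_cup)
next
  case (ccong_id s p k)
  then show ?case unfolding cdelta_degen by (auto simp: compose_singleton intro!: ccong_unit)
qed

lemma pcls_iff: "v \<in> pcls X m x y u \<longleftrightarrow> ccong X m x y u v"
  by (simp add: pcls_def crel_def)

lemma pcls_eqI: "ccong X m x y u v \<Longrightarrow> pcls X m x y u = pcls X m x y v"
  unfolding set_eq_iff pcls_iff by (blast intro: ccong_sym ccong_trans)

lemma pcls_eqD: "pcls X m x y u = pcls X m x y v \<Longrightarrow> cpath X m x y u \<Longrightarrow> ccong X m x y u v"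
  using pcls_iff[of u m x y u] pcls_iff[of u m x y v] by (auto intro: ccong_refl ccong_sym)

lemma crel_image:
  assumes "\<And>w. ccong X m x y u w \<Longrightarrow> ccong X' m' x' y' (h u) (h w)"
    and "cpath X m x y u"
  shows "crel X' m' x' y' `` (h ` pcls X m x y u) = pcls X' m' x' y' (h u)"
proof -
  have "crel X' m' x' y' `` (h ` pcls X m x y u) = {v. \<exists>w. ccong X m x y u w \<and> ccong X' m' x' y' (h w) v}"
    by (auto simp: pcls_iff crel_def)
  also have "\<dots> = {v. ccong X' m' x' y' (h u) v}"
    using assms by (auto intro: ccong.intros)
  finally show ?thesis by (simp add: pcls_def crel_def Image_def)
qed

lemma rigid_obs [simp]: "obs (rigid X) = simps X 0"
  by (simp add: rigid_def)

lemma rigid_simps: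
  "c \<in> simps (mhom (rigid X) x y) m \<longleftrightarrow> (\<exists>u. cpath X m x y u \<and> c = pcls X m x y u)"
  by (auto simp: rigid_def quotient_def pcls_def)

lemma pcls_in: "cpath X m x y u \<Longrightarrow> pcls X m x y u \<in> simps (mhom (rigid X) x y) m"
  by (auto simp: rigid_simps)

lemma rigid_act:
  "cpath X m x y u \<Longrightarrow> \<beta> \<in> mon l m \<Longrightarrow>
   act (mhom (rigid X) x y) l m \<beta> (pcls X m x y u) = pcls X l x y (map (gen_act l m \<beta>) u)"
  by (simp add: rigid_def crel_image ccong_act)

lemma rigid_mcomp:
  assumes "cpath X m x y u" "cpath X m y z v"
  shows "mcomp (rigid X) x y z m (pcls X m y z v) (pcls X m x y u) = pcls X m x z (u @ v)"
proof -
  have "mcomp (rigid X) x y z m (pcls X m y z v) (pcls X m x y u) =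
     {w. \<exists>u' v'. ccong X m x y u u' \<and> ccong X m y z v v' \<and> ccong X m x z (u' @ v') w}"
    by (auto simp: rigid_def pcls_iff crel_def)
  also have "\<dots> = {w. ccong X m x z (u @ v) w}"
    using assms by (auto intro: ccong.intros(1,3) ccong_append)
  finally show ?thesis by (simp add: pcls_def crel_def Image_def)
qed

lemma rigid_mid: "mid (rigid X) x = pcls X 0 x x []"
  by (simp add: rigid_def pcls_def)

lemma rigid_degen:
  "x \<in> simps X 0 \<Longrightarrow> degen (mhom (rigid X) x x) m (mid (rigid X) x) = pcls X m x x []"
  by (simp add: degen_def rigid_mid rigid_act cpath_Nil mon_const)

lemma gen_act_id: "cpath X m x y u \<Longrightarrow> map (gen_act m m (\<lambda>k\<in>{..m}. k)) u = u"
proof (induction rule: cpath.induct)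
  case (cpath_Cons s p k l T y u)
  then have "compose {..m} T (\<lambda>k\<in>{..m}. k) = T"
    by (intro extensionalityI[of _ "{..m}"]) (auto simp: compose_def subset_chains_def)
  then show ?case using cpath_Cons by (simp only: list.map gen_act.simps cdelta_act)
qed simp

lemma gen_act_comp:
  assumes "\<beta> \<in> mon l m"
  shows "gen_act l m \<beta> \<circ> gen_act m n \<alpha> = gen_act l n (compose {..l} \<alpha> \<beta>)"
proof
  fix G show "(gen_act l m \<beta> \<circ> gen_act m n \<alpha>) G = gen_act l n (compose {..l} \<alpha> \<beta>) G"
    using assms by (cases G) (auto simp: compose_def fun_eq_iff mon_iff)
qed

lemma is_sset_rigid_hom: "is_sset (mhom (rigid X) x y)"
  unfolding is_sset_def
proof (intro conjI allI ballI)
  fix m n \<alpha> c assume "\<alpha> \<in> mon m n" "c \<in> simps (mhom (rigid X) x y) n"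
  then show "act (mhom (rigid X) x y) m n \<alpha> c \<in> simps (mhom (rigid X) x y) m"
    by (auto simp: rigid_simps rigid_act intro: cpath_act)
next
  fix n c assume "c \<in> simps (mhom (rigid X) x y) n"
  then show "act (mhom (rigid X) x y) n n (\<lambda>k\<in>{..n}. k) c = c"
    by (auto simp: rigid_simps rigid_act mon_id gen_act_id)
next
  fix l m n \<alpha> \<beta> c assume "\<beta> \<in> mon l m" "\<alpha> \<in> mon m n" "c \<in> simps (mhom (rigid X) x y) n"
  then show "act (mhom (rigid X) x y) l m \<beta> (act (mhom (rigid X) x y) m n \<alpha> c) =
    act (mhom (rigid X) x y) l n (compose {..l} \<alpha> \<beta>) c"
    by (auto simp: rigid_simps rigid_act cpath_act mon_comp gen_act_comp)
qed

lemma is_scat_rigid: "is_scat (rigid X)"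
proof -
  have 1: "\<forall>x\<in>obs (rigid X). mid (rigid X) x \<in> simps (mhom (rigid X) x x) 0"
    by (auto simp: rigid_mid rigid_simps intro: cpath_Nil)
  have 2: "mcomp (rigid X) x y z m g f \<in> simps (mhom (rigid X) x z) m \<and>
          (\<forall>l. \<forall>\<beta>\<in>mon l m. act (mhom (rigid X) x z) l m \<beta> (mcomp (rigid X) x y z m g f) =
             mcomp (rigid X) x y z l (act (mhom (rigid X) y z) l m \<beta> g) (act (mhom (rigid X) x y) l m \<beta> f))"
    if that': "g \<in> simps (mhom (rigid X) y z) m" "f \<in> simps (mhom (rigid X) x y) m" for x y z m g f
  proof -
    obtain u v where "cpath X m x y u" "f = pcls X m x y u" "cpath X m y z v" "g = pcls X m y z v"
      using that' unfolding rigid_simps by blast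
    then show ?thesis
      by (auto simp: rigid_mcomp rigid_act cpath_act cpath_append intro: pcls_in)
  qed
  have 3: "mcomp (rigid X) w y z m h (mcomp (rigid X) w x y m g f) =
      mcomp (rigid X) w x z m (mcomp (rigid X) x y z m h g) f"
    if that': "h \<in> simps (mhom (rigid X) y z) m" "g \<in> simps (mhom (rigid X) x y) m"
      "f \<in> simps (mhom (rigid X) w x) m" for w x y z m h g f
  proof -
    obtain u v t where "cpath X m w x u" "f = pcls X m w x u" "cpath X m x y v" "g = pcls X m x y v"
      "cpath X m y z t" "h = pcls X m y z t"
      using that' unfolding rigid_simps by blast
    then show ?thesis
      by (auto simp: rigid_mcomp cpath_append)
  qed
  have 4: "mcomp (rigid X) x y y m (degen (mhom (rigid X) y y) m (mid (rigid X) y)) f = f \<and>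
        mcomp (rigid X) x x y m f (degen (mhom (rigid X) x x) m (mid (rigid X) x)) = f"
    if xy: "x \<in> simps X 0" "y \<in> simps X 0" and that': "f \<in> simps (mhom (rigid X) x y) m" for x y m f
  proof -
    obtain u where "cpath X m x y u" "f = pcls X m x y u"
      using that' unfolding rigid_simps by blast
    then show ?thesis
      using xy by (auto simp: rigid_degen rigid_mcomp cpath_Nil)
  qed
  show ?thesis
    unfolding is_scat_def using is_sset_rigid_hom 1 2 3 4 by auto
qed

lemma rigid_unit_obj: "k \<le> p \<Longrightarrow> fst (rigid_unit X p s) k = vertex X p s k"
  by (simp add: rigid_unit_def)

lemma rigid_unit_hom: "k \<le> p \<Longrightarrow> l \<le> p \<Longrightarrow> T \<in> subset_chains k l m \<Longrightarrow>
   snd (rigid_unit X p s) k l m T = pcls X m (vertex X p s k) (vertex X p s l) [Gen p s k l T]"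
  by (simp add: rigid_unit_def pcls_def)

lemma rigid_unit_functor:
  assumes s: "s \<in> simps X p"
  shows "rigid_unit X p s \<in> sfunctors (cdelta p) (rigid X)"
proof (rule sfunctorsI)
  show "fst (rigid_unit X p s) \<in> extensional (obs (cdelta p))"
    by (simp add: rigid_unit_def)
  show "hom_restrict (cdelta p) (snd (rigid_unit X p s)) = snd (rigid_unit X p s)"
    by (simp add: rigid_unit_def)
  show "snd (rigid_unit X p s) k k 0 (mid (cdelta p) k) = mid (rigid X) (fst (rigid_unit X p s) k)"
    if "k \<in> obs (cdelta p)" for k
    using that s ccong_unit[of s p k 0]
    by (auto simp: rigid_unit_hom rigid_unit_obj chains_singleton rigid_mid intro!: pcls_eqI)
  show "snd (rigid_unit X p s) j l m (mcomp (cdelta p) j k l m U T) =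
       mcomp (rigid X) (fst (rigid_unit X p s) j) (fst (rigid_unit X p s) k) (fst (rigid_unit X p s) l)
        m (snd (rigid_unit X p s) k l m U) (snd (rigid_unit X p s) j k m T)"
    if "j \<in> obs (cdelta p)" "k \<in> obs (cdelta p)" "l \<in> obs (cdelta p)"
      "U \<in> simps (mhom (cdelta p) k l) m" "T \<in> simps (mhom (cdelta p) j k) m" for j k l m U T
  proof -
    have "ccong X m (vertex X p s j) (vertex X p s l) [Gen p s j l (cup m T U)]
       ([Gen p s j k T] @ [Gen p s k l U])"
      using ccong_sym[OF ccong_cup[of s p j k l T m U]] s that by auto
    from pcls_eqI[OF this] show ?thesis using s that
      by (simp add: rigid_unit_hom rigid_unit_obj chains_cup rigid_mcomp cpath_single)
  qed
qed (auto simp: s rigid_unit_obj rigid_unit_hom vertex_in X chains_compose rigid_act cpath_single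
       intro!: pcls_in)

lemma rigid_unit_act:
  assumes s: "s \<in> simps X q" and \<alpha>: "\<alpha> \<in> mon p q"
  shows "rigid_unit X p (act X p q \<alpha> s) = act (cnerve (rigid X)) p q \<alpha> (rigid_unit X q s)"
proof (rule cdelta_functor_eqI)
  show "rigid_unit X p (act X p q \<alpha> s) \<in> sfunctors (cdelta p) (rigid X)"
    by (intro rigid_unit_functor act_in X s \<alpha>)
  show "act (cnerve (rigid X)) p q \<alpha> (rigid_unit X q s) \<in> sfunctors (cdelta p) (rigid X)"
    by (intro act_cnerve_in rigid_unit_functor s \<alpha>)
qed (use s \<alpha> in \<open>auto simp: rigid_unit_obj rigid_unit_hom act_cnerve_obj act_cnerve_hom mon_le vertex_act X
  chains_img intro!: pcls_eqI ccong_img\<close>)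

text \<open>For a vertex the structure map of the colimit is constant at the identity, because
  \<^term>\<open>cdelta 0\<close> has only identities.\<close>

lemma rigid_unit_vertex:
  assumes v: "v \<in> simps X 0"
  shows "rigid_unit X 0 v = cnerve_obj (rigid X) v"
proof (rule prod_eqI)
  show "fst (rigid_unit X 0 v) = fst (cnerve_obj (rigid X) v)"
    using v by (auto simp: rigid_unit_def cnerve_obj_def vertex_0 X)
  have "pcls X m v v [Gen 0 v 0 0 T] = pcls X m v v []" if T: "T \<in> subset_chains 0 0 m" for m T
  proof -
    have "T a = {0}" if "a \<le> m" for a
      using chains_bounds[OF T that] chains_ends[OF T that] by auto
    then have "T = (\<lambda>_\<in>{..m}. {0})"
      using T by (intro extensionalityI[of _ "{..m}"]) (auto simp: chains_ext)
    then show ?thesis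
      using ccong_unit[of v 0 0 m] v by (auto intro!: pcls_eqI simp: vertex_0 X)
  qed
  then show "snd (rigid_unit X 0 v) = snd (cnerve_obj (rigid X) v)"
    unfolding rigid_unit_def cnerve_obj_def snd_conv
    by (intro hom_restrict_cong) (use v in \<open>simp add: pcls_def vertex_0 X rigid_degen\<close>)
qed

end

text \<open>The generating relations are natural in the simplicial set, so that a simplicial map induces a
  functor between the rigidifications that relabels the generators.\<close>

lemma ccong_map:
  assumes X: "is_sset X" and Y: "is_sset Y" and \<phi>: "\<phi> \<in> smaps X Y"
  shows "ccong X m x y u v \<Longrightarrow>
    ccong Y m (\<phi> 0 x) (\<phi> 0 y) (map (gen_map \<phi>) u) (map (gen_map \<phi>) v)"
proof -
  have vert: "\<phi> 0 (vertex X p s k) = vertex Y p (\<phi> p s) k" if "s \<in> simps X p" "k \<le> p" for p s k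
    using that by (simp add: vertex_def smaps_act[OF \<phi>] mon_const)
  have path: "cpath X m x y u \<Longrightarrow> cpath Y m (\<phi> 0 x) (\<phi> 0 y) (map (gen_map \<phi>) u)" for x y u
  proof (induction rule: cpath.induct)
    case (cpath_Nil x)
    then show ?case by (auto intro: cpath.cpath_Nil smaps_in[OF \<phi>])
  next
    case (cpath_Cons s p k l T y u)
    then show ?case by (auto intro!: cpath.cpath_Cons smaps_in[OF \<phi>] simp: vert)
  qed
  show "ccong X m x y u v \<Longrightarrow>
    ccong Y m (\<phi> 0 x) (\<phi> 0 y) (map (gen_map \<phi>) u) (map (gen_map \<phi>) v)"
  proof (induction rule: ccong.induct)
    case (ccong_refl x y u)
    then show ?case by (auto intro: ccong.ccong_refl path)
  next
    case (ccong_sym x y u v)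
    then show ?case by (auto intro: ccong.ccong_sym)
  next
    case (ccong_trans x y u v w)
    then show ?case by (auto intro: ccong.ccong_trans)
  next
    case (ccong_append x y u v z u' v')
    then show ?case by (auto intro: ccong.ccong_append)
  next
    case (ccong_operator s q \<alpha> p k l T)
    then show ?case
      by (auto simp: cdelta_map_hom vert mon_le smaps_act[OF \<phi>] smaps_in[OF \<phi>] intro!: ccong_img[OF Y])
  next
    case (ccong_comp s p j k l T U)
    then show ?case by (auto simp: vert smaps_in[OF \<phi>] intro!: ccong_cup[OF Y])
  next
    case (ccong_id s p k)
    then show ?case unfolding cdelta_degen
      by (auto simp: vert smaps_in[OF \<phi>] intro!: ccong_unit[OF Y])
  qed
qed

lemma rigid_map_pcls:
  assumes "is_sset X" "is_sset Y" "\<phi> \<in> smaps X Y" "cpath X m x y u"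
  shows "snd (rigid_map X Y \<phi>) x y m (pcls X m x y u) =
    pcls Y m (\<phi> 0 x) (\<phi> 0 y) (map (gen_map \<phi>) u)"
  using assms cpath_ends[of X m x y u]
  by (simp add: rigid_map_def pcls_in crel_image[of X] ccong_map)

subsection \<open>The universal property\<close>

text \<open>The composite in \<open>C\<close> of a path of generators, given where the simplices go. The object \<open>z\<close> is the
  image of the endpoint of the path, from which the value at the empty path is found.\<close>

fun ev :: "('o, 'm) scat \<Rightarrow> (nat \<Rightarrow> 'a \<Rightarrow> (nat, nat \<Rightarrow> nat set, 'o, 'm) sfun) \<Rightarrow> nat \<Rightarrow> 'o \<Rightarrow> 'a gen list \<Rightarrow> 'm"
  where
  "ev C g m z [] = degen (mhom C z z) m (mid C z)"
| "ev C g m z (Gen p s k l T # u) =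
     mcomp C (fst (g p s) k) (fst (g p s) l) z m (ev C g m z u) (snd (g p s) k l m T)"

context
  fixes X :: "'a sset" and C :: "('o, 'm) scat"
    and g :: "nat \<Rightarrow> 'a \<Rightarrow> (nat, nat \<Rightarrow> nat set, 'o, 'm) sfun"
  assumes X: "is_sset X" and C: "is_scat C" and g: "g \<in> smaps X (cnerve C)"
begin

abbreviation "ob x \<equiv> fst (g 0 x) 0"

lemma g_functor: "s \<in> simps X p \<Longrightarrow> g p s \<in> sfunctors (cdelta p) C"
  using smaps_in[OF g] by simp

lemma ob_in: "x \<in> simps X 0 \<Longrightarrow> ob x \<in> obs C"
  using functor_obj[OF g_functor] by simp

lemma ob_vertex: "s \<in> simps X p \<Longrightarrow> k \<le> p \<Longrightarrow> ob (vertex X p s k) = fst (g p s) k"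
  by (simp add: vertex_def smaps_act[OF g] mon_const act_cnerve_obj)

lemma g_obj_in: "s \<in> simps X p \<Longrightarrow> k \<le> p \<Longrightarrow> fst (g p s) k \<in> obs C"
  using functor_obj[OF g_functor] by simp

lemma g_hom_in: "s \<in> simps X p \<Longrightarrow> k \<le> p \<Longrightarrow> l \<le> p \<Longrightarrow> T \<in> subset_chains k l m \<Longrightarrow>
  snd (g p s) k l m T \<in> simps (mhom C (fst (g p s) k) (fst (g p s) l)) m"
  using functor_in[OF g_functor] by simp

lemma ev_in: "cpath X m x y u \<Longrightarrow> ev C g m (ob y) u \<in> simps (mhom C (ob x) (ob y)) m"
proof (induction rule: cpath.induct)
  case (cpath_Nil x)
  then show ?case by (simp add: scat_id_in C ob_in)
next
  case (cpath_Cons s p k l T y u)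
  then show ?case using cpath_ends[OF X cpath_Cons(5)]
    by (auto simp: ob_vertex intro!: scat_comp_in[OF C] g_obj_in ob_in g_hom_in)
qed

lemma ev_single: "s \<in> simps X p \<Longrightarrow> k \<le> p \<Longrightarrow> l \<le> p \<Longrightarrow> T \<in> subset_chains k l m \<Longrightarrow>
   ev C g m (fst (g p s) l) [Gen p s k l T] = snd (g p s) k l m T"
  by (simp add: scat_id_left[OF C] g_obj_in g_hom_in)

lemma ev_append:
  "cpath X m x y u \<Longrightarrow> cpath X m y z v \<Longrightarrow>
   ev C g m (ob z) (u @ v) = mcomp C (ob x) (ob y) (ob z) m (ev C g m (ob z) v) (ev C g m (ob y) u)"
proof (induction rule: cpath.induct)
  case (cpath_Nil x)
  then show ?case using cpath_ends[OF X cpath_Nil(2)] ev_in[OF cpath_Nil(2)]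
    by (simp add: scat_id_right[OF C] ob_in)
next
  case (cpath_Cons s p k l T y u)
  then show ?case
    using cpath_ends[OF X cpath_Cons(5)] cpath_ends[OF X cpath_Cons(7)] ev_in[OF cpath_Cons(5)]
      ev_in[OF cpath_Cons(7)]
    by (simp add: ob_vertex scat_assoc[OF C] ob_in g_obj_in g_hom_in)
qed

lemma ev_act:
  "cpath X m x y u \<Longrightarrow> \<beta> \<in> mon l m \<Longrightarrow>
   ev C g l (ob y) (map (gen_act l m \<beta>) u) = act (mhom C (ob x) (ob y)) l m \<beta> (ev C g m (ob y) u)"
proof (induction rule: cpath.induct)
  case (cpath_Nil x)
  then show ?case by (simp add: scat_id_act[OF C] ob_in)
next
  case (cpath_Cons s p k l' T y u)
  then show ?case
    using cpath_ends[OF X cpath_Cons(5)] ev_in[OF cpath_Cons(5)]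
      functor_act[OF g_functor[OF cpath_Cons(1)], of k l' T m \<beta> l]
    by (simp add: ob_vertex scat_comp_act[OF C] ob_in g_obj_in g_hom_in)
qed

text \<open>The relations of the rigidification hold in \<open>C\<close>: those for operators since \<open>g\<close> is a simplicial map,
  and those for composites and identities since its values are functors.\<close>

lemma ev_ccong: "ccong X m x y u v \<Longrightarrow> ev C g m (ob y) u = ev C g m (ob y) v"
proof (induction rule: ccong.induct)
  case (ccong_append x y u v z u' v')
  then show ?case
    using ccong_cpath[OF X ccong_append(1)] ccong_cpath[OF X ccong_append(2)]
    by (simp add: ev_append[of m x y _ z])
next
  case (ccong_operator s q \<alpha> p k l T)
  then show ?case
    using ev_single[of "act X p q \<alpha> s" p k l T m] ev_single[of s q "\<alpha> k" "\<alpha> l" "img \<alpha> m T" m]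
    by (simp add: cdelta_map_hom act_in X chains_img mon_le ob_vertex smaps_act[OF g]
       act_cnerve_obj act_cnerve_hom del: ev.simps)
next
  case (ccong_comp s p j k l T U)
  have "ev C g m (ob (vertex X p s l)) ([Gen p s j k T] @ [Gen p s k l U]) =
     mcomp C (fst (g p s) j) (fst (g p s) k) (fst (g p s) l) m (snd (g p s) k l m U) (snd (g p s) j k m T)"
    using ccong_comp
    by (subst ev_append[OF cpath_single[OF X] cpath_single[OF X]]) (auto simp: ob_vertex ev_single simp del: ev.simps)
  also have "\<dots> = ev C g m (ob (vertex X p s l)) [Gen p s j l (cup m T U)]"
    using ccong_comp functor_comp[OF g_functor[OF ccong_comp(1)], of j k l U m T]
    by (simp add: ob_vertex ev_single chains_cup del: ev.simps)
  finally show ?case by simp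
next
  case (ccong_id s p k)
  have "snd (g p s) k k m (degen (mhom (cdelta p) k k) m (mid (cdelta p) k)) =
     degen (mhom C (fst (g p s) k) (fst (g p s) k)) m (mid C (fst (g p s) k))"
    using ccong_id by (intro functor_id g_functor) (auto simp: chains_singleton)
  then show ?case unfolding cdelta_degen
    using ccong_id ev_single[of s p k k "\<lambda>_\<in>{..m}. {k}" m] by (simp add: ob_vertex chains_singleton)
qed auto

definition adj_functor :: "('a, 'a gen list set, 'o, 'm) sfun" where
  "adj_functor = (\<lambda>x\<in>simps X 0. ob x,
     hom_restrict (rigid X) (\<lambda>x y m c. ev C g m (ob y) (SOME u. u \<in> c)))"

lemma adj_functor_hom:
  assumes "cpath X m x y u"
  shows "snd adj_functor x y m (pcls X m x y u) = ev C g m (ob y) u"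
proof -
  have "u \<in> pcls X m x y u" using assms by (simp add: pcls_iff[OF X] ccong_refl)
  then have "(SOME v. v \<in> pcls X m x y u) \<in> pcls X m x y u" by (rule someI)
  then have "ev C g m (ob y) u = ev C g m (ob y) (SOME v. v \<in> pcls X m x y u)"
    by (intro ev_ccong) (simp add: pcls_iff[OF X])
  then show ?thesis using cpath_ends[OF X assms] pcls_in[OF X assms]
    by (simp add: adj_functor_def rigid_obs[OF X])
qed

lemma adj_functor_obj: "x \<in> simps X 0 \<Longrightarrow> fst adj_functor x = ob x"
  by (simp add: adj_functor_def)

lemma adj_functor_functor: "adj_functor \<in> sfunctors (rigid X) C"
proof (rule sfunctorsI)
  show "fst adj_functor \<in> extensional (obs (rigid X))"
    by (simp add: adj_functor_def rigid_obs[OF X])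
  show "hom_restrict (rigid X) (snd adj_functor) = snd adj_functor"
    by (simp add: adj_functor_def)
  fix x assume "x \<in> obs (rigid X)"
  then have x: "x \<in> simps X 0" by (simp add: rigid_obs[OF X])
  show "fst adj_functor x \<in> obs C"
    using x by (simp add: adj_functor_obj ob_in)
  show "snd adj_functor x x 0 (mid (rigid X) x) = mid C (fst adj_functor x)"
    using x by (simp add: rigid_mid[OF X] adj_functor_hom cpath_Nil adj_functor_obj degen_0
        scat_sset[OF C] scat_mid[OF C] ob_in)
  fix y assume "y \<in> obs (rigid X)"
  then have y: "y \<in> simps X 0" by (simp add: rigid_obs[OF X])
  show "snd adj_functor x y m c \<in> simps (mhom C (fst adj_functor x) (fst adj_functor y)) m"
    if "c \<in> simps (mhom (rigid X) x y) m" for m c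
    using that x y by (auto simp: rigid_simps[OF X] adj_functor_hom adj_functor_obj ev_in)
  show "snd adj_functor x y l (act (mhom (rigid X) x y) l m \<beta> c) =
      act (mhom C (fst adj_functor x) (fst adj_functor y)) l m \<beta> (snd adj_functor x y m c)"
    if "c \<in> simps (mhom (rigid X) x y) m" "\<beta> \<in> mon l m" for l m \<beta> c
    using that x y
    by (auto simp: rigid_simps[OF X] rigid_act[OF X] cpath_act[OF X] adj_functor_hom adj_functor_obj ev_act)
  fix z assume "z \<in> obs (rigid X)"
  then have z: "z \<in> simps X 0" by (simp add: rigid_obs[OF X])
  show "snd adj_functor x z m (mcomp (rigid X) x y z m d c) =
      mcomp C (fst adj_functor x) (fst adj_functor y) (fst adj_functor z) m
        (snd adj_functor y z m d) (snd adj_functor x y m c)"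
    if cd: "d \<in> simps (mhom (rigid X) y z) m" "c \<in> simps (mhom (rigid X) x y) m" for m d c
  proof -
    obtain u v where "cpath X m x y u" "c = pcls X m x y u" "cpath X m y z v" "d = pcls X m y z v"
      using cd unfolding rigid_simps[OF X] by blast
    then show ?thesis using x y z
      by (simp add: rigid_mcomp[OF X] adj_functor_hom cpath_append[OF X] adj_functor_obj ev_append)
  qed
qed

lemma adj_functor_unit:
  assumes s: "s \<in> simps X p"
  shows "sfun_comp (cdelta p) adj_functor (rigid_unit X p s) = g p s"
proof (rule cdelta_functor_eqI)
  show "sfun_comp (cdelta p) adj_functor (rigid_unit X p s) \<in> sfunctors (cdelta p) C"
    by (rule sfun_comp_sfunctors[OF rigid_unit_functor[OF X s] adj_functor_functor])
     (auto simp: chains_compose chains_cup chains_singleton)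
  show "g p s \<in> sfunctors (cdelta p) C" using s by (rule g_functor)
qed (auto simp: sfun_comp_obj sfun_comp_hom rigid_unit_obj rigid_unit_hom adj_functor_obj X vertex_in s
      ob_vertex adj_functor_hom cpath_single ev_single simp del: ev.simps)

text \<open>A functor is determined by its values on generators, since they generate all paths; the unit
  prescribes these values.\<close>

lemma adj_functor_unique:
  assumes G: "G \<in> sfunctors (rigid X) C"
    and unit: "\<And>p s. s \<in> simps X p \<Longrightarrow> sfun_comp (cdelta p) G (rigid_unit X p s) = g p s"
  shows "G = adj_functor"
proof (rule functor_eqI[OF G adj_functor_functor])
  have ob: "fst G x = ob x" if "x \<in> simps X 0" for x
    using that unit[OF that] sfun_comp_obj[of 0 "cdelta 0" G "rigid_unit X 0 x"]
    by (simp add: rigid_unit_obj X vertex_0)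
  show "fst G x = fst adj_functor x" if "x \<in> obs (rigid X)" for x
    using that by (simp add: rigid_obs[OF X] ob adj_functor_obj)
  have gen: "snd G (vertex X p s k) (vertex X p s l) m
      (pcls X m (vertex X p s k) (vertex X p s l) [Gen p s k l T]) = snd (g p s) k l m T"
    if "s \<in> simps X p" "k \<le> p" "l \<le> p" "T \<in> subset_chains k l m" for p s k l m T
    using that unit[OF that(1)] sfun_comp_hom[of k "cdelta p" l T m G "rigid_unit X p s"]
    by (simp add: rigid_unit_obj rigid_unit_hom X)
  have "snd G x y m (pcls X m x y u) = ev C g m (ob y) u" if "cpath X m x y u" for x y m u
    using that
  proof (induction rule: cpath.induct)
    case (cpath_Nil x)
    have "mid (rigid X) x \<in> simps (mhom (rigid X) x x) 0"
      using scat_mid[OF is_scat_rigid[OF X]] cpath_Nil by (simp add: rigid_obs[OF X])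
    then show ?case
      using functor_id[OF G, of x m] cpath_Nil by (simp add: rigid_obs[OF X] rigid_degen[OF X] ob)
  next
    case (cpath_Cons s p k l T y u)
    have in': "vertex X p s k \<in> simps X 0" "vertex X p s l \<in> simps X 0" "y \<in> simps X 0"
      using cpath_Cons cpath_ends[OF X cpath_Cons(5)] by (auto simp: vertex_in X)
    have c: "cpath X m (vertex X p s k) (vertex X p s l) [Gen p s k l T]"
      using cpath_Cons by (auto intro: cpath_single[OF X])
    have "snd G (vertex X p s k) y m (pcls X m (vertex X p s k) y ([Gen p s k l T] @ u)) =
      mcomp C (ob (vertex X p s k)) (ob (vertex X p s l)) (ob y) m (ev C g m (ob y) u) (snd (g p s) k l m T)"
      using functor_comp[OF G, of "vertex X p s k" "vertex X p s l" y "pcls X m (vertex X p s l) y u" m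
         "pcls X m (vertex X p s k) (vertex X p s l) [Gen p s k l T]"] in' c cpath_Cons
      by (simp add: rigid_obs[OF X] pcls_in[OF X] rigid_mcomp[OF X] ob gen)
    then show ?case using cpath_Cons by (simp add: ob_vertex)
  qed
  then show "snd G x y m c = snd adj_functor x y m c"
    if "c \<in> simps (mhom (rigid X) x y) m" for x y m c
    using that by (auto simp: rigid_simps[OF X] adj_functor_hom)
qed

lemma adjoint_functor_eq: "adjoint_functor X C g = adj_functor"
  unfolding adjoint_functor_def
proof (rule the_equality)
  show "adj_functor \<in> sfunctors (rigid X) C \<and>
    (\<forall>p. \<forall>s\<in>simps X p. sfun_comp (cdelta p) adj_functor (rigid_unit X p s) = g p s)"
    using adj_functor_functor adj_functor_unit by blast
qed (metis adj_functor_unique)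

lemma adjoint_functor_functor: "adjoint_functor X C g \<in> sfunctors (rigid X) C"
  by (simp add: adjoint_functor_eq adj_functor_functor)

lemma adjoint_functor_obj: "x \<in> simps X 0 \<Longrightarrow> fst (adjoint_functor X C g) x = fst (g 0 x) 0"
  by (simp add: adjoint_functor_eq adj_functor_obj)

lemma adjoint_functor_gen:
  "s \<in> simps X p \<Longrightarrow> k \<le> p \<Longrightarrow> l \<le> p \<Longrightarrow> T \<in> subset_chains k l m \<Longrightarrow>
   snd (adjoint_functor X C g) (vertex X p s k) (vertex X p s l) m
     (pcls X m (vertex X p s k) (vertex X p s l) [Gen p s k l T]) = snd (g p s) k l m T"
  by (simp add: adjoint_functor_eq adj_functor_hom cpath_single X ob_vertex ev_single del: ev.simps)

end

section \<open>Bipartite functors\<close>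

text \<open>The functor with prescribed values \<open>h\<close> on the chains that lead from vertices outside \<open>R\<close> to vertices
  in \<open>R\<close>. The predicate \<open>R\<close> is meant to be upward closed, so it cuts \<open>[p]\<close> into two segments, one sent to
  \<open>x\<close> and one to \<open>y\<close>. A pair of vertices on different sides in the other order has an empty mapping space.\<close>

definition bip_functor where
  "bip_functor C x y p R h = (\<lambda>k\<in>{..p}. if R k then y else x,
     hom_restrict (cdelta p) (\<lambda>k l m T.
       if R k = R l then (let z = if R k then y else x in degen (mhom C z z) m (mid C z))
       else h k l m T))"

text \<open>A simplex of the coherent nerve that is constant on each of the two segments into which \<open>R\<close> cuts the
  vertices. All values of the simplices of the three mapping spaces have this form.\<close>

definition bipartite where
  "bipartite C x y p R G \<longleftrightarrow> G \<in> sfunctors (cdelta p) C \<and>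
     (\<forall>k\<le>p. fst G k = (if R k then y else x)) \<and>
     (\<forall>k l m T. l \<le> p \<longrightarrow> T \<in> subset_chains k l m \<longrightarrow> R k = R l \<longrightarrow>
        snd G k l m T = (let z = if R k then y else x in degen (mhom C z z) m (mid C z)))"

lemma bipartite_functor: "bipartite C x y p R G \<Longrightarrow> G \<in> sfunctors (cdelta p) C"
  and bipartite_obj: "bipartite C x y p R G \<Longrightarrow> k \<le> p \<Longrightarrow> fst G k = (if R k then y else x)"
  and bipartite_same: "bipartite C x y p R G \<Longrightarrow> l \<le> p \<Longrightarrow> T \<in> subset_chains k l m \<Longrightarrow> R k = R l \<Longrightarrow>
        snd G k l m T = (let z = if R k then y else x in degen (mhom C z z) m (mid C z))"
  unfolding bipartite_def by blast+

lemma bip_functor_hom: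
  "k \<le> p \<Longrightarrow> l \<le> p \<Longrightarrow> T \<in> subset_chains k l m \<Longrightarrow> \<not> R k \<Longrightarrow> R l \<Longrightarrow>
   snd (bip_functor C x y p R h) k l m T = h k l m T"
  by (simp add: bip_functor_def)

lemma bip_functor_cong:
  assumes "\<And>k. k \<le> p \<Longrightarrow> R k = R' k" "\<And>j k. j \<le> k \<Longrightarrow> k \<le> p \<Longrightarrow> R j \<Longrightarrow> R k"
    and "\<And>k l m T. l \<le> p \<Longrightarrow> T \<in> subset_chains k l m \<Longrightarrow> \<not> R k \<Longrightarrow> R l \<Longrightarrow> h k l m T = h' k l m T"
  shows "bip_functor C x y p R h = bip_functor C x y p R' h'"
proof (rule prod_eqI)
  show "fst (bip_functor C x y p R h) = fst (bip_functor C x y p R' h')"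
    using assms(1) by (auto simp: bip_functor_def)
  show "snd (bip_functor C x y p R h) = snd (bip_functor C x y p R' h')"
    unfolding bip_functor_def snd_conv
  proof (rule hom_restrict_cong)
    fix k l m T assume "k \<in> obs (cdelta p)" "l \<in> obs (cdelta p)" "T \<in> simps (mhom (cdelta p) k l) m"
    then have kl: "k \<le> p" "l \<le> p" "T \<in> subset_chains k l m" by auto
    then have "R k = R l \<or> \<not> R k \<and> R l" using assms(2)[of k l] chains_le[of T k l m] by auto
    then show "(if R k = R l then let z = if R k then y else x in degen (mhom C z z) m (mid C z) else h k l m T) =
      (if R' k = R' l then let z = if R' k then y else x in degen (mhom C z z) m (mid C z) else h' k l m T)"
      using assms(1)[of k] assms(1)[of l] assms(3)[of l T k m] kl by auto
  qed
qed

lemma act_bip_functor: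
  assumes "\<alpha> \<in> mon m n"
  shows "act (cnerve C) m n \<alpha> (bip_functor C x y n R h) =
    bip_functor C x y m (\<lambda>k. R (\<alpha> k)) (\<lambda>k l q T. h (\<alpha> k) (\<alpha> l) q (img \<alpha> q T))"
proof (rule prod_eqI)
  show "fst (act (cnerve C) m n \<alpha> (bip_functor C x y n R h)) =
     fst (bip_functor C x y m (\<lambda>k. R (\<alpha> k)) (\<lambda>k l q T. h (\<alpha> k) (\<alpha> l) q (img \<alpha> q T)))"
    using assms by (auto simp: cnerve_def sfun_comp_def bip_functor_def compose_def fun_eq_iff mon_le)
  show "snd (act (cnerve C) m n \<alpha> (bip_functor C x y n R h)) =
     snd (bip_functor C x y m (\<lambda>k. R (\<alpha> k)) (\<lambda>k l q T. h (\<alpha> k) (\<alpha> l) q (img \<alpha> q T)))"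
    unfolding cnerve_def sfun_comp_def bip_functor_def sset.simps snd_conv
    by (intro hom_restrict_cong) (use assms in \<open>simp add: cdelta_map_hom chains_img mon_le\<close>)
qed

lemma degen_0_cnerve_obj: "degen (cnerve C) 0 (cnerve_obj C z) = cnerve_obj C z"
proof -
  have 0: "cnerve_obj C z = bip_functor C z z 0 (\<lambda>_. False) (\<lambda>_ _ _ _. undefined)"
    by (simp add: cnerve_obj_def bip_functor_def)
  show ?thesis unfolding degen_def 0 act_bip_functor[OF mon_const[OF order_refl]] ..
qed

context
  fixes C :: "('o, 'm) scat" and x y :: 'o
  assumes C: "is_scat C" and x: "x \<in> obs C" and y: "y \<in> obs C"
begin

text \<open>In every composite at least one factor is sent to an identity. Hence functoriality reduces to the conditions
  that \<open>h\<close> ignores a piece of the chain inside the first segment when it is put in front, and a piece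
  inside the second segment when it is put behind. These two conditions are exchanged by reversal.\<close>

lemma bipartite_bip_functor:
  assumes R: "\<And>j k. j \<le> k \<Longrightarrow> k \<le> p \<Longrightarrow> R j \<Longrightarrow> R k"
    and h_in: "\<And>k l m T. l \<le> p \<Longrightarrow> \<not> R k \<Longrightarrow> R l \<Longrightarrow> T \<in> subset_chains k l m \<Longrightarrow>
      h k l m T \<in> simps (mhom C x y) m"
    and h_act: "\<And>k l m n T \<beta>. l \<le> p \<Longrightarrow> \<not> R k \<Longrightarrow> R l \<Longrightarrow> T \<in> subset_chains k l m \<Longrightarrow> \<beta> \<in> mon n m \<Longrightarrow>
      h k l n (compose {..n} T \<beta>) = act (mhom C x y) n m \<beta> (h k l m T)"
    and h_left: "\<And>j k l m T U. l \<le> p \<Longrightarrow> \<not> R j \<Longrightarrow> \<not> R k \<Longrightarrow> R l \<Longrightarrow>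
      T \<in> subset_chains j k m \<Longrightarrow> U \<in> subset_chains k l m \<Longrightarrow> h j l m (cup m T U) = h k l m U"
    and h_right: "\<And>j k l m T U. l \<le> p \<Longrightarrow> \<not> R j \<Longrightarrow> R k \<Longrightarrow> R l \<Longrightarrow>
      T \<in> subset_chains j k m \<Longrightarrow> U \<in> subset_chains k l m \<Longrightarrow> h j l m (cup m T U) = h j k m T"
  shows "bipartite C x y p R (bip_functor C x y p R h)"
proof -
  let ?G = "bip_functor C x y p R h"
  have obj: "fst ?G k = (if R k then y else x)" if "k \<le> p" for k
    using that by (simp add: bip_functor_def)
  have same: "snd ?G k l m T = (let z = if R k then y else x in degen (mhom C z z) m (mid C z))"
    if "l \<le> p" "T \<in> subset_chains k l m" "R k = R l" for k l m T
    using that chains_le[OF that(2)] by (simp add: bip_functor_def)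
  have mixed: "snd ?G k l m T = h k l m T"
    if "l \<le> p" "T \<in> subset_chains k l m" "\<not> R k" "R l" for k l m T
    using that chains_le[OF that(2)] by (simp add: bip_functor_def)
  have cases: "(R k = R l) \<or> \<not> R k \<and> R l" if "l \<le> p" "T \<in> subset_chains k l m" for k l m T
    using R[of k l] that chains_le[OF that(2)] by auto
  have "?G \<in> sfunctors (cdelta p) C"
  proof (rule sfunctorsI)
    show "fst ?G \<in> extensional (obs (cdelta p))" by (simp add: bip_functor_def)
    show "hom_restrict (cdelta p) (snd ?G) = snd ?G" by (simp add: bip_functor_def)
    show "fst ?G k \<in> obs C" if "k \<in> obs (cdelta p)" for k
      using that x y by (simp add: obj)
    show "snd ?G k l m T \<in> simps (mhom C (fst ?G k) (fst ?G l)) m"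
      if "k \<in> obs (cdelta p)" "l \<in> obs (cdelta p)" "T \<in> simps (mhom (cdelta p) k l) m" for k l m T
      using that cases[of l T k m] x y
      by (auto simp: obj same mixed h_in Let_def scat_id_in[OF C])
    show "snd ?G k l n (act (mhom (cdelta p) k l) n m \<beta> T) =
       act (mhom C (fst ?G k) (fst ?G l)) n m \<beta> (snd ?G k l m T)"
      if "k \<in> obs (cdelta p)" "l \<in> obs (cdelta p)" "T \<in> simps (mhom (cdelta p) k l) m"
        "\<beta> \<in> mon n m" for k l n m \<beta> T
      using that cases[of l T k m] x y
      by (auto simp: obj same mixed h_act Let_def scat_id_act[OF C] chains_compose)
    show "snd ?G k k 0 (mid (cdelta p) k) = mid C (fst ?G k)" if "k \<in> obs (cdelta p)" for k
      using that x y
      by (auto simp: same chains_singleton obj Let_def degen_0 scat_sset[OF C] scat_mid[OF C])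
    show "snd ?G j l m (mcomp (cdelta p) j k l m U T) =
       mcomp C (fst ?G j) (fst ?G k) (fst ?G l) m (snd ?G k l m U) (snd ?G j k m T)"
      if "j \<in> obs (cdelta p)" "k \<in> obs (cdelta p)" "l \<in> obs (cdelta p)"
        "U \<in> simps (mhom (cdelta p) k l) m" "T \<in> simps (mhom (cdelta p) j k) m" for j k l m U T
      using that x y cases[of l U k m] cases[of k T j m] chains_cup[of T j k m U l]
      by (auto simp: obj same mixed Let_def scat_id_left[OF C] scat_id_right[OF C] scat_id_in[OF C]
          h_left h_right h_in)
  qed
  then show ?thesis using obj same by (simp add: bipartite_def)
qed

lemma bipartite_hom_in:
  assumes "bipartite C x y p R G" "l \<le> p" "T \<in> subset_chains k l m" "\<not> R k" "R l"
  shows "snd G k l m T \<in> simps (mhom C x y) m"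
  using assms functor_in[of G "cdelta p" C k l T m] chains_le[of T k l m]
  by (auto simp: bipartite_def)

lemma bipartite_hom_act:
  assumes "bipartite C x y p R G" "l \<le> p" "T \<in> subset_chains k l m" "\<not> R k" "R l" "\<beta> \<in> mon n m"
  shows "snd G k l n (compose {..n} T \<beta>) = act (mhom C x y) n m \<beta> (snd G k l m T)"
  using assms functor_act[of G "cdelta p" C k l T m \<beta> n] chains_le[of T k l m]
  by (auto simp: bipartite_def)

lemma bipartite_hom_cup:
  assumes "bipartite C x y p R G" "l \<le> p" "T \<in> subset_chains j k m" "U \<in> subset_chains k l m"
    "\<not> R j" "R l"
  shows "snd G j l m (cup m T U) = (if R k then snd G j k m T else snd G k l m U)"
proof -
  have le: "j \<le> k" "k \<le> l" using assms chains_le by auto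
  have G: "G \<in> sfunctors (cdelta p) C" using assms(1) by (simp add: bipartite_def)
  have "snd G j l m (cup m T U) =
     mcomp C (fst G j) (fst G k) (fst G l) m (snd G k l m U) (snd G j k m T)"
    using functor_comp[OF G, of j k l U m T] assms le by simp
  then show ?thesis
    using assms le x y bipartite_hom_in[OF assms(1), of l U k m] bipartite_hom_in[OF assms(1), of k T j m]
    by (auto simp: bipartite_def Let_def scat_id_left[OF C] scat_id_right[OF C])
qed

lemma bipartite_eqI:
  assumes "bipartite C x y p R G" "bipartite C x y p R H"
    and R: "\<And>j k. j \<le> k \<Longrightarrow> k \<le> p \<Longrightarrow> R j \<Longrightarrow> R k"
    and eq: "\<And>k l m T. l \<le> p \<Longrightarrow> \<not> R k \<Longrightarrow> R l \<Longrightarrow> T \<in> subset_chains k l m \<Longrightarrow>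
      snd G k l m T = snd H k l m T"
  shows "G = H"
proof (rule cdelta_functor_eqI)
  show "G \<in> sfunctors (cdelta p) C" "H \<in> sfunctors (cdelta p) C"
    using assms(1,2) by (auto simp: bipartite_def)
  show "fst G k = fst H k" if "k \<le> p" for k
    using assms(1,2) that by (auto simp: bipartite_def)
  show "snd G k l m T = snd H k l m T" if "k \<le> l" "l \<le> p" "T \<in> subset_chains k l m" for k l m T
  proof (cases "R k = R l")
    case True
    then show ?thesis using bipartite_same[OF assms(1) that(2,3)] bipartite_same[OF assms(2) that(2,3)]
      by simp
  next
    case False
    then have "\<not> R k" "R l" using R[OF that(1,2)] by blast+
    then show ?thesis using eq that by blast
  qed
qed

text \<open>If all vertices are on the same side then there are no mixed chains, and the only bipartite functor
  is the constant one.\<close>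

lemma bipartite_const_iff:
  assumes R: "\<And>k. k \<le> p \<Longrightarrow> R k = c"
  shows "bipartite C x y p R G \<longleftrightarrow> G = degen (cnerve C) p (cnerve_obj C (if c then y else x))"
proof -
  let ?D = "degen (cnerve C) p (cnerve_obj C (if c then y else x))"
  have no_mixed: False if "l \<le> p" "\<not> R k" "R l" "T \<in> subset_chains k l m" for k l m T
    using that chains_le[OF that(4)] R[of k] R[of l] by auto
  have mono: "R k" if "j \<le> k" "k \<le> p" "R j" for j k
    using that R[of j] R[of k] by auto
  have 0: "cnerve_obj C (if c then y else x) = bip_functor C x y 0 (\<lambda>_. c) (\<lambda>_ _ _ _. undefined)"
    by (simp add: cnerve_obj_def bip_functor_def)
  have D: "?D = bip_functor C x y p R (\<lambda>_ _ _ _. undefined)"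
    unfolding degen_def 0 act_bip_functor[OF mon_const[OF order_refl]]
    by (rule bip_functor_cong) (simp_all add: R)
  have *: "bipartite C x y p R ?D"
    unfolding D by (rule bipartite_bip_functor) (use mono no_mixed in blast)+
  moreover have "G = ?D" if "bipartite C x y p R G"
    using that * by (rule bipartite_eqI) (use mono no_mixed in blast)+
  ultimately show ?thesis by blast
qed

text \<open>Precomposition with the reversal of chains on the mixed mapping spaces only. The objects stay where
  they are: the vertices \<open>p - l\<close> and \<open>p - k\<close> are again sent to \<open>x\<close> and \<open>y\<close> if the sides of \<open>G\<close> are the
  reflected ones.\<close>

definition flip_functor where
  "flip_functor p R G = bip_functor C x y p R (\<lambda>k l m T. snd G (p - l) (p - k) m (rev_chain p m T))"

lemma flip_functor_hom:
  "l \<le> p \<Longrightarrow> T \<in> subset_chains k l m \<Longrightarrow> \<not> R k \<Longrightarrow> R l \<Longrightarrow>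
   snd (flip_functor p R G) k l m T = snd G (p - l) (p - k) m (rev_chain p m T)"
  using chains_le[of T k l m] by (simp add: flip_functor_def bip_functor_hom)

lemma flip_functor_cong:
  assumes "\<And>k. k \<le> p \<Longrightarrow> R k = R' k" "\<And>j k. j \<le> k \<Longrightarrow> k \<le> p \<Longrightarrow> R j \<Longrightarrow> R k"
  shows "flip_functor p R G = flip_functor p R' G"
  unfolding flip_functor_def using assms by (intro bip_functor_cong) auto

text \<open>Although reversal exchanges the order of composition, the flipped functor is a functor into the same
  category \<open>C\<close> and not into its opposite, because a composite in which at least one factor is an identity
  does not depend on the order.\<close>

lemma bipartite_flip_functor:
  assumes G: "bipartite C x y p R' G" and R': "\<And>k. k \<le> p \<Longrightarrow> R' k \<longleftrightarrow> \<not> R (p - k)"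
    and R: "\<And>j k. j \<le> k \<Longrightarrow> k \<le> p \<Longrightarrow> R j \<Longrightarrow> R k"
  shows "bipartite C x y p R (flip_functor p R G)"
  unfolding flip_functor_def
proof (rule bipartite_bip_functor[OF R])
  show "snd G (p - l) (p - k) m (rev_chain p m T) \<in> simps (mhom C x y) m"
    if "l \<le> p" "\<not> R k" "R l" "T \<in> subset_chains k l m" for k l m T
    using that chains_le[OF that(4)]
    by (intro bipartite_hom_in[OF G]) (auto simp: R' rev_chain_chains)
  show "snd G (p - l) (p - k) n (rev_chain p n (compose {..n} T \<beta>)) =
       act (mhom C x y) n m \<beta> (snd G (p - l) (p - k) m (rev_chain p m T))"
    if "l \<le> p" "\<not> R k" "R l" "T \<in> subset_chains k l m" "\<beta> \<in> mon n m" for k l m n T \<beta>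
    using that chains_le[OF that(4)] bipartite_hom_act[OF G _ rev_chain_chains[OF that(4,1)], of \<beta> n]
    by (simp add: R' img_compose)
  have rev_cup: "rev_chain p m (cup m T U) = cup m (rev_chain p m U) (rev_chain p m T)" for m T U
    by (auto simp: img_def cup_def fun_eq_iff)
  show "snd G (p - l) (p - j) m (rev_chain p m (cup m T U)) = snd G (p - l) (p - k) m (rev_chain p m U)"
    if "l \<le> p" "\<not> R j" "\<not> R k" "R l" "T \<in> subset_chains j k m" "U \<in> subset_chains k l m" for j k l m T U
    using that chains_le[OF that(5)] chains_le[OF that(6)]
    by (simp add: rev_cup bipartite_hom_cup[OF G _ rev_chain_chains rev_chain_chains] R')
  show "snd G (p - l) (p - j) m (rev_chain p m (cup m T U)) = snd G (p - k) (p - j) m (rev_chain p m T)"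
    if "l \<le> p" "\<not> R j" "R k" "R l" "T \<in> subset_chains j k m" "U \<in> subset_chains k l m" for j k l m T U
    using that chains_le[OF that(5)] chains_le[OF that(6)]
    by (simp add: rev_cup bipartite_hom_cup[OF G _ rev_chain_chains rev_chain_chains] R')
qed auto

lemma flip_flip_functor:
  assumes G: "bipartite C x y p R' G" and R': "\<And>k. k \<le> p \<Longrightarrow> R' k \<longleftrightarrow> \<not> R (p - k)"
    and R: "\<And>j k. j \<le> k \<Longrightarrow> k \<le> p \<Longrightarrow> R j \<Longrightarrow> R k"
  shows "flip_functor p R' (flip_functor p R G) = G"
proof (rule bipartite_eqI)
  have R2: "R k \<longleftrightarrow> \<not> R' (p - k)" if "k \<le> p" for k using R'[of "p - k"] that by simp
  show mono': "R' k" if "j \<le> k" "k \<le> p" "R' j" for j k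
    using that R[of "p - k" "p - j"] diff_le_mono2[of j k p] by (auto simp: R')
  show "bipartite C x y p R' (flip_functor p R' (flip_functor p R G))"
    by (rule bipartite_flip_functor[OF bipartite_flip_functor[OF G]]) (use R R' R2 mono' in blast)+
  show "bipartite C x y p R' G" by (rule G)
  show "snd (flip_functor p R' (flip_functor p R G)) k l m T = snd G k l m T"
    if "l \<le> p" "\<not> R' k" "R' l" "T \<in> subset_chains k l m" for k l m T
    using that chains_le[OF that(4)]
    by (simp add: flip_functor_hom rev_chain_chains rev_chain_rev_chain R')
qed

lemma act_flip_functor:
  assumes \<alpha>: "\<alpha> \<in> mon p q" and R: "\<And>j k. j \<le> k \<Longrightarrow> k \<le> q \<Longrightarrow> R j \<Longrightarrow> R k"
  shows "act (cnerve C) p q \<alpha> (flip_functor q R G) =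
    flip_functor p (\<lambda>k. R (\<alpha> k)) (act (cnerve C) p q (reflect p q \<alpha>) G)"
  unfolding flip_functor_def act_bip_functor[OF \<alpha>]
proof (rule bip_functor_cong)
  fix k l m T assume T: "l \<le> p" "T \<in> subset_chains k l m"
  show "snd G (q - \<alpha> l) (q - \<alpha> k) m (rev_chain q m (img \<alpha> m T)) =
    snd (act (cnerve C) p q (reflect p q \<alpha>) G) (p - l) (p - k) m (rev_chain p m T)"
    using T chains_le[OF T(2)] \<alpha>
    by (simp add: act_cnerve_hom rev_chain_chains img_reflect)
next
  show "R (\<alpha> k)" if "j \<le> k" "k \<le> p" "R (\<alpha> j)" for j k
    using R[of "\<alpha> j" "\<alpha> k"] mon_mono[OF \<alpha> that(1,2)] mon_le[OF \<alpha> that(2)] that by blast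
qed (rule refl)

end

section \<open>Quotients of simplicial sets\<close>

context
  fixes X :: "'a sset" and R :: "nat \<Rightarrow> ('a \<times> 'a) set"
  assumes X: "is_sset X" and R: "\<And>m. equiv (simps X m) (R m)"
    and R_act: "\<And>l m \<beta> s t. \<beta> \<in> mon l m \<Longrightarrow> (s, t) \<in> R m \<Longrightarrow> (act X l m \<beta> s, act X l m \<beta> t) \<in> R l"
begin

lemma quot_simps: "simps (quot X R) m = (\<lambda>s. R m `` {s}) ` simps X m"
  by (auto simp: quot_def quotient_def)

lemma quot_simpsI: "s \<in> simps X m \<Longrightarrow> R m `` {s} \<in> simps (quot X R) m"
  by (simp add: quot_simps)

lemma quot_eq_iff: "s \<in> simps X m \<Longrightarrow> t \<in> simps X m \<Longrightarrow> R m `` {s} = R m `` {t} \<longleftrightarrow> (s, t) \<in> R m"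
  by (simp add: eq_equiv_class_iff[OF R])

lemma quot_self: "s \<in> simps X m \<Longrightarrow> s \<in> R m `` {s}"
  by (rule equiv_class_self[OF R])

lemma quot_act:
  assumes \<beta>: "\<beta> \<in> mon l m" and s: "s \<in> simps X m"
  shows "act (quot X R) l m \<beta> (R m `` {s}) = R l `` {act X l m \<beta> s}"
proof -
  have "R l `` {act X l m \<beta> t} = R l `` {act X l m \<beta> s}" if "t \<in> R m `` {s}" for t
    using that R_act[OF \<beta>, of s t] equiv_class_eq[OF R, of "act X l m \<beta> s" "act X l m \<beta> t" l] by auto
  then have "(\<Union>t\<in>R m `` {s}. R l `` {act X l m \<beta> t}) = R l `` {act X l m \<beta> s}"
    using quot_self[OF s] by blast
  moreover have "act (quot X R) l m \<beta> (R m `` {s}) = (\<Union>t\<in>R m `` {s}. R l `` {act X l m \<beta> t})"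
    by (auto simp: quot_def)
  ultimately show ?thesis by simp
qed

lemma is_sset_quot: "is_sset (quot X R)"
  unfolding is_sset_def
proof (intro conjI allI ballI)
  fix m n \<alpha> c assume "\<alpha> \<in> mon m n" "c \<in> simps (quot X R) n"
  then show "act (quot X R) m n \<alpha> c \<in> simps (quot X R) m"
    by (auto simp: quot_simps quot_act act_in X)
next
  fix n c assume "c \<in> simps (quot X R) n"
  then show "act (quot X R) n n (\<lambda>k\<in>{..n}. k) c = c"
    by (auto simp only: quot_simps quot_act mon_id act_id[OF X])
next
  fix l m n \<alpha> \<beta> c assume "\<beta> \<in> mon l m" "\<alpha> \<in> mon m n" "c \<in> simps (quot X R) n"
  then show "act (quot X R) l m \<beta> (act (quot X R) m n \<alpha> c) =
    act (quot X R) l n (compose {..l} \<alpha> \<beta>) c"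
    by (auto simp: quot_simps quot_act act_in X mon_comp act_act)
qed

lemma descend_class:
  assumes "\<And>t. (s, t) \<in> R m \<Longrightarrow> g m t = g m s" and s: "s \<in> simps X m"
  shows "descend X R g m (R m `` {s}) = g m s"
proof -
  have "g m t = g m s" if "t \<in> R m `` {s}" for t using assms(1) that by blast
  then have "g m ` (R m `` {s}) = {g m s}" using quot_self[OF s] by blast
  then show ?thesis using s by (simp add: descend_def quot_simpsI)
qed

lemma descend_smaps:
  assumes g: "g \<in> smaps X Y" and eq: "\<And>m s t. (s, t) \<in> R m \<Longrightarrow> g m t = g m s"
  shows "descend X R g \<in> smaps (quot X R) Y"
proof (rule smapsI)
  have d: "descend X R g m (R m `` {s}) = g m s" if "s \<in> simps X m" for m s
    using eq that by (rule descend_class)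
  show "descend X R g n \<in> extensional (simps (quot X R) n)" for n by (simp add: descend_def)
  show "descend X R g n c \<in> simps Y n" if "c \<in> simps (quot X R) n" for n c
    using that by (auto simp: quot_simps d smaps_in[OF g])
  show "descend X R g m (act (quot X R) m n \<alpha> c) = act Y m n \<alpha> (descend X R g n c)"
    if "\<alpha> \<in> mon m n" "c \<in> simps (quot X R) n" for m n \<alpha> c
    using that by (auto simp: quot_simps quot_act d act_in X smaps_act[OF g])
qed

end

section \<open>Bipartite simplicial sets\<close>

text \<open>A simplicial set with a map to \<open>\<Delta>\<^sup>1\<close>, presented by the side of each vertex of each simplex, and a
  vertex over each of the two ends. Joins \<open>\<Delta>\<^sup>i * \<Delta>\<^sup>j\<close> and cylinders \<open>\<Delta>\<^sup>n \<times> \<Delta>\<^sup>1\<close> are the examples. Both \<open>J\<close> and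
  the suspension arise by collapsing the two fibres, and all that is needed about them is true at this
  level of generality.\<close>

locale bipartite_sset =
  fixes X :: "'a sset" and side :: "'a \<Rightarrow> nat \<Rightarrow> bool" and a0 a1 :: 'a
  assumes X: "is_sset X"
    and side_act: "\<alpha> \<in> mon m n \<Longrightarrow> s \<in> simps X n \<Longrightarrow> k \<le> m \<Longrightarrow> side (act X m n \<alpha> s) k = side s (\<alpha> k)"
    and side_mono: "s \<in> simps X n \<Longrightarrow> j \<le> k \<Longrightarrow> k \<le> n \<Longrightarrow> side s j \<Longrightarrow> side s k"
    and a0: "a0 \<in> simps X 0" "\<not> side a0 0"
    and a1: "a1 \<in> simps X 0" "side a1 0"
begin

definition part :: "bool \<Rightarrow> nat \<Rightarrow> 'a set" where
  "part c m = {s \<in> simps X m. \<forall>k\<le>m. side s k = c}"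

definition R :: "nat \<Rightarrow> ('a \<times> 'a) set" where
  "R = collapse_rel X (part False) (part True)"

definition q :: "nat \<Rightarrow> 'a \<Rightarrow> 'a set" where
  "q m s = R m `` {s}"

abbreviation Q :: "'a set sset" where
  "Q \<equiv> quot X R"

abbreviation v0 where "v0 \<equiv> q 0 a0"
abbreviation v1 where "v1 \<equiv> q 0 a1"

lemma R_iff: "(s, t) \<in> R m \<longleftrightarrow> s \<in> simps X m \<and> t \<in> simps X m \<and> (s = t \<or> (\<exists>c. s \<in> part c m \<and> t \<in> part c m))"
  by (auto simp: R_def collapse_rel_def ex_bool_eq)

lemma part_unique: "s \<in> part c m \<Longrightarrow> s \<in> part d m \<Longrightarrow> c = d"
  by (auto simp: part_def)

lemma part_act: "s \<in> part c m \<Longrightarrow> \<beta> \<in> mon l m \<Longrightarrow> act X l m \<beta> s \<in> part c l"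
  by (auto simp: part_def act_in X side_act mon_le)

lemma R_equiv: "equiv (simps X m) (R m)"
proof (rule equivI)
  show "R m \<subseteq> simps X m \<times> simps X m" by (auto simp: R_iff)
  show "refl_on (simps X m) (R m)" by (auto simp: refl_on_def R_iff)
  show "sym (R m)" by (auto simp: sym_def R_iff)
  show "trans (R m)" using part_unique unfolding trans_def R_iff by blast
qed

lemma R_act: "\<beta> \<in> mon l m \<Longrightarrow> (s, t) \<in> R m \<Longrightarrow> (act X l m \<beta> s, act X l m \<beta> t) \<in> R l"
  unfolding R_iff using part_act act_in[OF X] by blast

lemma Q: "is_sset Q"
  by (rule is_sset_quot[OF X R_equiv R_act])

lemma Q_simps: "simps Q m = q m ` simps X m"
  by (simp add: quot_simps[OF X R_equiv R_act] q_def)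

lemma q_in: "s \<in> simps X m \<Longrightarrow> q m s \<in> simps Q m"
  by (simp add: Q_simps)

lemma q_eq_iff: "s \<in> simps X m \<Longrightarrow> t \<in> simps X m \<Longrightarrow> q m s = q m t \<longleftrightarrow> (s, t) \<in> R m"
  unfolding q_def by (rule quot_eq_iff[OF X R_equiv R_act])

lemma act_q: "\<beta> \<in> mon l m \<Longrightarrow> s \<in> simps X m \<Longrightarrow> act Q l m \<beta> (q m s) = q l (act X l m \<beta> s)"
  unfolding q_def by (rule quot_act[OF X R_equiv R_act])

lemma q_vertex: "s \<in> simps X 0 \<Longrightarrow> q 0 s = (if side s 0 then v1 else v0)"
  using a0 a1 by (auto simp: q_eq_iff R_iff part_def)

lemma v_in: "v0 \<in> simps Q 0" "v1 \<in> simps Q 0"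
  using a0 a1 by (auto simp: q_in)

lemma v0_v1: "v0 \<noteq> v1"
  using a0 a1 by (auto simp: q_eq_iff R_iff part_def)

lemma vertex_q:
  assumes "s \<in> simps X p" "k \<le> p"
  shows "vertex Q p (q p s) k = (if side s k then v1 else v0)"
proof -
  have "vertex Q p (q p s) k = q 0 (act X 0 p (constm 0 k) s)"
    using assms by (simp add: vertex_def act_q mon_const)
  then show ?thesis using assms by (simp add: q_vertex act_in X mon_const side_act)
qed

text \<open>These are the maps from the collapsed simplicial set to the coherent nerve that send its two points
  to \<open>x\<close> and \<open>y\<close>.\<close>

definition bip_maps where
  "bip_maps C x y = {g \<in> smaps X (cnerve C). \<forall>c m. \<forall>s\<in>part c m.
     g m s = degen (cnerve C) m (cnerve_obj C (if c then y else x))}"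

lemma bip_maps_smaps: "g \<in> bip_maps C x y \<Longrightarrow> g \<in> smaps X (cnerve C)"
  by (simp add: bip_maps_def)

context
  fixes C :: "('o, 'm) scat" and x y :: 'o
  assumes C: "is_scat C" and x: "x \<in> obs C" and y: "y \<in> obs C"
begin

text \<open>The condition on the two fibres determines the values of the functor \<open>g p s\<close> on every chain between
  vertices \<open>k \<le> l\<close> on the same side: the face of \<open>s\<close> spanned by \<open>k, \<dots>, l\<close> lies in a fibre.\<close>

lemma bip_maps_bipartite:
  assumes g: "g \<in> bip_maps C x y" and s: "s \<in> simps X p"
  shows "bipartite C x y p (side s) (g p s)"
proof -
  have gs: "g \<in> smaps X (cnerve C)" using g by (rule bip_maps_smaps)
  have const: "bipartite C x y m (side t) (g m t)" if "t \<in> part c m" for t c m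
  proof -
    have "g m t = degen (cnerve C) m (cnerve_obj C (if c then y else x))"
      using g that by (simp add: bip_maps_def)
    then show ?thesis using that
      by (subst bipartite_const_iff[OF C x y, of _ _ c]) (auto simp: part_def)
  qed
  have restr: "g m (act X m p \<alpha> s) = act (cnerve C) m p \<alpha> (g p s)" if "\<alpha> \<in> mon m p" for m \<alpha>
    using smaps_act[OF gs that s] .
  have obj: "fst (g p s) k = (if side s k then y else x)" if k: "k \<le> p" for k
  proof -
    let ?t = "act X 0 p (constm 0 k) s"
    have t: "?t \<in> part (side s k) 0"
      using s k by (auto simp: part_def act_in X mon_const side_act)
    have "fst (g 0 ?t) 0 = (if side s k then y else x)"
      using bipartite_obj[OF const[OF t], of 0] t by (simp add: part_def)
    then show ?thesis using k by (simp add: restr mon_const act_cnerve_obj)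
  qed
  have hom: "snd (g p s) k l m T = (let z = if side s k then y else x in degen (mhom C z z) m (mid C z))"
    if l: "l \<le> p" and T: "T \<in> subset_chains k l m" and eq: "side s k = side s l" for k l m T
  proof -
    \<comment> \<open>The face spanned by the vertices from \<open>k\<close> to \<open>l\<close>, and the same chain regarded on that face.\<close>
    let ?d = "\<lambda>a\<in>{..l - k}. a + k" and ?T = "img (\<lambda>a. a - k) m T"
    have kl: "k \<le> l" using T by (rule chains_le)
    have d: "?d \<in> mon (l - k) p" using kl l by (auto simp: mon_iff)
    let ?t = "act X (l - k) p ?d s"
    have side_t: "side ?t a = side s k" if "a \<le> l - k" for a
    proof -
      have "a + k \<le> l" using that kl by linarith
      then show ?thesis
        using that l eq side_mono[OF s, of k "a + k"] side_mono[OF s, of "a + k" l]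
        by (auto simp: side_act[OF d s])
    qed
    have t: "?t \<in> part (side s k) (l - k)"
      using s d side_t by (auto simp: part_def act_in X)
    have T': "?T \<in> subset_chains 0 (l - k) m"
    proof (rule chainsI)
      show "0 \<le> u \<and> u \<le> l - k" if "a \<le> m" "u \<in> ?T a" for a u
        using that chains_bounds[OF T, of a] by (fastforce simp: img_def)
      show "?T a \<subseteq> ?T b" if "a \<le> b" "b \<le> m" for a b
        using that chains_mono[OF T, of a b] by (auto simp: img_def)
      show "0 \<in> ?T a \<and> l - k \<in> ?T a" if "a \<le> m" for a
        using that chains_ends[OF T, of a] by (force simp: img_def)
    qed (simp add: img_def)
    have "?d ` (\<lambda>u. u - k) ` T a = T a" if "a \<le> m" for a
      using chains_bounds[OF T that] by (force simp: image_iff)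
    then have T_eq: "img ?d m ?T = T"
      using T by (intro extensionalityI[of _ "{..m}"]) (auto simp: img_def chains_ext)
    have "snd (g p s) k l m T = snd (g (l - k) ?t) 0 (l - k) m ?T"
      using kl T' T_eq by (simp add: restr[OF d] act_cnerve_hom)
    then show ?thesis
      using bipartite_same[OF const[OF t] order_refl T'] side_t[of 0] side_t[of "l - k"] by simp
  qed
  have "g p s \<in> sfunctors (cdelta p) C" using smaps_in[OF gs s] by simp
  then show ?thesis using obj hom unfolding bipartite_def by blast
qed

lemma bip_mapsI:
  assumes g: "g \<in> smaps X (cnerve C)"
    and bip: "\<And>p s. s \<in> simps X p \<Longrightarrow> bipartite C x y p (side s) (g p s)"
  shows "g \<in> bip_maps C x y"
proof -
  have "g m s = degen (cnerve C) m (cnerve_obj C (if c then y else x))" if "s \<in> part c m" for c m s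
    using bip[of s m] that bipartite_const_iff[OF C x y, of m "side s" c "g m s"] by (auto simp: part_def)
  then show ?thesis using g by (simp add: bip_maps_def)
qed

lemma bip_maps_eqI:
  assumes g: "g \<in> bip_maps C x y" and h: "h \<in> bip_maps C x y"
    and eq: "\<And>p s k l m T. s \<in> simps X p \<Longrightarrow> l \<le> p \<Longrightarrow> \<not> side s k \<Longrightarrow> side s l \<Longrightarrow>
      T \<in> subset_chains k l m \<Longrightarrow> snd (g p s) k l m T = snd (h p s) k l m T"
  shows "g = h"
proof (rule smaps_eqI[OF bip_maps_smaps[OF g] bip_maps_smaps[OF h]])
  fix p s assume s: "s \<in> simps X p"
  show "g p s = h p s"
    by (rule bipartite_eqI[OF C x y bip_maps_bipartite[OF g s] bip_maps_bipartite[OF h s]])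
      (use s side_mono eq in blast)+
qed

text \<open>The map of mapping spaces that corresponds to a map to the coherent nerve by adjunction.\<close>

definition transpose where
  "transpose g = snd (adjoint_functor Q C (descend X R g)) v0 v1"

lemma bip_maps_descend:
  assumes g: "g \<in> bip_maps C x y"
  shows "descend X R g \<in> smaps Q (cnerve C)"
    and "s \<in> simps X m \<Longrightarrow> descend X R g m (q m s) = g m s"
proof -
  have eq: "g m t = g m s" if "(s, t) \<in> R m" for m s t
    using that g by (auto simp: R_iff bip_maps_def)
  show "descend X R g \<in> smaps Q (cnerve C)"
    by (rule descend_smaps[OF X R_equiv R_act bip_maps_smaps[OF g] eq])
  show "s \<in> simps X m \<Longrightarrow> descend X R g m (q m s) = g m s"
    unfolding q_def by (rule descend_class[OF X R_equiv R_act eq])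
qed

lemma transpose_smaps:
  assumes g: "g \<in> bip_maps C x y"
  shows "transpose g \<in> smaps (mhom (rigid Q) v0 v1) (mhom C x y)"
proof -
  note d = bip_maps_descend[OF g]
  have "fst (adjoint_functor Q C (descend X R g)) v0 = x"
    "fst (adjoint_functor Q C (descend X R g)) v1 = y"
    using a0 a1 bipartite_obj[OF bip_maps_bipartite[OF g], of a0 0 0]
      bipartite_obj[OF bip_maps_bipartite[OF g], of a1 0 0]
    by (simp_all add: adjoint_functor_obj[OF Q C d(1)] v_in d(2))
  then show ?thesis
    using functor_smap[OF adjoint_functor_functor[OF Q C d(1)], of v0 v1] v_in
    by (simp add: transpose_def rigid_obs[OF Q])
qed

end

definition gcls :: "nat \<Rightarrow> nat \<Rightarrow> 'a \<Rightarrow> nat \<Rightarrow> nat \<Rightarrow> (nat \<Rightarrow> nat set) \<Rightarrow> 'a set gen list set" where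
  "gcls m p s k l T = pcls Q m v0 v1 [Gen p (q p s) k l T]"

lemma gcls_path:
  assumes "s \<in> simps X p" "l \<le> p" "\<not> side s k" "side s l" "T \<in> subset_chains k l m"
  shows "cpath Q m v0 v1 [Gen p (q p s) k l T]"
  using cpath_single[OF Q q_in[OF assms(1)], of k l T m] assms chains_le[OF assms(5)]
  by (simp add: vertex_q)

lemma gcls_in:
  "s \<in> simps X p \<Longrightarrow> l \<le> p \<Longrightarrow> \<not> side s k \<Longrightarrow> side s l \<Longrightarrow> T \<in> subset_chains k l m \<Longrightarrow>
   gcls m p s k l T \<in> simps (mhom (rigid Q) v0 v1) m"
  unfolding gcls_def by (intro pcls_in[OF Q] gcls_path)

lemma gcls_operator:
  assumes "s \<in> simps X r" "\<alpha> \<in> mon p r" "l \<le> p" "\<not> side s (\<alpha> k)" "side s (\<alpha> l)" "T \<in> subset_chains k l m"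
  shows "gcls m p (act X p r \<alpha> s) k l T = gcls m r s (\<alpha> k) (\<alpha> l) (img \<alpha> m T)"
proof -
  have k: "k \<le> p" using assms chains_le[of T k l m] by simp
  show ?thesis
    using ccong_img[OF Q q_in[OF assms(1)] assms(2) k assms(3,6)] assms k
    unfolding gcls_def by (intro pcls_eqI[OF Q]) (simp add: act_q vertex_q mon_le)
qed

lemma transpose_gcls:
  assumes C: "is_scat C" "x \<in> obs C" "y \<in> obs C" and g: "g \<in> bip_maps C x y"
    and s: "s \<in> simps X p" "l \<le> p" "\<not> side s k" "side s l" "T \<in> subset_chains k l m"
  shows "transpose C g m (gcls m p s k l T) = snd (g p s) k l m T"
proof -
  note d = bip_maps_descend[OF C g]
  show ?thesis
    using adjoint_functor_gen[OF Q C(1) d(1) q_in[OF s(1)], of k l T m] s chains_le[OF s(5)]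
    by (simp add: transpose_def[OF C] gcls_def vertex_q d(2))
qed

text \<open>The transpose sees all mixed chains, and a bipartite functor is determined by its values on these.\<close>

lemma transpose_inj:
  assumes C: "is_scat C" "x \<in> obs C" "y \<in> obs C"
    and g: "g \<in> bip_maps C x y" and h: "h \<in> bip_maps C x y" and eq: "transpose C g = transpose C h"
  shows "g = h"
proof (rule bip_maps_eqI[OF C g h])
  fix p s k l m T
  assume s: "s \<in> simps X p" "l \<le> p" "\<not> side s k" "side s l" "T \<in> subset_chains k l m"
  show "snd (g p s) k l m T = snd (h p s) k l m T"
    using transpose_gcls[OF C g s] transpose_gcls[OF C h s] eq by simp
qed

text \<open>The unit of the adjunction, composed with the quotient map. It is itself constant on both fibres, so
  statements about bipartite functors apply to generators of the rigidification.\<close>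

definition unit_map where
  "unit_map = (\<lambda>p. \<lambda>s\<in>simps X p. rigid_unit Q p (q p s))"

lemma unit_map_bip: "unit_map \<in> bip_maps (rigid Q) v0 v1"
proof -
  have "unit_map \<in> smaps X (cnerve (rigid Q))"
    by (rule smapsI)
      (auto simp: unit_map_def act_in X rigid_unit_functor Q q_in rigid_unit_act act_q[symmetric])
  moreover have "unit_map m s = degen (cnerve (rigid Q)) m (cnerve_obj (rigid Q) (if c then v1 else v0))"
    if s: "s \<in> part c m" for c m s
  proof -
    let ?a = "if c then a1 else a0"
    have a: "?a \<in> part c 0" using a0 a1 by (auto simp: part_def)
    have "act X m 0 (constm m 0) ?a \<in> part c m" by (rule part_act[OF a]) (simp add: mon_const)
    then have "q m s = q m (act X m 0 (constm m 0) ?a)"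
      using s by (subst q_eq_iff) (auto simp: part_def R_iff)
    also have "\<dots> = act Q m 0 (constm m 0) (if c then v1 else v0)"
      using a0 a1 by (auto simp: act_q mon_const)
    finally have "unit_map m s = act (cnerve (rigid Q)) m 0 (constm m 0) (rigid_unit Q 0 (if c then v1 else v0))"
      using s v_in by (auto simp: unit_map_def part_def rigid_unit_act Q mon_const)
    then show ?thesis using v_in by (auto simp: rigid_unit_vertex Q degen_def)
  qed
  ultimately show ?thesis by (simp add: bip_maps_def)
qed

lemma unit_map_gcls:
  assumes "s \<in> simps X p" "l \<le> p" "\<not> side s k" "side s l" "T \<in> subset_chains k l m"
  shows "snd (unit_map p s) k l m T = gcls m p s k l T"
  using assms chains_le[of T k l m] by (simp add: unit_map_def rigid_unit_hom Q vertex_q gcls_def)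

lemma rigid_v_obs: "v0 \<in> obs (rigid Q)" "v1 \<in> obs (rigid Q)"
  using v_in by (simp_all add: rigid_obs Q)

text \<open>A generator between vertices on the same side is trivial, and a mixed generator can occur only once in
  a path, since none leads back from \<open>v1\<close> to \<open>v0\<close>.\<close>

lemma path_normal_form:
  "cpath Q m a b u \<Longrightarrow> (a = b \<and> ccong Q m a b u []) \<or> (a = v0 \<and> b = v1 \<and>
    (\<exists>p s k l T. s \<in> simps X p \<and> l \<le> p \<and> \<not> side s k \<and> side s l \<and> T \<in> subset_chains k l m \<and>
       ccong Q m v0 v1 u [Gen p (q p s) k l T]))"
  (is "_ \<Longrightarrow> ?nf a b u")
proof (induction rule: cpath.induct)
  case (cpath_Nil a)
  then show ?case by (auto intro: ccong_refl cpath.cpath_Nil)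
next
  case (cpath_Cons s' p k l T b u)
  obtain s where s: "s \<in> simps X p" and s': "s' = q p s"
    using cpath_Cons(1) by (auto simp: Q_simps)
  have T: "T \<in> subset_chains k l m" using cpath_Cons(4) by simp
  have kl: "k \<le> l" using T by (rule chains_le)
  note path = cpath_single[OF Q cpath_Cons(1-3) T]
  have app: "ccong Q m (vertex Q p s' k) b (Gen p s' k l T # u) (v @ w)"
    if "ccong Q m (vertex Q p s' k) (vertex Q p s' l) [Gen p s' k l T] v"
      "ccong Q m (vertex Q p s' l) b u w" for v w
    using ccong_append[OF that] by simp
  show ?case
  proof (cases "side s k = side s l")
    case True
    then have v: "vertex Q p s' k = vertex Q p s' l"
      using s cpath_Cons by (simp add: s' vertex_q)
    have "pcls Q m (vertex Q p s' k) (vertex Q p s' l) [Gen p s' k l T] = pcls Q m (vertex Q p s' k) (vertex Q p s' l) []"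
      using bipartite_same[OF bip_maps_bipartite[OF is_scat_rigid[OF Q] rigid_v_obs unit_map_bip s] cpath_Cons(3) T True]
        cpath_Cons(2,3) s True T v_in v
      by (simp add: unit_map_def rigid_unit_hom Q s' Let_def rigid_degen vertex_q split: if_splits)
    then have "ccong Q m (vertex Q p s' k) (vertex Q p s' l) [Gen p s' k l T] []"
      using path by (rule pcls_eqD[OF Q])
    then have drop: "ccong Q m (vertex Q p s' l) b (Gen p s' k l T # u) w"
      if "ccong Q m (vertex Q p s' l) b u w" for w
      using app[of "[]" w] that by (simp add: v)
    have "?nf (vertex Q p s' l) b (Gen p s' k l T # u)"
      using cpath_Cons(6)
    proof (elim disjE conjE exE)
      fix p1 s1 k1 l1 T1
      assume *: "vertex Q p s' l = v0" "b = v1" "s1 \<in> simps X p1" "l1 \<le> p1" "\<not> side s1 k1" "side s1 l1"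
        "T1 \<in> subset_chains k1 l1 m" "ccong Q m v0 v1 u [Gen p1 (q p1 s1) k1 l1 T1]"
      then have "ccong Q m v0 v1 (Gen p s' k l T # u) [Gen p1 (q p1 s1) k1 l1 T1]"
        using drop[of "[Gen p1 (q p1 s1) k1 l1 T1]"] by simp
      then show ?thesis using * by blast
    qed (use drop in blast)
    then show ?thesis unfolding v .
  next
    case False
    then have side: "\<not> side s k" "side s l" using side_mono[OF s kl cpath_Cons(3)] by auto
    then have v: "vertex Q p s' k = v0" "vertex Q p s' l = v1"
      using s cpath_Cons by (simp_all add: s' vertex_q)
    then have "b = v1" "ccong Q m v1 v1 u []" using cpath_Cons(6) v0_v1 by auto
    then have "ccong Q m v0 v1 (Gen p s' k l T # u) [Gen p (q p s) k l T]"
      using app[OF ccong_refl[OF path], of "[]"] unfolding v by (simp add: s')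
    then show ?thesis using v \<open>b = v1\<close> s cpath_Cons(3) side T by blast
  qed
qed

lemma hom_cases:
  assumes "c \<in> simps (mhom (rigid Q) v0 v1) m"
  obtains p s k l T where "s \<in> simps X p" "l \<le> p" "\<not> side s k" "side s l" "T \<in> subset_chains k l m"
    "c = gcls m p s k l T"
proof -
  obtain u where u: "cpath Q m v0 v1 u" "c = pcls Q m v0 v1 u"
    using assms by (auto simp: rigid_simps[OF Q])
  then show ?thesis
    using path_normal_form[OF u(1)] v0_v1 pcls_eqI[OF Q] that unfolding gcls_def by metis
qed

lemma bip_maps_comp:
  assumes B: "bipartite_sset X' side' b0 b1" and \<phi>: "\<phi> \<in> smaps X X'"
    and side: "\<And>p s k. s \<in> simps X p \<Longrightarrow> k \<le> p \<Longrightarrow> side' (\<phi> p s) k = side s k"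
    and g: "g \<in> bipartite_sset.bip_maps X' side' C x y"
  shows "smap_comp X g \<phi> \<in> bip_maps C x y"
proof -
  interpret B: bipartite_sset X' side' b0 b1 by (rule B)
  have "smap_comp X g \<phi> \<in> smaps X (cnerve C)"
    by (rule smap_comp_smaps[OF \<phi> B.bip_maps_smaps[OF g] X])
  moreover have "smap_comp X g \<phi> m s = degen (cnerve C) m (cnerve_obj C (if c then y else x))"
    if "s \<in> part c m" for c m s
  proof -
    have "\<phi> m s \<in> B.part c m"
      using that by (auto simp: part_def B.part_def smaps_in[OF \<phi>] side)
    then show ?thesis using g that by (auto simp: B.bip_maps_def part_def)
  qed
  ultimately show ?thesis by (simp add: bip_maps_def)
qed

end

section \<open>Reversal\<close>

text \<open>The axioms for \<open>\<theta>\<close> describe a simplicial map from \<open>X\<close> to the opposite of \<open>X'\<close> that exchanges the two sides.\<close>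

locale reversal = A: bipartite_sset X side a0 a1 + B: bipartite_sset X' side' b0 b1
  for X :: "'a sset" and side a0 a1 and X' :: "'b sset" and side' b0 b1 +
  fixes \<theta> :: "nat \<Rightarrow> 'a \<Rightarrow> 'b"
  assumes \<theta>_in: "s \<in> simps X p \<Longrightarrow> \<theta> p s \<in> simps X' p"
    and \<theta>_act: "\<alpha> \<in> mon m n \<Longrightarrow> s \<in> simps X n \<Longrightarrow>
      \<theta> m (act X m n \<alpha> s) = act X' m n (reflect m n \<alpha>) (\<theta> n s)"
    and \<theta>_side: "s \<in> simps X p \<Longrightarrow> k \<le> p \<Longrightarrow> side' (\<theta> p s) k \<longleftrightarrow> \<not> side s (p - k)"
begin

definition flip_map where
  "flip_map C x y g = (\<lambda>p. \<lambda>s\<in>simps X p. flip_functor C x y p (side s) (g p (\<theta> p s)))"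

context
  fixes C :: "('o, 'm) scat" and x y :: 'o
  assumes C: "is_scat C" "x \<in> obs C" "y \<in> obs C"
begin

lemma flip_map_bip:
  assumes g: "g \<in> B.bip_maps C x y"
  shows "flip_map C x y g \<in> A.bip_maps C x y"
proof (rule A.bip_mapsI[OF C])
  have bip: "bipartite C x y p (side s) (flip_map C x y g p s)" if s: "s \<in> simps X p" for p s
    using bipartite_flip_functor[OF C B.bip_maps_bipartite[OF C g \<theta>_in[OF s]], of "side s"]
      s A.side_mono[OF s] by (simp add: flip_map_def \<theta>_side)
  then show "bipartite C x y p (side s) (flip_map C x y g p s)" if "s \<in> simps X p" for p s
    using that .
  show "flip_map C x y g \<in> smaps X (cnerve C)"
  proof (rule smapsI)
    show "flip_map C x y g n s \<in> simps (cnerve C) n" if "s \<in> simps X n" for n s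
      using bip[OF that] by (simp add: bipartite_functor)
    show "flip_map C x y g n \<in> extensional (simps X n)" for n by (simp add: flip_map_def)
    show "flip_map C x y g m (act X m n \<alpha> s) = act (cnerve C) m n \<alpha> (flip_map C x y g n s)"
      if \<alpha>: "\<alpha> \<in> mon m n" and s: "s \<in> simps X n" for m n \<alpha> s
    proof -
      have "act (cnerve C) m n \<alpha> (flip_functor C x y n (side s) (g n (\<theta> n s))) =
        flip_functor C x y m (\<lambda>k. side s (\<alpha> k)) (g m (\<theta> m (act X m n \<alpha> s)))"
        using act_flip_functor[OF C \<alpha>, of "side s" "g n (\<theta> n s)"] A.side_mono[OF s]
          smaps_act[OF B.bip_maps_smaps[OF g] reflect_mon[OF \<alpha>] \<theta>_in[OF s]]
        by (simp add: \<theta>_act \<alpha> s)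
      also have "\<dots> = flip_functor C x y m (side (act X m n \<alpha> s)) (g m (\<theta> m (act X m n \<alpha> s)))"
        unfolding flip_functor_def[OF C]
        by (rule bip_functor_cong)
          (use A.side_act[OF \<alpha> s] A.side_mono[OF act_in[OF A.X \<alpha> s]] in auto)
      finally show ?thesis using s \<alpha> by (simp add: flip_map_def act_in A.X)
    qed
  qed
qed

lemma flip_map_hom:
  "s \<in> simps X p \<Longrightarrow> l \<le> p \<Longrightarrow> \<not> side s k \<Longrightarrow> side s l \<Longrightarrow> T \<in> subset_chains k l m \<Longrightarrow>
   snd (flip_map C x y g p s) k l m T = snd (g p (\<theta> p s)) (p - l) (p - k) m (rev_chain p m T)"
  by (simp add: flip_map_def flip_functor_hom[OF C])

text \<open>On generators, flipping a map and precomposing its transpose with the reversal of generators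
  are the same.\<close>

lemma transpose_flip_map:
  assumes g: "g \<in> B.bip_maps C x y"
    and s: "s \<in> simps X p" "l \<le> p" "\<not> side s k" "side s l" "T \<in> subset_chains k l m"
  shows "A.transpose C (flip_map C x y g) m (A.gcls m p s k l T) =
    B.transpose C g m (B.gcls m p (\<theta> p s) (p - l) (p - k) (rev_chain p m T))"
  using s chains_le[OF s(5)] A.transpose_gcls[OF C flip_map_bip[OF g] s]
    B.transpose_gcls[OF C g \<theta>_in[OF s(1)], of "p - k" "p - l" "rev_chain p m T" m]
  by (simp add: flip_map_hom \<theta>_side rev_chain_chains)

end

end

locale reversal_pair = reversal X side a0 a1 X' side' b0 b1 \<theta> + inv: reversal X' side' b0 b1 X side a0 a1 \<theta>'
  for X :: "'a sset" and side a0 a1 and X' :: "'b sset" and side' b0 b1 \<theta> \<theta>' +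
  assumes \<theta>_\<theta>': "t \<in> simps X' p \<Longrightarrow> \<theta> p (\<theta>' p t) = t"
begin

lemma flip_flip_map:
  assumes C: "is_scat C" "x \<in> obs C" "y \<in> obs C" and g: "g \<in> B.bip_maps C x y"
  shows "inv.flip_map C x y (flip_map C x y g) = g"
proof (rule smaps_eqI)
  show "inv.flip_map C x y (flip_map C x y g) \<in> smaps X' (cnerve C)"
    by (rule B.bip_maps_smaps[OF inv.flip_map_bip[OF C flip_map_bip[OF C g]]])
  show "g \<in> smaps X' (cnerve C)" using g by (rule B.bip_maps_smaps)
  fix p t assume t: "t \<in> simps X' p"
  then have t': "\<theta>' p t \<in> simps X p" by (rule inv.\<theta>_in)
  have "flip_functor C x y p (side' t) (flip_functor C x y p (side (\<theta>' p t)) (g p t)) = g p t"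
  proof (rule flip_flip_functor[OF C B.bip_maps_bipartite[OF C g t]])
    show "side' t k \<longleftrightarrow> \<not> side (\<theta>' p t) (p - k)" if "k \<le> p" for k
      using inv.\<theta>_side[OF t, of "p - k"] that by simp
  qed (rule A.side_mono[OF t'])
  then show "inv.flip_map C x y (flip_map C x y g) p t = g p t"
    using t t' by (simp add: flip_map_def inv.flip_map_def \<theta>_\<theta>')
qed

end

text \<open>This yields the naturality of the isomorphisms: for an operator \<open>\<alpha>\<close> one of the two maps is induced
  by \<open>\<alpha>\<close> and the other by its reflection.\<close>

lemma flip_map_natural:
  assumes M: "reversal X side a0 a1 X' side' b0 b1 \<theta>" and K: "reversal Z sideZ c0 c1 Z' sideZ' d0 d1 \<theta>Z"
    and C: "is_scat C" "x \<in> obs C" "y \<in> obs C"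
    and \<phi>: "\<phi> \<in> smaps X Z" "\<And>p s k. s \<in> simps X p \<Longrightarrow> k \<le> p \<Longrightarrow> sideZ (\<phi> p s) k = side s k"
    and \<phi>': "\<phi>' \<in> smaps X' Z'" "\<And>p s k. s \<in> simps X' p \<Longrightarrow> k \<le> p \<Longrightarrow> sideZ' (\<phi>' p s) k = side' s k"
    and comm: "\<And>p s. s \<in> simps X p \<Longrightarrow> \<theta>Z p (\<phi> p s) = \<phi>' p (\<theta> p s)"
    and g: "g \<in> bipartite_sset.bip_maps Z' sideZ' C x y"
  shows "smap_comp X' g \<phi>' \<in> bipartite_sset.bip_maps X' side' C x y"
    and "reversal.flip_map X side \<theta> C x y (smap_comp X' g \<phi>') = smap_comp X (reversal.flip_map Z sideZ \<theta>Z C x y g) \<phi>"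
proof -
  interpret M: reversal X side a0 a1 X' side' b0 b1 \<theta> by (rule M)
  interpret K: reversal Z sideZ c0 c1 Z' sideZ' d0 d1 \<theta>Z by (rule K)
  show g': "smap_comp X' g \<phi>' \<in> M.B.bip_maps C x y"
    using K.B.bipartite_sset_axioms \<phi>' g by (rule M.B.bip_maps_comp)
  show "M.flip_map C x y (smap_comp X' g \<phi>') = smap_comp X (K.flip_map C x y g) \<phi>"
  proof (rule smap_comp_eqI[OF M.A.bip_maps_smaps[OF M.flip_map_bip[OF C g']]])
    fix p s assume s: "s \<in> simps X p"
    show "M.flip_map C x y (smap_comp X' g \<phi>') p s = K.flip_map C x y g p (\<phi> p s)"
      using flip_functor_cong[OF C, of p "side s" "sideZ (\<phi> p s)"] \<phi>(2)[OF s] M.A.side_mono[OF s]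
        smaps_in[OF \<phi>(1) s] M.\<theta>_in[OF s] s
      by (simp add: M.flip_map_def K.flip_map_def comm)
  qed
qed

section \<open>Joins\<close>

locale join_sset =
  fixes i j N :: nat
  assumes N: "N = i + j + 1"
begin

sublocale bipartite_sset "std N" "\<lambda>\<alpha> k. i < \<alpha> k" "constm 0 0" "constm 0 N"
proof
  show "i < \<alpha> k'" if "\<alpha> \<in> simps (std N) p" "k \<le> k'" "k' \<le> p" "i < \<alpha> k" for \<alpha> p k k'
    using that mon_mono[of \<alpha> p N k k'] by auto
qed (auto simp: is_sset_std compose_def mon_const N)

lemma join_left_eq: "join_left i j = part False" and join_right_eq: "join_right i j = part True"
  unfolding join_left_def join_right_def part_def N[symmetric] by (auto simp: fun_eq_iff mon_le)

lemma J_rel_eq: "J_rel i j = R"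
  unfolding J_rel_def R_def N[symmetric] join_left_eq join_right_eq ..

lemma Jsset_eq: "Jsset i j = Q"
  unfolding Jsset_def J_rel_eq N[symmetric] ..

lemma J0_eq: "J0 i j = v0"
  unfolding J0_def J_rel_eq q_def ..

lemma J1_eq: "J1 i j = v1"
  unfolding J1_def J_rel_eq q_def N[symmetric] ..

lemma Qspace_eq: "Qspace i j = mhom (rigid Q) v0 v1"
  unfolding Qspace_def Jsset_eq J0_eq J1_eq ..

lemma Q_transpose_eq:
  assumes C: "is_scat C" "x \<in> obs C" "y \<in> obs C"
  shows "Q_transpose C i j g = transpose C g"
  unfolding Q_transpose_def transpose_def[OF C] Jsset_eq J0_eq J1_eq J_rel_eq N[symmetric] ..

abbreviation idN :: "nat \<Rightarrow> nat" where
  "idN \<equiv> \<lambda>k\<in>{..N}. k"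

lemma idN_in: "idN \<in> simps (std N) N"
  by (simp add: mon_id)

lemma gcls_std:
  assumes "\<alpha> \<in> mon p N" "l \<le> p" "\<alpha> k \<le> i" "i < \<alpha> l" "T \<in> subset_chains k l m"
  shows "gcls m p \<alpha> k l T = gcls m N idN (\<alpha> k) (\<alpha> l) (img \<alpha> m T)"
proof -
  have \<alpha>: "act (std N) p N \<alpha> idN = \<alpha>"
    using assms(1) by (intro extensionalityI[of _ "{..p}"]) (auto simp: mon_iff compose_def)
  have "\<alpha> k \<le> N" "\<alpha> l \<le> N"
    using assms chains_le[of T k l m] by (auto intro: mon_le)
  then show ?thesis
    using gcls_operator[OF idN_in assms(1,2), of k T m] assms unfolding \<alpha> by simp
qed

section \<open>The quotient of the nerve of a poset\<close>

abbreviation "P \<equiv> nerve (meeting_both i j)"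

lemma P_iff:
  "T \<in> simps P m \<longleftrightarrow> T \<in> extensional {..m} \<and> (\<forall>k\<le>m. T k \<subseteq> {..N}) \<and> (\<forall>k k'. k \<le> k' \<longrightarrow> k' \<le> m \<longrightarrow> T k \<subseteq> T k') \<and>
     (\<exists>a\<le>i. a \<in> T 0) \<and> (\<exists>b\<in>{i<..N}. b \<in> T 0)" (is "_ \<longleftrightarrow> ?r")
proof
  assume "T \<in> simps P m"
  then have *: "T \<in> extensional {..m}" "\<And>k. k \<le> m \<Longrightarrow> T k \<in> meeting_both i j"
    "\<And>k k'. k \<le> k' \<Longrightarrow> k' \<le> m \<Longrightarrow> T k \<subseteq> T k'"
    by (auto simp: simps_nerve_iff)
  have mb: "A \<subseteq> {..N} \<and> (\<exists>a\<le>i. a \<in> A) \<and> (\<exists>b\<in>{i<..N}. b \<in> A)" if "A \<in> meeting_both i j" for A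
    using that unfolding meeting_both_def N by blast
  show ?r using * mb[OF *(2)] mb[OF *(2)[of 0]] by blast
next
  assume r: ?r
  then obtain a b where ab: "a \<le> i" "a \<in> T 0" "b \<in> {i<..N}" "b \<in> T 0" by blast
  have "T k \<in> meeting_both i j" if "k \<le> m" for k
  proof -
    have "T 0 \<subseteq> T k" "T k \<subseteq> {..N}" using r that by blast+
    then show ?thesis using ab by (auto simp: meeting_both_def N)
  qed
  then show "T \<in> simps P m" using r by (auto simp: simps_nerve_iff)
qed

text \<open>The part of a chain between \<open>a\<close> and \<open>b\<close>. It represents the class of the chain in the quotient
  of the nerve, for all \<open>a\<close> and \<open>b\<close> in \<open>T 0\<close> from the two join factors.\<close>

definition cut :: "nat \<Rightarrow> nat \<Rightarrow> nat \<Rightarrow> (nat \<Rightarrow> nat set) \<Rightarrow> nat \<Rightarrow> nat set" where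
  "cut m a b T = (\<lambda>k\<in>{..m}. T k \<inter> {a..b})"

lemma P_mono: "T \<in> simps P m \<Longrightarrow> k \<le> k' \<Longrightarrow> k' \<le> m \<Longrightarrow> T k \<subseteq> T k'"
  and P_0: "T \<in> simps P m \<Longrightarrow> k \<le> m \<Longrightarrow> a \<in> T 0 \<Longrightarrow> a \<in> T k"
  and P_sub: "T \<in> simps P m \<Longrightarrow> k \<le> m \<Longrightarrow> a \<in> T k \<Longrightarrow> a \<le> N"
  unfolding P_iff by (blast, blast, blast)

lemma chains_P:
  assumes T: "T \<in> subset_chains a b m" and "a \<le> i" "i < b" "b \<le> N"
  shows "T \<in> simps P m"
proof -
  have "\<forall>k\<le>m. T k \<subseteq> {..N}" using chains_bounds[OF T] \<open>b \<le> N\<close> by fastforce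
  moreover have "a \<in> T 0" "b \<in> T 0" using chains_ends[OF T, of 0] by auto
  moreover have "b \<in> {i<..N}" using assms by simp
  ultimately show ?thesis
    unfolding P_iff using chains_ext[OF T] chains_mono[OF T] \<open>a \<le> i\<close> by blast
qed

lemma cut_chains:
  assumes T: "T \<in> simps P m" and ab: "a \<in> T 0" "b \<in> T 0" "a \<le> b"
  shows "cut m a b T \<in> subset_chains a b m"
proof (rule chainsI)
  show "a \<in> cut m a b T k \<and> b \<in> cut m a b T k" if "k \<le> m" for k
    using ab P_0[OF T that ab(1)] P_0[OF T that ab(2)] that by (simp add: cut_def)
  show "cut m a b T k \<subseteq> cut m a b T k'" if "k \<le> k'" "k' \<le> m" for k k'
    using P_mono[OF T that] that by (auto simp: cut_def)
qed (auto simp: cut_def)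

lemma cut_id: "T \<in> subset_chains a b m \<Longrightarrow> cut m a b T = T"
  by (rule extensionalityI[of _ "{..m}"]) (auto simp: cut_def chains_ext dest: chains_bounds)

lemma P_rel_iff:
  "(T, T') \<in> P_rel i j m \<longleftrightarrow> T \<in> simps P m \<and> T' \<in> simps P m \<and>
     (\<exists>a b. a \<le> i \<and> i < b \<and> b \<le> N \<and> a \<in> T 0 \<and> a \<in> T' 0 \<and> b \<in> T 0 \<and> b \<in> T' 0 \<and> cut m a b T = cut m a b T')"
proof -
  have cut_eq: "cut m a b T = cut m a b T' \<longleftrightarrow> (\<forall>k\<le>m. T k \<inter> {a..b} = T' k \<inter> {a..b})" for a b
    by (auto simp: cut_def fun_eq_iff restrict_def)
  show ?thesis
    unfolding P_rel_def N[symmetric] cut_eq mem_Collect_eq split_conv Bex_def atMost_iff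
      greaterThanAtMost_iff insert_subset Int_iff by blast
qed

lemma P_relI:
  assumes "T \<in> simps P m" "T' \<in> simps P m" "a \<le> i" "i < b" "b \<le> N"
    "a \<in> T 0" "a \<in> T' 0" "b \<in> T 0" "b \<in> T' 0"
    and "\<And>k. k \<le> m \<Longrightarrow> T k \<inter> {a..b} = T' k \<inter> {a..b}"
  shows "(T, T') \<in> P_rel i j m"
proof -
  have "cut m a b T = cut m a b T'"
    unfolding cut_def by (rule restrict_ext) (simp add: assms(10))
  then show ?thesis unfolding P_rel_iff using assms(1-9) by blast
qed

lemma P_relE:
  assumes "(T, T') \<in> P_rel i j m"
  obtains a b where "T \<in> simps P m" "T' \<in> simps P m" "a \<le> i" "i < b" "b \<le> N" "a \<in> T 0" "a \<in> T' 0"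
    "b \<in> T 0" "b \<in> T' 0" "\<And>k. k \<le> m \<Longrightarrow> T k \<inter> {a..b} = T' k \<inter> {a..b}"
proof -
  obtain a b where *: "T \<in> simps P m" "T' \<in> simps P m" "a \<le> i" "i < b" "b \<le> N" "a \<in> T 0" "a \<in> T' 0"
    "b \<in> T 0" "b \<in> T' 0" "cut m a b T = cut m a b T'"
    using assms unfolding P_rel_iff by blast
  have "T k \<inter> {a..b} = T' k \<inter> {a..b}" if "k \<le> m" for k
    using fun_cong[OF *(10), of k] that by (simp add: cut_def)
  then show ?thesis using that * by blast
qed

text \<open>For transitivity, the witnesses are the larger of the two left and the smaller of the two right
  vertices: both lie in the interval on which the chains are known to agree.\<close>

lemma P_rel_equiv: "equiv (simps P m) (P_rel i j m)"
proof (rule equivI)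
  show "P_rel i j m \<subseteq> simps P m \<times> simps P m" by (auto elim: P_relE)
  show "refl_on (simps P m) (P_rel i j m)"
  proof (rule refl_onI)
    fix T assume T: "T \<in> simps P m"
    then obtain a b where "a \<le> i" "a \<in> T 0" "b \<in> {i<..N}" "b \<in> T 0" unfolding P_iff by blast
    then show "(T, T) \<in> P_rel i j m" using T by (intro P_relI[of _ _ _ a b]) auto
  qed
  show "sym (P_rel i j m)"
  proof (rule symI)
    fix T T' assume "(T, T') \<in> P_rel i j m"
    then show "(T', T) \<in> P_rel i j m" unfolding P_rel_iff by metis
  qed
  show "trans (P_rel i j m)"
  proof (rule transI)
    fix T U V assume "(T, U) \<in> P_rel i j m" "(U, V) \<in> P_rel i j m"
    then obtain a b a' b' where
      1: "T \<in> simps P m" "a \<le> i" "i < b" "b \<le> N" "a \<in> T 0" "a \<in> U 0"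
        "b \<in> T 0" "b \<in> U 0" "\<And>k. k \<le> m \<Longrightarrow> T k \<inter> {a..b} = U k \<inter> {a..b}" and
      2: "V \<in> simps P m" "a' \<le> i" "i < b'" "b' \<le> N" "a' \<in> U 0" "a' \<in> V 0"
        "b' \<in> U 0" "b' \<in> V 0" "\<And>k. k \<le> m \<Longrightarrow> U k \<inter> {a'..b'} = V k \<inter> {a'..b'}"
      by (elim P_relE) blast
    \<comment> \<open>Each of these two vertices lies in both intervals, so \<open>T\<close>, \<open>U\<close> and \<open>V\<close> agree there.\<close>
    let ?a = "max a a'" and ?b = "min b b'"
    have TU: "u \<in> T k \<longleftrightarrow> u \<in> U k" if "a \<le> u" "u \<le> b" "k \<le> m" for u k
      using 1(9)[OF that(3)] that by (auto simp: set_eq_iff)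
    have UV: "u \<in> U k \<longleftrightarrow> u \<in> V k" if "a' \<le> u" "u \<le> b'" "k \<le> m" for u k
      using 2(9)[OF that(3)] that by (auto simp: set_eq_iff)
    show "(T, V) \<in> P_rel i j m"
    proof (rule P_relI[of _ _ _ ?a ?b])
      show "?a \<in> T 0" "?a \<in> V 0" "?b \<in> T 0" "?b \<in> V 0"
        using 1(2-8) 2(2-8) TU[of ?a 0] UV[of ?a 0] TU[of ?b 0] UV[of ?b 0]
        by (auto simp: max_def min_def split: if_splits)
      show "T k \<inter> {?a..?b} = V k \<inter> {?a..?b}" if "k \<le> m" for k
        using TU[OF _ _ that] UV[OF _ _ that] by auto
    qed (use 1(1-4) 2(1-4) in auto)
  qed
qed

lemma P_rel_act:
  assumes \<beta>: "\<beta> \<in> mon l m" and "(T, T') \<in> P_rel i j m"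
  shows "(act P l m \<beta> T, act P l m \<beta> T') \<in> P_rel i j l"
  using assms(2)
proof (rule P_relE)
  fix a b assume *: "T \<in> simps P m" "T' \<in> simps P m" "a \<le> i" "i < b" "b \<le> N" "a \<in> T 0" "a \<in> T' 0"
    "b \<in> T 0" "b \<in> T' 0" "\<And>k. k \<le> m \<Longrightarrow> T k \<inter> {a..b} = T' k \<inter> {a..b}"
  have \<beta>0: "\<beta> 0 \<le> m" using \<beta> by (simp add: mon_le)
  show ?thesis unfolding act_nerve
  proof (rule P_relI[of _ _ _ a b])
    show "a \<in> compose {..l} T \<beta> 0" "a \<in> compose {..l} T' \<beta> 0"
      "b \<in> compose {..l} T \<beta> 0" "b \<in> compose {..l} T' \<beta> 0"
      using P_0[OF *(1) \<beta>0] P_0[OF *(2) \<beta>0] *(6-9) by (simp_all add: compose_def)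
    show "compose {..l} T \<beta> k \<inter> {a..b} = compose {..l} T' \<beta> k \<inter> {a..b}" if "k \<le> l" for k
      using *(10)[OF mon_le[OF \<beta> that]] that by (simp add: compose_def)
  qed (use *(1-5) \<beta> in \<open>simp_all add: nerve_compose\<close>)
qed

lemmas P_facts = is_sset_nerve P_rel_equiv P_rel_act

lemma Pquot_sset: "is_sset (Pquot i j)"
  unfolding Pquot_def by (rule is_sset_quot[OF P_facts])

end

text \<open>The simplicial category with two objects and one prescribed mapping space between them, all other
  morphisms being identities. The value of all operations on identities is \<open>undefined\<close>, the only element
  of the endomorphism spaces.\<close>

definition arrow_cat :: "'a sset \<Rightarrow> (bool, 'a) scat" where
  "arrow_cat Y = \<lparr>obs = UNIV,
     mhom = (\<lambda>x y. if x = y then \<lparr>simps = (\<lambda>_. {undefined}), act = (\<lambda>_ _ _ _. undefined)\<rparr>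
       else if y then Y else \<lparr>simps = (\<lambda>_. {}), act = (\<lambda>_ _ _ _. undefined)\<rparr>),
     mcomp = (\<lambda>x y z m g f. if x = y then g else f),
     mid = (\<lambda>_. undefined)\<rparr>"

lemma arrow_cat_simps [simp]:
  "obs (arrow_cat Y) = UNIV" "mhom (arrow_cat Y) False True = Y"
  by (simp_all add: arrow_cat_def)

lemma is_scat_arrow_cat:
  assumes "is_sset Y"
  shows "is_scat (arrow_cat Y)"
  using assms unfolding is_scat_def arrow_cat_def by (auto simp: is_sset_def degen_def)

context join_sset
begin

lemma unit_idN:
  assumes "a \<le> i" "i < b" "b \<le> N" "T \<in> subset_chains a b m"
  shows "snd (unit_map N idN) a b m T = gcls m N idN a b T"
  using assms by (intro unit_map_gcls idN_in) auto

text \<open>The pieces of the chain between \<open>a\<close> and \<open>a'\<close> and between \<open>b'\<close> and \<open>b\<close> lie in one join factor and become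
  identities in the rigidification.\<close>

lemma gcls_cut_inner:
  assumes T: "T \<in> simps P m" and a: "a \<le> a'" "a' \<le> i" and b: "i < b'" "b' \<le> b" "b \<le> N"
    and in': "a \<in> T 0" "a' \<in> T 0" "b \<in> T 0" "b' \<in> T 0"
  shows "gcls m N idN a b (cut m a b T) = gcls m N idN a' b' (cut m a' b' T)"
proof -
  let ?G = "unit_map N idN"
  have bip: "bipartite (rigid Q) v0 v1 N (\<lambda>k. i < idN k) ?G"
    by (rule bip_maps_bipartite[OF is_scat_rigid[OF Q] rigid_v_obs unit_map_bip idN_in])
  note cup = bipartite_hom_cup[OF is_scat_rigid[OF Q] rigid_v_obs bip]
  have 1: "cut m a a' T \<in> subset_chains a a' m" "cut m a' b' T \<in> subset_chains a' b' m"
    "cut m b' b T \<in> subset_chains b' b m"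
    using T a b in' by (auto intro!: cut_chains)
  \<comment> \<open>The outer two of the three pieces stay on one side and are dropped by functoriality.\<close>
  have "cut m a b T = cup m (cut m a a' T) (cup m (cut m a' b' T) (cut m b' b T))"
    using a b by (auto simp: cut_def cup_def fun_eq_iff)
  then have "snd ?G a b m (cut m a b T) = snd ?G a' b' m (cut m a' b' T)"
    using a b by (simp add: cup[OF _ 1(1) chains_cup[OF 1(2,3)]] cup[OF _ 1(2,3)])
  moreover have "snd ?G a b m (cut m a b T) = gcls m N idN a b (cut m a b T)"
    "snd ?G a' b' m (cut m a' b' T) = gcls m N idN a' b' (cut m a' b' T)"
    using T a b in' by (simp_all add: unit_idN cut_chains)
  ultimately show ?thesis by simp
qed

lemma gcls_cut:
  assumes T: "T \<in> simps P m" and ab: "a \<le> i" "a \<in> T 0" "i < b" "b \<le> N" "b \<in> T 0"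
    and ab': "a' \<le> i" "a' \<in> T 0" "i < b'" "b' \<le> N" "b' \<in> T 0"
  shows "gcls m N idN a b (cut m a b T) = gcls m N idN a' b' (cut m a' b' T)"
  using gcls_cut_inner[OF T, of a "max a a'" "min b b'" b]
    gcls_cut_inner[OF T, of a' "max a a'" "min b b'" b'] ab ab'
  by (auto simp: max_def min_def split: if_splits)

text \<open>All generators that occur in the definition of \<^const>\<open>P_to_Q\<close> for the class of \<open>T\<close> represent the same
  morphism, which can be computed from any \<open>a\<close> and \<open>b\<close>.\<close>

lemma P_to_Q_class:
  assumes T: "T \<in> simps P m" and ab: "a \<le> i" "a \<in> T 0" "i < b" "b \<le> N" "b \<in> T 0"
  shows "P_to_Q i j m (P_rel i j m `` {T}) = gcls m N idN a b (cut m a b T)"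
proof -
  let ?c = "P_rel i j m `` {T}"
  let ?gen = "\<lambda>T a b. [Gen N (q N idN) a b (cut m a b T)]"
  have c: "?c \<in> simps (Pquot i j) m"
    unfolding Pquot_def by (rule quot_simpsI[OF P_facts T])
  have "P_to_Q i j m ?c = (\<Union>u\<in>{?gen T' a' b' |T' a' b'. T' \<in> ?c \<and> a' \<in> T' 0 \<inter> {..i} \<and> b' \<in> T' 0 \<inter> {i<..N}}.
      pcls Q m v0 v1 u)"
    using c unfolding P_to_Q_def Jsset_eq J0_eq J1_eq J_rel_eq N[symmetric] q_def[symmetric] cut_def[symmetric]
    by (auto simp: pcls_def)
  also have "\<dots> = (\<Union>u\<in>{?gen T a b}. pcls Q m v0 v1 u)"
  proof -
    have "pcls Q m v0 v1 (?gen T' a' b') = pcls Q m v0 v1 (?gen T a b)"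
      if T': "T' \<in> ?c" "a' \<in> T' 0 \<inter> {..i}" "b' \<in> T' 0 \<inter> {i<..N}" for T' a' b'
    proof -
      obtain a0 b0 where *: "T' \<in> simps P m" "a0 \<le> i" "i < b0" "b0 \<le> N" "a0 \<in> T 0" "a0 \<in> T' 0"
        "b0 \<in> T 0" "b0 \<in> T' 0" "cut m a0 b0 T = cut m a0 b0 T'"
        using T'(1) unfolding Image_singleton_iff P_rel_iff by blast
      have "gcls m N idN a' b' (cut m a' b' T') = gcls m N idN a0 b0 (cut m a0 b0 T')"
        using T' * by (intro gcls_cut) auto
      also have "\<dots> = gcls m N idN a b (cut m a b T)"
        using T ab * unfolding *(9)[symmetric] by (intro gcls_cut) auto
      finally show ?thesis by (simp add: gcls_def)
    qed
    moreover have "T \<in> ?c" "a \<in> T 0 \<inter> {..i}" "b \<in> T 0 \<inter> {i<..N}"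
      using equiv_class_self[OF P_rel_equiv T] ab by auto
    ultimately show ?thesis by blast
  qed
  finally show ?thesis by (simp add: gcls_def)
qed

text \<open>Together with the mirrored statement this is the functoriality that a bipartite functor
  with values in \<^term>\<open>arrow_cat (Pquot i j)\<close> has to satisfy.\<close>

lemma P_rel_cup_left:
  assumes A: "A \<in> subset_chains a0 a m" and B: "B \<in> subset_chains a b m" and ab: "a \<le> i" "i < b" "b \<le> N"
  shows "(cup m A B, B) \<in> P_rel i j m"
proof (rule P_relI[of _ _ _ a b])
  show "cup m A B \<in> simps P m"
    using chains_P[OF chains_cup[OF A B]] chains_le[OF A] ab by simp
  show "B \<in> simps P m" using chains_P[OF B] ab by simp
  show "cup m A B k \<inter> {a..b} = B k \<inter> {a..b}" if "k \<le> m" for k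
    using chains_bounds[OF A that] chains_ends[OF B that] that by (fastforce simp: cup_def)
qed (use ab chains_ends[OF B, of 0] in \<open>simp_all add: cup_def\<close>)

lemma P_rel_cup_right:
  assumes A: "A \<in> subset_chains a b m" and B: "B \<in> subset_chains b b0 m" and ab: "a \<le> i" "i < b" "b0 \<le> N"
  shows "(cup m A B, A) \<in> P_rel i j m"
proof (rule P_relI[of _ _ _ a b])
  have b: "b \<le> b0" using B by (rule chains_le)
  show "cup m A B \<in> simps P m"
    using chains_P[OF chains_cup[OF A B]] b ab by simp
  show "A \<in> simps P m" "b \<le> N" using chains_P[OF A] b ab by simp_all
  show "cup m A B k \<inter> {a..b} = A k \<inter> {a..b}" if "k \<le> m" for k
    using chains_bounds[OF B that] chains_ends[OF A that] that by (fastforce simp: cup_def)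
qed (use ab chains_ends[OF A, of 0] in \<open>simp_all add: cup_def\<close>)

text \<open>The functors that send a mixed chain to its class in the quotient of the nerve. Their transpose is a
  left inverse of \<^const>\<open>P_to_Q\<close>.\<close>

definition class_map where
  "class_map = (\<lambda>p. \<lambda>\<alpha>\<in>mon p N. bip_functor (arrow_cat (Pquot i j)) False True p (\<lambda>k. i < \<alpha> k)
     (\<lambda>k l m T. P_rel i j m `` {img \<alpha> m T}))"

lemma class_map_bip: "class_map \<in> bip_maps (arrow_cat (Pquot i j)) False True"
proof (rule bip_mapsI)
  let ?C = "arrow_cat (Pquot i j)"
  show C: "is_scat ?C" by (rule is_scat_arrow_cat[OF Pquot_sset])
  have img_P: "img \<alpha> m T \<in> simps P m"
    if "\<alpha> \<in> mon p N" "l \<le> p" "\<not> i < \<alpha> k" "i < \<alpha> l" "T \<in> subset_chains k l m" for p \<alpha> k l m T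
    using that by (intro chains_P[OF chains_img[OF that(1,5,2)]]) (auto simp: mon_le)
  show bip: "bipartite ?C False True p (\<lambda>k. i < s k) (class_map p s)" if "s \<in> simps (std N) p" for p s
  proof -
    have \<alpha>: "s \<in> mon p N" using that by simp
    note P = img_P[OF \<alpha>]
    have "class_map p s = bip_functor ?C False True p (\<lambda>k. i < s k) (\<lambda>k l m T. P_rel i j m `` {img s m T})"
      using \<alpha> by (simp add: class_map_def)
    also have "bipartite ?C False True p (\<lambda>k. i < s k) \<dots>"
    proof (rule bipartite_bip_functor[OF C])
      show "i < s k" if "k' \<le> k" "k \<le> p" "i < s k'" for k' k
        using that mon_mono[OF \<alpha> that(1,2)] by simp
      show "P_rel i j m `` {img s m T} \<in> simps (mhom ?C False True) m"
        if "l \<le> p" "\<not> i < s k" "i < s l" "T \<in> subset_chains k l m" for k l m T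
        unfolding arrow_cat_simps Pquot_def by (rule quot_simpsI[OF P_facts P[OF that]])
      show "P_rel i j n `` {img s n (compose {..n} T \<beta>)} =
         act (mhom ?C False True) n m \<beta> (P_rel i j m `` {img s m T})"
        if "l \<le> p" "\<not> i < s k" "i < s l" "T \<in> subset_chains k l m" "\<beta> \<in> mon n m" for k l m n T \<beta>
        using quot_act[OF P_facts that(5) P[OF that(1-4)]]
        by (simp add: img_compose[OF that(5)] Pquot_def)
      show "P_rel i j m `` {img s m (cup m T U)} = P_rel i j m `` {img s m U}"
        if "l \<le> p" "\<not> i < s k'" "\<not> i < s k" "i < s l" "T \<in> subset_chains k' k m" "U \<in> subset_chains k l m"
        for k' k l m T U
        unfolding img_cup using that chains_le[OF that(6)] mon_le[OF \<alpha> that(1)]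
        by (intro equiv_class_eq[OF P_rel_equiv] P_rel_cup_left[OF chains_img[OF \<alpha> that(5)] chains_img[OF \<alpha> that(6)]]) auto
      show "P_rel i j m `` {img s m (cup m T U)} = P_rel i j m `` {img s m T}"
        if "l \<le> p" "\<not> i < s k'" "i < s k" "i < s l" "T \<in> subset_chains k' k m" "U \<in> subset_chains k l m"
        for k' k l m T U
        unfolding img_cup using that chains_le[OF that(6)] mon_le[OF \<alpha> that(1)]
        by (intro equiv_class_eq[OF P_rel_equiv] P_rel_cup_right[OF chains_img[OF \<alpha> that(5)] chains_img[OF \<alpha> that(6)]]) auto
    qed simp_all
    finally show ?thesis .
  qed
  show "class_map \<in> smaps (std N) (cnerve ?C)"
  proof (rule smapsI)
    show "class_map n s \<in> simps (cnerve ?C) n" if "s \<in> simps (std N) n" for n s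
      using bip[OF that] by (simp add: bipartite_functor)
    show "class_map n \<in> extensional (simps (std N) n)" for n by (simp add: class_map_def)
    show "class_map m (act (std N) m n \<alpha> s) = act (cnerve ?C) m n \<alpha> (class_map n s)"
      if \<alpha>: "\<alpha> \<in> mon m n" and "s \<in> simps (std N) n" for m n \<alpha> s
    proof -
      have s: "s \<in> mon n N" using that by simp
      have "bip_functor ?C False True m (\<lambda>k. i < compose {..m} s \<alpha> k) (\<lambda>k l q T. P_rel i j q `` {img (compose {..m} s \<alpha>) q T}) =
        bip_functor ?C False True m (\<lambda>k. i < s (\<alpha> k)) (\<lambda>k l q T. P_rel i j q `` {img s q (img \<alpha> q T)})"
      proof (rule bip_functor_cong)
        show "i < compose {..m} s \<alpha> k" if "k' \<le> k" "k \<le> m" "i < compose {..m} s \<alpha> k'" for k' k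
          using that mon_mono[OF mon_comp[OF s \<alpha>], of k' k] by auto
        show "P_rel i j q `` {img (compose {..m} s \<alpha>) q T} = P_rel i j q `` {img s q (img \<alpha> q T)}"
          if "l \<le> m" "T \<in> subset_chains k l q" for k l q T
          unfolding img_comp[OF that(2,1)] ..
      qed (simp add: compose_eq)
      then show ?thesis using s \<alpha> by (simp add: class_map_def mon_comp act_bip_functor)
    qed
  qed
qed auto

text \<open>The isomorphism \<open>\<tau>\<close> is defined on \<^const>\<open>Qspace\<close> by means of the inverse of \<^const>\<open>P_to_Q\<close>, so injectivity is
  indispensable to compute it. A functor out of the rigidification separates the classes.\<close>

lemma P_to_Q_inj: "inj_on (P_to_Q i j m) (simps (Pquot i j) m)"
proof (rule inj_onI)
  fix c c' assume "c \<in> simps (Pquot i j) m" "c' \<in> simps (Pquot i j) m" and eq: "P_to_Q i j m c = P_to_Q i j m c'"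
  then obtain T T' where T: "T \<in> simps P m" "c = P_rel i j m `` {T}" and T': "T' \<in> simps P m" "c' = P_rel i j m `` {T'}"
    by (auto simp: Pquot_def quot_simps[OF P_facts])
  let ?C = "arrow_cat (Pquot i j)"
  have C: "is_scat ?C" "False \<in> obs ?C" "True \<in> obs ?C" using Pquot_sset by (simp_all add: is_scat_arrow_cat)
  have "transpose ?C class_map m (P_to_Q i j m (P_rel i j m `` {T})) = P_rel i j m `` {T}"
    if T: "T \<in> simps P m" for T
  proof -
    obtain a b where ab: "a \<le> i" "a \<in> T 0" "b \<in> {i<..N}" "b \<in> T 0"
      using T unfolding P_iff by blast
    have ab': "i < b" "b \<le> N" "\<not> i < a" "i < idN b" "\<not> i < idN a" using ab by auto
    have cT: "cut m a b T \<in> subset_chains a b m" using T ab by (intro cut_chains) auto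
    have "transpose ?C class_map m (P_to_Q i j m (P_rel i j m `` {T})) = snd (class_map N idN) a b m (cut m a b T)"
      unfolding P_to_Q_class[OF T ab(1,2) ab'(1,2) ab(4)]
      by (rule transpose_gcls[OF C class_map_bip idN_in ab'(2,5,4) cT])
    also have "\<dots> = P_rel i j m `` {img idN m (cut m a b T)}"
      using ab ab' cT by (simp add: class_map_def mon_id bip_functor_hom)
    also have "img idN m (cut m a b T) = cut m a b T" by (rule img_id[OF cT ab'(2)])
    also have "P_rel i j m `` {cut m a b T} = P_rel i j m `` {T}"
    proof (rule equiv_class_eq[OF P_rel_equiv], rule P_relI[of _ _ _ a b])
      show "cut m a b T \<in> simps P m" by (rule chains_P[OF cT ab(1) ab'(1,2)])
    qed (use T ab ab' in \<open>auto simp: cut_def\<close>)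
    finally show ?thesis .
  qed
  from this[OF T(1)] this[OF T'(1)]
  have "transpose ?C class_map m (P_to_Q i j m c) = c" "transpose ?C class_map m (P_to_Q i j m c') = c'"
    unfolding T(2) T'(2) .
  then show "c = c'" unfolding eq by simp
qed

end

locale join_pair = fw: join_sset i j N + bw: join_sset j i N for i j N
begin

text \<open>In the coordinates \<open>[i + j + 1]\<close> of the join, \<open>\<tau>\<close> is the order-reversing bijection.\<close>

lemma tau_eq: "tau i j = (\<lambda>p\<in>{..N}. N - p)"
  using fw.N by (auto simp: tau_def fun_eq_iff)

lemma rev_P:
  assumes "T \<in> simps fw.P m"
  shows "rev_chain N m T \<in> simps bw.P m"
proof -
  obtain a b where "a \<le> i" "a \<in> T 0" "b \<in> {i<..N}" "b \<in> T 0"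
    using assms unfolding fw.P_iff by blast
  then have "\<exists>a'\<le>j. a' \<in> rev_chain N m T 0" "\<exists>b'\<in>{j<..N}. b' \<in> rev_chain N m T 0"
    using fw.N by (auto simp: img_def intro!: exI[of _ "N - b"] bexI[of _ "N - a"])
  moreover have "rev_chain N m T k \<subseteq> rev_chain N m T k'" if "k \<le> k'" "k' \<le> m" for k k'
    using fw.P_mono[OF assms that] that by (auto simp: img_def)
  moreover have "rev_chain N m T k \<subseteq> {..N}" if "k \<le> m" for k
    using that by (auto simp: img_def)
  moreover have "rev_chain N m T \<in> extensional {..m}" by (simp add: img_def)
  ultimately show ?thesis unfolding bw.P_iff by blast
qed

lemma rev_P_rel:
  assumes "(T, T') \<in> P_rel i j m"
  shows "(rev_chain N m T, rev_chain N m T') \<in> P_rel j i m"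
  using assms
proof (rule fw.P_relE)
  fix a b assume *: "T \<in> simps fw.P m" "T' \<in> simps fw.P m" "a \<le> i" "i < b" "b \<le> N" "a \<in> T 0" "a \<in> T' 0"
    "b \<in> T 0" "b \<in> T' 0" "\<And>k. k \<le> m \<Longrightarrow> T k \<inter> {a..b} = T' k \<inter> {a..b}"
  show ?thesis
  proof (rule bw.P_relI[of _ _ _ "N - b" "N - a"])
    have eq: "(\<lambda>u. N - u) ` T k \<inter> {N - b..N - a} = (\<lambda>u. N - u) ` (T k \<inter> {a..b})"
      if "T \<in> simps fw.P m" "k \<le> m" for T k
    proof -
      have "N - u \<in> {N - b..N - a} \<longleftrightarrow> u \<in> {a..b}" if "u \<in> T k" for u
        using fw.P_sub[OF \<open>T \<in> simps fw.P m\<close> \<open>k \<le> m\<close> that] *(3-5) by auto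
      then show ?thesis by blast
    qed
    show "rev_chain N m T k \<inter> {N - b..N - a} = rev_chain N m T' k \<inter> {N - b..N - a}" if "k \<le> m" for k
      using that *(10)[OF that] by (simp add: img_def eq[OF *(1)] eq[OF *(2)])
    show "rev_chain N m T \<in> simps bw.P m" "rev_chain N m T' \<in> simps bw.P m"
      using *(1,2) by (simp_all add: rev_P)
  qed (use *(3-9) fw.N in \<open>auto simp: img_def\<close>)
qed

lemma tau_P_class:
  assumes T: "T \<in> simps fw.P m"
  shows "tau_P i j m (P_rel i j m `` {T}) = P_rel j i m `` {rev_chain N m T}"
proof -
  have tau: "(\<lambda>k\<in>{..m}. tau i j ` T k) = rev_chain N m T" if "T \<in> simps fw.P m" for T
    using fw.P_sub[OF that] by (auto simp: img_def tau_eq fun_eq_iff image_iff Bex_def)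
  have "tau_P i j m (P_rel i j m `` {T}) = P_rel j i m `` {\<lambda>k\<in>{..m}. tau i j ` T k}"
    unfolding tau_P_def
  proof (rule descend_class[OF fw.P_facts _ T])
    fix T' assume rel: "(T, T') \<in> P_rel i j m"
    then have "T' \<in> simps fw.P m" by (rule fw.P_relE)
    then show "P_rel j i m `` {\<lambda>k\<in>{..m}. tau i j ` T' k} = P_rel j i m `` {\<lambda>k\<in>{..m}. tau i j ` T k}"
      using equiv_class_eq[OF bw.P_rel_equiv rev_P_rel[OF rel]] by (simp add: tau T)
  qed
  then show ?thesis by (simp add: tau T)
qed

lemma tau_Q_idN:
  assumes ab: "a \<le> i" "i < b" "b \<le> N" and T: "T \<in> subset_chains a b m"
  shows "tau_Q i j m (fw.gcls m N fw.idN a b T) = bw.gcls m N bw.idN (N - b) (N - a) (rev_chain N m T)"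
proof -
  have T0: "a \<in> T 0" "b \<in> T 0" using chains_ends[OF T, of 0] by auto
  have P: "T \<in> simps fw.P m" by (rule fw.chains_P[OF T ab])
  have PT: "P_to_Q i j m (P_rel i j m `` {T}) = fw.gcls m N fw.idN a b T"
    using fw.P_to_Q_class[OF P ab(1) T0(1) ab(2,3) T0(2)] by (simp add: fw.cut_id[OF T])
  have c: "P_rel i j m `` {T} \<in> simps (Pquot i j) m"
    unfolding Pquot_def by (rule quot_simpsI[OF fw.P_facts P])
  have rT: "rev_chain N m T \<in> subset_chains (N - b) (N - a) m"
    by (rule rev_chain_chains[OF T ab(3)])
  have "fw.gcls m N fw.idN a b T \<in> simps (Qspace i j) m"
    unfolding fw.Qspace_eq using ab T by (intro fw.gcls_in fw.idN_in) auto
  then have "tau_Q i j m (fw.gcls m N fw.idN a b T) = P_to_Q j i m (P_rel j i m `` {rev_chain N m T})"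
    unfolding tau_Q_def
    by (simp add: PT[symmetric] the_inv_into_f_f[OF fw.P_to_Q_inj c] tau_P_class[OF P])
  also have "\<dots> = bw.gcls m N bw.idN (N - b) (N - a) (bw.cut m (N - b) (N - a) (rev_chain N m T))"
    using ab fw.N chains_ends[OF rT, of 0] by (intro bw.P_to_Q_class[OF rev_P[OF P]]) auto
  finally show ?thesis by (simp add: bw.cut_id[OF rT])
qed

text \<open>An operator moves any generator to the top simplex of the join, where \<open>\<tau>\<close> can be computed in the
  quotient of the nerve.\<close>

lemma tau_Q_gcls:
  assumes \<alpha>: "\<alpha> \<in> mon p N" and l: "l \<le> p" and side: "\<alpha> k \<le> i" "i < \<alpha> l" and T: "T \<in> subset_chains k l m"
  shows "tau_Q i j m (fw.gcls m p \<alpha> k l T) =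
    bw.gcls m p (reflect p N \<alpha>) (p - l) (p - k) (rev_chain p m T)"
proof -
  have k: "k \<le> l" using T by (rule chains_le)
  have "tau_Q i j m (fw.gcls m p \<alpha> k l T) =
     bw.gcls m N bw.idN (N - \<alpha> l) (N - \<alpha> k) (rev_chain N m (img \<alpha> m T))"
    unfolding fw.gcls_std[OF \<alpha> l side T]
    by (rule tau_Q_idN[OF side mon_le[OF \<alpha> l] chains_img[OF \<alpha> T l]])
  also have "\<dots> = bw.gcls m p (reflect p N \<alpha>) (p - l) (p - k) (rev_chain p m T)"
  proof -
    have "N - \<alpha> l \<le> j" "j < N - \<alpha> k" using side mon_le[OF \<alpha> l] fw.N by auto
    then show ?thesis
      using bw.gcls_std[OF reflect_mon[OF \<alpha>] _ _ _ rev_chain_chains[OF T l]] l k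
      by (simp add: img_reflect[OF \<alpha> T l])
  qed
  finally show ?thesis .
qed

sublocale reversal_pair "std N" "\<lambda>\<alpha> k. i < \<alpha> k" "constm 0 0" "constm 0 N"
  "std N" "\<lambda>\<alpha> k. j < \<alpha> k" "constm 0 0" "constm 0 N" "\<lambda>p. reflect p N" "\<lambda>p. reflect p N"
proof
  have "j < N - s k \<longleftrightarrow> \<not> i < s k" if "s \<in> mon p N" "k \<le> p" for s p k
    using mon_le[OF that] fw.N by auto
  then show "j < reflect p N s k \<longleftrightarrow> \<not> i < s (p - k)" if "s \<in> simps (std N) p" "k \<le> p" for s p k
    using that by simp
  have "i < N - s k \<longleftrightarrow> \<not> j < s k" if "s \<in> mon p N" "k \<le> p" for s p k
    using mon_le[OF that] fw.N by auto
  then show "i < reflect p N s k \<longleftrightarrow> \<not> j < s (p - k)" if "s \<in> simps (std N) p" "k \<le> p" for s p k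
    using that by simp
qed (auto simp: reflect_mon reflect_compose reflect_reflect)

end

section \<open>One-sided mapping spaces\<close>

context join_sset
begin

text \<open>If one join factor is a point, being constant on it is a condition on a single vertex.\<close>

lemma map_const_iff:
  assumes g: "g \<in> smaps (std N) (cnerve C)" and v: "v \<le> N" and part: "\<And>m. part c m = {constm m v}"
  shows "g 0 (constm 0 v) = cnerve_obj C z \<longleftrightarrow>
    (\<forall>m. \<forall>\<alpha>\<in>part c m. g m \<alpha> = degen (cnerve C) m (cnerve_obj C z))"
proof -
  have deg: "g m (constm m v) = degen (cnerve C) m (g 0 (constm 0 v))" for m
    using smaps_act[OF g, of "constm m 0" m 0 "constm 0 v"] v
    by (simp add: mon_const const_compose degen_def)
  show ?thesis unfolding part
  proof
    assume "\<forall>m. \<forall>\<alpha>\<in>{constm m v}. g m \<alpha> = degen (cnerve C) m (cnerve_obj C z)"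
    then have "g 0 (constm 0 v) = degen (cnerve C) 0 (cnerve_obj C z)" by blast
    then show "g 0 (constm 0 v) = cnerve_obj C z" unfolding degen_0_cnerve_obj .
  next
    assume "g 0 (constm 0 v) = cnerve_obj C z"
    then show "\<forall>m. \<forall>\<alpha>\<in>{constm m v}. g m \<alpha> = degen (cnerve C) m (cnerve_obj C z)"
      using deg by (metis singletonD)
  qed
qed

end

lemma HomL_simps:
  assumes "join_sset n 0 N"
  shows "simps (HomL (cnerve C) (cnerve_obj C x) (cnerve_obj C y)) n =
    bipartite_sset.bip_maps (std N) (\<lambda>\<alpha> k. n < \<alpha> k) C x y"
proof -
  interpret join_sset n 0 N by (rule assms)
  have "part True m = {constm m N}" for m
  proof -
    have "\<alpha> = constm m N" if "\<alpha> \<in> part True m" for \<alpha>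
    proof (rule extensionalityI[of _ "{..m}"])
      show "\<alpha> k = constm m N k" if "k \<in> {..m}" for k
      proof -
        have "n < \<alpha> k" "\<alpha> k \<le> N" using \<open>\<alpha> \<in> part True m\<close> that by (auto simp: part_def mon_le)
        then show ?thesis using N that by simp
      qed
    qed (use that in \<open>auto simp: part_def mon_ext constm_def\<close>)
    moreover have "n < N" using N by simp
    then have "constm m N \<in> part True m" by (simp add: part_def mon_const)
    ultimately show ?thesis by blast
  qed
  note const = map_const_iff[OF _ order_refl this, of _ C y]
  have "n + 1 = N" using N by simp
  then have "simps (HomL (cnerve C) (cnerve_obj C x) (cnerve_obj C y)) n =
    {g \<in> smaps (std N) (cnerve C). (\<forall>m. \<forall>\<alpha>\<in>part False m. g m \<alpha> = degen (cnerve C) m (cnerve_obj C x)) \<and>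
       g 0 (constm 0 N) = cnerve_obj C y}"
    unfolding HomL_def N[symmetric] by (simp add: join_left_eq)
  also have "\<dots> = bip_maps C x y"
    unfolding bip_maps_def all_bool_eq by (auto simp: const)
  finally show ?thesis .
qed

lemma HomR_simps:
  assumes "join_sset 0 n N"
  shows "simps (HomR (cnerve C) (cnerve_obj C x) (cnerve_obj C y)) n =
    bipartite_sset.bip_maps (std N) (\<lambda>\<alpha> k. 0 < \<alpha> k) C x y"
proof -
  interpret join_sset 0 n N by (rule assms)
  have "part False m = {constm m 0}" for m
  proof -
    have "\<alpha> = constm m 0" if "\<alpha> \<in> part False m" for \<alpha>
    proof (rule extensionalityI[of _ "{..m}"])
      show "\<alpha> k = constm m 0 k" if "k \<in> {..m}" for k
        using \<open>\<alpha> \<in> part False m\<close> that by (auto simp: part_def)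
    qed (use that in \<open>auto simp: part_def mon_ext constm_def\<close>)
    then show ?thesis by (auto simp: part_def mon_const)
  qed
  note const = map_const_iff[OF _ le0 this, of _ C x]
  have "Suc n = N" using N by simp
  then have "simps (HomR (cnerve C) (cnerve_obj C x) (cnerve_obj C y)) n =
    {g \<in> smaps (std N) (cnerve C). g 0 (constm 0 0) = cnerve_obj C x \<and>
       (\<forall>m. \<forall>\<alpha>\<in>part True m. g m \<alpha> = degen (cnerve C) m (cnerve_obj C y))}"
    unfolding HomR_def by (simp add: join_right_eq)
  also have "\<dots> = bip_maps C x y"
    unfolding bip_maps_def all_bool_eq by (auto simp: const)
  finally show ?thesis .
qed

section \<open>Suspension\<close>

locale suspension =
  fixes n :: nat
begin

lemma cyl_simps [simp]: "simps (cyl n) m = mon m n \<times> mon m (Suc 0)"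
  and cyl_act [simp]: "act (cyl n) l m \<beta> s = (compose {..l} (fst s) \<beta>, compose {..l} (snd s) \<beta>)"
  by (simp_all add: cyl_def sprod_def)

sublocale bipartite_sset "cyl n" "\<lambda>s k. 0 < snd s k" "(constm 0 0, constm 0 0)" "(constm 0 0, constm 0 (Suc 0))"
proof
  show "is_sset (cyl n)" unfolding cyl_def by (intro is_sset_sprod is_sset_std)
  show "0 < snd s k" if "s \<in> simps (cyl n) p" "j \<le> k" "k \<le> p" "0 < snd s j" for s p j k
    using that mon_mono[of "snd s" p "Suc 0" j k] by (auto simp: mem_Times_iff)
qed (auto simp: mon_const compose_eq)

definition \<theta> :: "nat \<Rightarrow> (nat \<Rightarrow> nat) \<times> (nat \<Rightarrow> nat) \<Rightarrow> (nat \<Rightarrow> nat) \<times> (nat \<Rightarrow> nat)" where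
  "\<theta> p s = (reflect p n (fst s), reflect p (Suc 0) (snd s))"

sublocale rev: reversal_pair "cyl n" "\<lambda>s k. 0 < snd s k" "(constm 0 0, constm 0 0)" "(constm 0 0, constm 0 (Suc 0))"
  "cyl n" "\<lambda>s k. 0 < snd s k" "(constm 0 0, constm 0 0)" "(constm 0 0, constm 0 (Suc 0))" \<theta> \<theta>
proof
  have "0 < Suc 0 - e (p - k) \<longleftrightarrow> \<not> 0 < e (p - k)" for e :: "nat \<Rightarrow> nat" and p k
    by auto
  then show "0 < snd (\<theta> p s) k \<longleftrightarrow> \<not> 0 < snd s (p - k)" if "s \<in> simps (cyl n) p" "k \<le> p" for s p k
    using that by (simp add: \<theta>_def)
qed (auto simp: \<theta>_def reflect_mon reflect_compose reflect_reflect)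

lemma cyl_end_eq: "cyl_end n 0 = part False" "cyl_end n (Suc 0) = part True"
proof -
  have const: "e = constm m c \<longleftrightarrow> (\<forall>k\<le>m. e k = c)" if "e \<in> mon m (Suc 0)" for e m c
    using that by (auto simp: mon_iff constm_def extensional_def fun_eq_iff)
  have 1: "e k = Suc 0 \<longleftrightarrow> 0 < e k" if "e \<in> mon m (Suc 0)" "k \<le> m" for e m k
    using mon_le[OF that] by auto
  show "cyl_end n 0 = part False"
    by (rule ext) (auto simp: cyl_end_def part_def mon_const const)
  show "cyl_end n (Suc 0) = part True"
    by (rule ext) (auto simp: cyl_end_def part_def mon_const const 1)
qed

lemma S_rel_eq: "S_rel n = R"
  by (simp add: S_rel_def R_def cyl_end_eq)

lemma Susp_eq: "Susp n = Q"
  by (simp add: Susp_def S_rel_eq)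

lemma S_vertex_eq: "S_vertex n 0 = v0" "S_vertex n 1 = v1"
  by (simp_all add: S_vertex_def S_rel_eq q_def)

lemma Wspace_eq: "Wspace n = mhom (rigid Q) v0 v1"
  unfolding Wspace_def Susp_eq S_vertex_eq ..

lemma W_transpose_eq:
  assumes C: "is_scat C" "x \<in> obs C" "y \<in> obs C"
  shows "W_transpose C n g = transpose C g"
  unfolding W_transpose_def transpose_def[OF C] Susp_eq S_vertex_eq S_rel_eq ..

lemma Hom_simps: "simps (Hom (cnerve C) (cnerve_obj C x) (cnerve_obj C y)) n = bip_maps C x y"
  unfolding bip_maps_def all_bool_eq by (auto simp: Hom_def cyl_end_eq)

subsection \<open>The maps from joins\<close>

text \<open>The map \<open>\<Delta>\<^sup>i * \<Delta>\<^sup>j \<rightarrow> \<Delta>\<^sup>0 * \<Delta>\<^sup>0 = \<Delta>\<^sup>1\<close>.\<close>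

definition join_proj :: "nat \<Rightarrow> nat \<Rightarrow> nat \<Rightarrow> nat" where
  "join_proj i j = join_map i j 0 (constm i 0) (constm j 0)"

lemma join_proj_apply: "k \<le> i + j + 1 \<Longrightarrow> join_proj i j k = (if k \<le> i then 0 else Suc 0)"
  by (auto simp: join_proj_def join_map_def)

lemma join_proj_mon: "join_proj i j \<in> mon (i + j + 1) (Suc 0)"
  by (auto simp: mon_iff join_proj_apply join_proj_def join_map_def)

lemma reflect_join_proj: "reflect (i + j + 1) (Suc 0) (join_proj i j) = join_proj j i"
  by (rule extensionalityI[of _ "{..i + j + 1}"])
    (auto simp: reflect_def join_proj_apply, auto simp: join_proj_def join_map_def)

lemma J_to_S_q:
  assumes J: "join_sset i j N" and f: "f \<in> mon N n"
  shows "J_to_S i j n f \<in> smaps (Jsset i j) (Susp n)"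
    and "\<alpha> \<in> mon m N \<Longrightarrow> J_to_S i j n f m (bipartite_sset.q (std N) (\<lambda>\<alpha> k. i < \<alpha> k) m \<alpha>) =
      q m (compose {..m} f \<alpha>, compose {..m} (join_proj i j) \<alpha>)"
proof -
  interpret J: join_sset i j N by (rule J)
  define h where "h = (\<lambda>m. \<lambda>\<alpha>\<in>mon m N. q m (compose {..m} f \<alpha>, compose {..m} (join_proj i j) \<alpha>))"
  have proj: "join_proj i j \<in> mon N (Suc 0)" using join_proj_mon[of i j] J.N by simp
  have h_in: "(compose {..m} f \<alpha>, compose {..m} (join_proj i j) \<alpha>) \<in> simps (cyl n) m" if "\<alpha> \<in> mon m N" for m \<alpha>
    using that f proj by (simp add: mon_comp)
  have h: "h \<in> smaps (std N) Q"
  proof (rule smapsI)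
    show "h m (act (std N) m p \<beta> \<alpha>) = act Q m p \<beta> (h p \<alpha>)" if \<beta>: "\<beta> \<in> mon m p" and "\<alpha> \<in> simps (std N) p" for m p \<beta> \<alpha>
    proof -
      have "compose {..m} g (compose {..m} \<alpha> \<beta>) = compose {..m} (compose {..p} g \<alpha>) \<beta>" for g :: "nat \<Rightarrow> nat"
        using \<beta> by (auto simp: compose_def fun_eq_iff mon_le)
      then show ?thesis using that h_in[of \<alpha> p] by (simp add: h_def mon_comp act_q)
    qed
    show "h m \<alpha> \<in> simps Q m" if "\<alpha> \<in> simps (std N) m" for m \<alpha>
      using that q_in[OF h_in] by (simp add: h_def)
  qed (simp add: h_def)
  have eq: "h m \<beta> = h m \<alpha>" if rel: "(\<alpha>, \<beta>) \<in> J.R m" for m \<alpha> \<beta>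
  proof (cases "\<alpha> = \<beta>")
    case False
    then obtain c where c: "\<alpha> \<in> J.part c m" "\<beta> \<in> J.part c m" using rel by (auto simp: J.R_iff)
    have "(compose {..m} f \<gamma>, compose {..m} (join_proj i j) \<gamma>) \<in> part c m" if "\<gamma> \<in> J.part c m" for \<gamma>
    proof -
      have \<gamma>: "\<gamma> \<in> mon m N" "\<And>k. k \<le> m \<Longrightarrow> (i < \<gamma> k) = c" using that by (auto simp: J.part_def)
      have "(0 < join_proj i j (\<gamma> k)) = c" if "k \<le> m" for k
        using \<gamma>(2)[OF that] mon_le[OF \<gamma>(1) that] J.N by (auto simp: join_proj_apply)
      then show ?thesis using h_in[OF \<gamma>(1)] by (auto simp: part_def compose_eq)
    qed
    note part = this[OF c(1)] this[OF c(2)]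
    have mem: "\<alpha> \<in> mon m N" "\<beta> \<in> mon m N" using c by (auto simp: J.part_def)
    have "q m (compose {..m} f \<alpha>, compose {..m} (join_proj i j) \<alpha>) =
       q m (compose {..m} f \<beta>, compose {..m} (join_proj i j) \<beta>)"
      using part h_in[OF mem(1)] h_in[OF mem(2)] unfolding q_eq_iff[OF h_in[OF mem(1)] h_in[OF mem(2)]] R_iff
      by blast
    then show ?thesis using mem by (simp add: h_def)
  qed simp
  have J_to_S: "J_to_S i j n f = descend (std N) J.R h"
  proof -
    have "(\<lambda>\<alpha>. q m (compose {..m} f \<alpha>, compose {..m} (join_proj i j) \<alpha>)) ` c = h m ` c"
      if "c \<in> simps J.Q m" for m c
      using that J.R_iff[of _ _ m] by (intro image_cong) (auto simp: J.Q_simps J.q_def h_def)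
    then show ?thesis
      unfolding J_to_S_def descend_def J.J_rel_eq J.N[symmetric] S_rel_eq q_def[symmetric] join_proj_def[symmetric]
      by (intro ext restrict_ext) simp
  qed
  show "J_to_S i j n f \<in> smaps (Jsset i j) (Susp n)"
    unfolding J_to_S J.Jsset_eq Susp_eq
    by (rule descend_smaps[OF J.X J.R_equiv J.R_act h eq])
  show "J_to_S i j n f m (J.q m \<alpha>) = q m (compose {..m} f \<alpha>, compose {..m} (join_proj i j) \<alpha>)"
    if "\<alpha> \<in> mon m N"
  proof -
    have "descend (std N) J.R h m (J.R m `` {\<alpha>}) = h m \<alpha>"
      by (rule descend_class[OF J.X J.R_equiv J.R_act eq]) (use that in simp_all)
    then show ?thesis using that unfolding J_to_S J.q_def by (simp add: h_def)
  qed
qed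

lemma iota_gcls:
  assumes J: "join_sset i j N" and f: "f \<in> mon N n"
    and \<alpha>: "\<alpha> \<in> mon p N" "l \<le> p" "\<alpha> k \<le> i" "i < \<alpha> l" and T: "T \<in> subset_chains k l m"
  shows "iota i j n f m (bipartite_sset.gcls (std N) (\<lambda>\<alpha> k. i < \<alpha> k) (constm 0 0) (constm 0 N) m p \<alpha> k l T) =
    gcls m p (compose {..p} f \<alpha>, compose {..p} (join_proj i j) \<alpha>) k l T"
proof -
  interpret J: join_sset i j N by (rule J)
  note JS = J_to_S_q[OF J f]
  have proj: "join_proj i j \<in> mon N (Suc 0)" using join_proj_mon[of i j] J.N by simp
  have vert: "J_to_S i j n f 0 (J.q 0 (constm 0 v)) = (if 0 < join_proj i j v then v1 else v0)"
    if v: "v \<le> N" for v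
  proof -
    have "(constm 0 (f v), constm 0 (join_proj i j v)) \<in> simps (cyl n) 0"
      using mon_le[OF f v] mon_le[OF proj v] by (simp add: mon_const)
    from q_vertex[OF this] show ?thesis
      unfolding JS(2)[OF mon_const[OF v]] compose_const[OF f v] compose_const[OF proj v] by simp
  qed
  have "join_proj i j 0 = 0" "join_proj i j N = Suc 0"
    using join_proj_apply[of 0 i j] join_proj_apply[of N i j] J.N by simp_all
  then have v: "J_to_S i j n f 0 J.v0 = v0" "J_to_S i j n f 0 J.v1 = v1"
    using vert[of 0] vert[of N] by simp_all
  have "cpath J.Q m J.v0 J.v1 [Gen p (J.q p \<alpha>) k l T]"
    using J.gcls_path[of \<alpha> p l k T m] \<alpha> T by simp
  then have "iota i j n f m (J.gcls m p \<alpha> k l T) = pcls Q m v0 v1 [Gen p (J_to_S i j n f p (J.q p \<alpha>)) k l T]"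
    using JS(1) unfolding iota_def J.J0_eq J.J1_eq J.gcls_def J.Jsset_eq Susp_eq
    by (simp add: rigid_map_pcls[OF J.Q Q] v)
  then show ?thesis using \<alpha> by (simp add: JS(2) gcls_def)
qed

lemma transpose_unit:
  assumes "s \<in> simps (cyl n) p" "l \<le> p" "\<not> 0 < snd s k" "0 < snd s l" "T \<in> subset_chains k l m"
  shows "transpose (rigid Q) unit_map m (gcls m p s k l T) = gcls m p s k l T"
  using transpose_gcls[OF is_scat_rigid[OF Q] rigid_v_obs unit_map_bip assms] unit_map_gcls[OF assms] by simp

definition is_rho where
  "is_rho \<rho> \<longleftrightarrow> \<rho> \<in> smaps (Wspace n) (Wspace n) \<and>
     (\<forall>i j. \<forall>f\<in>mon (i + j + 1) n.
        smap_comp (Qspace i j) \<rho> (iota i j n f) =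
        smap_comp (Qspace i j)
          (iota j i n (\<lambda>p\<in>{..j + i + 1}. n - f (the_inv_into {..i + j + 1} (tau i j) p)))
          (tau_Q i j))"

end

context join_pair
begin

lemma reflect_eq: "(\<lambda>p\<in>{..j + i + 1}. n - f (the_inv_into {..i + j + 1} (tau i j) p)) = reflect N n f"
proof -
  have N: "j + i + 1 = N" "i + j + 1 = N" using fw.N by simp_all
  have "inj_on (tau i j) {..N}" by (auto simp: inj_on_def tau_eq)
  then have "the_inv_into {..N} (tau i j) p = N - p" if "p \<le> N" for p
    using that by (intro the_inv_into_f_eq) (auto simp: tau_eq)
  then show ?thesis unfolding N reflect_def by (intro restrict_ext) simp
qed

lemma transpose_flip_map_eq:
  assumes C: "is_scat C" "x \<in> obs C" "y \<in> obs C" and g: "g \<in> bw.bip_maps C x y"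
  shows "fw.transpose C (flip_map C x y g) = smap_comp (Qspace i j) (bw.transpose C g) (tau_Q i j)"
proof (rule smap_comp_eqI)
  show "fw.transpose C (flip_map C x y g) \<in> smaps (Qspace i j) (mhom C x y)"
    unfolding fw.Qspace_eq by (rule fw.transpose_smaps[OF C flip_map_bip[OF C g]])
  fix m c assume "c \<in> simps (Qspace i j) m"
  then obtain p \<alpha> k l T where *: "\<alpha> \<in> simps (std N) p" "l \<le> p" "\<not> i < \<alpha> k" "i < \<alpha> l" "T \<in> subset_chains k l m"
    "c = fw.gcls m p \<alpha> k l T"
    unfolding fw.Qspace_eq by (rule fw.hom_cases)
  then have "tau_Q i j m c = bw.gcls m p (reflect p N \<alpha>) (p - l) (p - k) (rev_chain p m T)"
    using tau_Q_gcls[of \<alpha> p l k T m] by simp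
  then show "fw.transpose C (flip_map C x y g) m c = bw.transpose C g m (tau_Q i j m c)"
    using transpose_flip_map[OF C g *(1-5)] *(6) by simp
qed

end

context suspension
begin

definition reversing where
  "reversing \<rho> \<longleftrightarrow> (\<forall>m p s k l T. s \<in> simps (cyl n) p \<longrightarrow> l \<le> p \<longrightarrow> \<not> 0 < snd s k \<longrightarrow> 0 < snd s l \<longrightarrow>
     T \<in> subset_chains k l m \<longrightarrow>
     \<rho> m (gcls m p s k l T) = gcls m p (\<theta> p s) (p - l) (p - k) (rev_chain p m T))"

lemma rho_condition:
  assumes J: "join_pair i j N" and f: "f \<in> mon N n"
    and \<alpha>: "\<alpha> \<in> mon p N" "l \<le> p" "\<alpha> k \<le> i" "i < \<alpha> l" and T: "T \<in> subset_chains k l m"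
  shows "iota j i n (reflect N n f) m (tau_Q i j m (bipartite_sset.gcls (std N) (\<lambda>\<alpha> k. i < \<alpha> k) (constm 0 0) (constm 0 N) m p \<alpha> k l T)) =
    gcls m p (\<theta> p (compose {..p} f \<alpha>, compose {..p} (join_proj i j) \<alpha>)) (p - l) (p - k) (rev_chain p m T)"
proof -
  interpret J: join_pair i j N by (rule J)
  have k: "k \<le> l" using T by (rule chains_le)
  have proj: "join_proj i j \<in> mon N (Suc 0)" using join_proj_mon[of i j] J.fw.N by simp
  have "j < N - \<alpha> k" "N - \<alpha> l \<le> j" using \<alpha> mon_le[OF \<alpha>(1,2)] J.fw.N by auto
  then have "iota j i n (reflect N n f) m (J.bw.gcls m p (reflect p N \<alpha>) (p - l) (p - k) (rev_chain p m T)) =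
    gcls m p (compose {..p} (reflect N n f) (reflect p N \<alpha>), compose {..p} (join_proj j i) (reflect p N \<alpha>))
      (p - l) (p - k) (rev_chain p m T)"
    using \<alpha>(2) k rev_chain_chains[OF T \<alpha>(2)]
    by (intro iota_gcls[OF J.bw.join_sset_axioms reflect_mon[OF f] reflect_mon[OF \<alpha>(1)]]) auto
  moreover have "join_proj j i = reflect N (Suc 0) (join_proj i j)"
    using reflect_join_proj[of i j] J.fw.N by simp
  ultimately show ?thesis
    using reflect_compose[OF f \<alpha>(1)] reflect_compose[OF proj \<alpha>(1)]
    by (simp add: J.tau_Q_gcls[OF \<alpha> T] \<theta>_def)
qed

text \<open>Compatibility with the maps \<open>\<iota>\<^sub>f\<close> determines \<open>\<rho>\<close> on all generators: if the first vertex of a simplex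
  \<open>(f, e)\<close> of the cylinder that lies over the end \<open>1\<close> is \<open>i + 1\<close>, then \<open>e\<close> is the projection of a join
  \<open>\<Delta>\<^sup>i * \<Delta>\<^sup>j\<close>, and the generator comes from \<open>Q\<^sub>i\<^sub>,\<^sub>j\<close> by \<open>\<iota>\<^sub>f\<close>.\<close>

lemma is_rho_iff_reversing:
  "is_rho \<rho> \<longleftrightarrow> \<rho> \<in> smaps (Wspace n) (Wspace n) \<and> reversing \<rho>"
proof
  assume \<rho>: "is_rho \<rho>"
  have "\<rho> m (gcls m p s k l T) = gcls m p (\<theta> p s) (p - l) (p - k) (rev_chain p m T)"
    if s: "s \<in> simps (cyl n) p" "l \<le> p" "\<not> 0 < snd s k" "0 < snd s l" "T \<in> subset_chains k l m" for m p s k l T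
  proof -
    \<comment> \<open>The first vertex over the end \<open>1\<close>; the simplex factors through the join of what comes before it with the rest.\<close>
    define c where "c = (LEAST a. 0 < snd s a)"
    have c: "0 < snd s c" "c \<le> l" "\<And>a. a < c \<Longrightarrow> \<not> 0 < snd s a"
      using LeastI[of "\<lambda>a. 0 < snd s a", OF s(4)] Least_le[of "\<lambda>a. 0 < snd s a", OF s(4)] not_less_Least
      unfolding c_def by blast+
    have e: "snd s \<in> mon p (Suc 0)" and f: "fst s \<in> mon p n" using s(1) by auto
    have k: "k \<le> l" using s(5) by (rule chains_le)
    have kc: "k < c"
      using c(1) s(2,3) k mon_mono[OF e, of c k] by (cases "k < c") auto
    define i j where "i = c - 1" and "j = p - c"
    have p: "p = i + j + 1" using kc c(2) s(2) by (simp add: i_def j_def)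
    interpret J: join_pair i j p by unfold_locales (use p in auto)
    have proj: "join_proj i j = snd s"
    proof (rule extensionalityI[of _ "{..p}"])
      show "join_proj i j \<in> extensional {..p}" using mon_ext[OF join_proj_mon[of i j]] p by simp
      show "snd s \<in> extensional {..p}" using e by (rule mon_ext)
      fix a assume "a \<in> {..p}"
      then have a: "a \<le> p" by simp
      show "join_proj i j a = snd s a"
      proof (cases "a \<le> i")
        case True
        then have "a < c" using kc by (simp add: i_def)
        then show ?thesis using c(3)[of a] True a p by (simp add: join_proj_apply)
      next
        case False
        then have "c \<le> a" by (simp add: i_def)
        then have "snd s a = Suc 0" using c(1) mon_mono[OF e, of c a] mon_le[OF e a] a by simp
        then show ?thesis using False a p by (simp add: join_proj_apply)
      qed
    qed
    have kl: "J.fw.idN k \<le> i" "i < J.fw.idN l"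
    proof -
      show "J.fw.idN k \<le> i" using k s(2) kc by (simp add: i_def)
      have "c \<le> l" by (rule c(2))
      then show "i < J.fw.idN l" using s(2) kc by (simp add: i_def)
    qed
    have comp_id: "compose {..p} h J.fw.idN = h" if "h \<in> extensional {..p}" for h :: "nat \<Rightarrow> nat"
      using that by (intro extensionalityI[of _ "{..p}"]) (auto simp: compose_eq)
    have s_eq: "(compose {..p} (fst s) J.fw.idN, compose {..p} (join_proj i j) J.fw.idN) = s"
      using mon_ext[OF e] mon_ext[OF f] by (simp add: comp_id proj)
    let ?c = "J.fw.gcls m p J.fw.idN k l T"
    have in': "?c \<in> simps (Qspace i j) m"
      unfolding J.fw.Qspace_eq using kl s(2,5) by (intro J.fw.gcls_in J.fw.idN_in) auto
    have "fst s \<in> mon (i + j + 1) n" using f p by simp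
    then have "smap_comp (Qspace i j) \<rho> (iota i j n (fst s)) =
        smap_comp (Qspace i j) (iota j i n (reflect p n (fst s))) (tau_Q i j)"
      using \<rho> unfolding is_rho_def J.reflect_eq[symmetric] by blast
    from fun_cong[OF fun_cong[OF this, of m], of ?c]
    have "\<rho> m (iota i j n (fst s) m ?c) = iota j i n (reflect p n (fst s)) m (tau_Q i j m ?c)"
      using in' by simp
    then show ?thesis
      unfolding iota_gcls[OF J.fw.join_sset_axioms f mon_id s(2) kl s(5)]
        rho_condition[OF J.join_pair_axioms f mon_id s(2) kl s(5)] s_eq .
  qed
  then show "\<rho> \<in> smaps (Wspace n) (Wspace n) \<and> reversing \<rho>"
    using \<rho> unfolding is_rho_def reversing_def by blast
next
  assume \<rho>: "\<rho> \<in> smaps (Wspace n) (Wspace n) \<and> reversing \<rho>"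
  have "smap_comp (Qspace i j) \<rho> (iota i j n f) =
        smap_comp (Qspace i j)
          (iota j i n (\<lambda>p\<in>{..j + i + 1}. n - f (the_inv_into {..i + j + 1} (tau i j) p)))
          (tau_Q i j)" if "f \<in> mon (i + j + 1) n" for i j f
  proof -
    define N where "N = i + j + 1"
    interpret J: join_pair i j N by unfold_locales (auto simp: N_def)
    have f: "f \<in> mon N n" using that by (simp add: N_def)
    have proj: "join_proj i j \<in> mon N (Suc 0)" using join_proj_mon[of i j] J.fw.N by simp
    have "\<rho> m (iota i j n f m c) = iota j i n (reflect N n f) m (tau_Q i j m c)"
      if "c \<in> simps (Qspace i j) m" for m c
    proof -
      obtain p \<alpha> k l T where *: "\<alpha> \<in> mon p N" "l \<le> p" "\<alpha> k \<le> i" "i < \<alpha> l" "T \<in> subset_chains k l m"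
        "c = J.fw.gcls m p \<alpha> k l T"
        using \<open>c \<in> simps (Qspace i j) m\<close> unfolding J.fw.Qspace_eq
        by (metis J.fw.hom_cases not_less simps_std)
      have k: "k \<le> p" using chains_le[OF *(5)] *(2) by simp
      have "(compose {..p} f \<alpha>, compose {..p} (join_proj i j) \<alpha>) \<in> simps (cyl n) p"
        using mon_comp[OF f *(1)] mon_comp[OF proj *(1)] by simp
      moreover have "\<not> 0 < join_proj i j (\<alpha> k)" "0 < join_proj i j (\<alpha> l)"
        using * mon_le[OF *(1) k] mon_le[OF *(1,2)] J.fw.N by (simp_all add: join_proj_apply)
      ultimately show ?thesis
        using \<rho> * k unfolding *(6) iota_gcls[OF J.fw.join_sset_axioms f *(1-5)]
          rho_condition[OF J.join_pair_axioms f *(1-5)] reversing_def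
        by (simp add: compose_eq)
    qed
    then show ?thesis unfolding J.reflect_eq by (intro ext) (simp add: smap_comp_def restrict_def)
  qed
  then show "is_rho \<rho>" using \<rho> unfolding is_rho_def by blast
qed

text \<open>The formula on generators is compatible with the relations between them because it describes the
  transpose of the flipped unit. Uniqueness holds since the generators exhaust the mapping space.\<close>

lemma rho_smaps: "rho n \<in> smaps (Wspace n) (Wspace n)"
  and rho_reversing: "reversing (rho n)"
proof -
  let ?g = "rev.flip_map (rigid Q) v0 v1 unit_map"
  let ?\<rho> = "transpose (rigid Q) ?g"
  note C = is_scat_rigid[OF Q] rigid_v_obs
  have "?\<rho> \<in> smaps (Wspace n) (Wspace n)"
    unfolding Wspace_eq by (rule transpose_smaps[OF C rev.flip_map_bip[OF C unit_map_bip]])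
  moreover have "reversing ?\<rho>"
    unfolding reversing_def
  proof (intro allI impI)
    fix m p s k l T
    assume s: "s \<in> simps (cyl n) p" "l \<le> p" "\<not> 0 < snd s k" "0 < snd s l" "T \<in> subset_chains k l m"
    have k: "k \<le> p" using chains_le[OF s(5)] s(2) by simp
    have "?\<rho> m (gcls m p s k l T) =
      transpose (rigid Q) unit_map m (gcls m p (\<theta> p s) (p - l) (p - k) (rev_chain p m T))"
      by (rule rev.transpose_flip_map[OF C unit_map_bip s])
    also have "\<dots> = gcls m p (\<theta> p s) (p - l) (p - k) (rev_chain p m T)"
      using s k rev.\<theta>_in[OF s(1)] rev.\<theta>_side[OF s(1)]
      by (intro transpose_unit) (simp_all add: rev_chain_chains del: cyl_simps)
    finally show "?\<rho> m (gcls m p s k l T) = gcls m p (\<theta> p s) (p - l) (p - k) (rev_chain p m T)" .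
  qed
  ultimately have ex: "is_rho ?\<rho>" by (simp add: is_rho_iff_reversing)
  have unique: "\<rho> = ?\<rho>" if "is_rho \<rho>" for \<rho>
  proof (rule smaps_eqI)
    show "\<rho> \<in> smaps (Wspace n) (Wspace n)" "?\<rho> \<in> smaps (Wspace n) (Wspace n)"
      using that ex by (simp_all add: is_rho_iff_reversing)
    fix m c assume "c \<in> simps (Wspace n) m"
    then show "\<rho> m c = ?\<rho> m c"
      unfolding Wspace_eq
    proof (rule hom_cases)
      fix p s k l T
      assume "s \<in> simps (cyl n) p" "l \<le> p" "\<not> 0 < snd s k" "0 < snd s l" "T \<in> subset_chains k l m"
        "c = gcls m p s k l T"
      then show ?thesis using that ex unfolding is_rho_iff_reversing reversing_def by metis
    qed
  qed
  have "rho n = (THE \<rho>. is_rho \<rho>)" unfolding rho_def is_rho_def ..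
  also have "\<dots> = ?\<rho>" using ex unique by (rule the_equality)
  finally have "is_rho (rho n)" using ex by simp
  then show "rho n \<in> smaps (Wspace n) (Wspace n)" "reversing (rho n)"
    by (simp_all add: is_rho_iff_reversing)
qed

lemma transpose_flip_map_eq:
  assumes C: "is_scat C" "x \<in> obs C" "y \<in> obs C" and g: "g \<in> bip_maps C x y"
  shows "transpose C (rev.flip_map C x y g) = smap_comp (Wspace n) (transpose C g) (rho n)"
proof (rule smap_comp_eqI)
  show "transpose C (rev.flip_map C x y g) \<in> smaps (Wspace n) (mhom C x y)"
    unfolding Wspace_eq by (rule transpose_smaps[OF C rev.flip_map_bip[OF C g]])
  fix m c assume "c \<in> simps (Wspace n) m"
  then show "transpose C (rev.flip_map C x y g) m c = transpose C g m (rho n m c)"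
    unfolding Wspace_eq
  proof (rule hom_cases)
    fix p s k l T
    assume *: "s \<in> simps (cyl n) p" "l \<le> p" "\<not> 0 < snd s k" "0 < snd s l" "T \<in> subset_chains k l m"
      "c = gcls m p s k l T"
    then have "rho n m c = gcls m p (\<theta> p s) (p - l) (p - k) (rev_chain p m T)"
      using rho_reversing unfolding reversing_def by blast
    then show ?thesis using rev.transpose_flip_map[OF C g *(1-5)] *(6) by simp
  qed
qed

end

section \<open>The isomorphisms of mapping spaces\<close>

text \<open>The isomorphism is unique because transposition (here \<open>t\<close>) is injective; the condition in the theorem
  prescribes the transpose of each value.\<close>

lemma unique_iso:
  assumes \<Phi>: "\<And>n g. g \<in> simps H n \<Longrightarrow> \<Phi> n g \<in> simps K n \<and> \<Psi> n (\<Phi> n g) = g"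
    and \<Psi>: "\<And>n h. h \<in> simps K n \<Longrightarrow> \<Psi> n h \<in> simps H n \<and> \<Phi> n (\<Psi> n h) = h"
    and nat: "\<And>m n \<alpha> g. \<alpha> \<in> mon m n \<Longrightarrow> g \<in> simps H n \<Longrightarrow>
      act H m n \<alpha> g \<in> simps H m \<and> \<Phi> m (act H m n \<alpha> g) = act K m n (reflect m n \<alpha>) (\<Phi> n g)"
    and inj: "\<And>n h h'. h \<in> simps K n \<Longrightarrow> h' \<in> simps K n \<Longrightarrow> t n h = t n h' \<Longrightarrow> h = h'"
    and eq: "\<And>n g. g \<in> simps H n \<Longrightarrow> t n (\<Phi> n g) = e n g"
  shows "\<exists>!F. F \<in> sisos H (opp K) \<and> (\<forall>n. \<forall>g\<in>simps H n. t n (F n g) = e n g)"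
proof
  let ?F = "\<lambda>n. \<lambda>g\<in>simps H n. \<Phi> n g"
  have opp: "simps (opp K) = simps K" "act (opp K) m n \<alpha> h = act K m n (reflect m n \<alpha>) h" for m n \<alpha> h
    by (simp_all add: opp_def reflect_def)
  have "?F \<in> smaps H (opp K)"
    by (rule smapsI) (use \<Phi> nat in \<open>auto simp: opp\<close>)
  moreover have "bij_betw (?F n) (simps H n) (simps (opp K) n)" for n
    by (rule bij_betwI[of _ _ _ "\<Psi> n"]) (use \<Phi> \<Psi> in \<open>auto simp: opp\<close>)
  ultimately show "?F \<in> sisos H (opp K) \<and> (\<forall>n. \<forall>g\<in>simps H n. t n (?F n g) = e n g)"
    using eq by (auto simp: sisos_def)
  fix G assume G: "G \<in> sisos H (opp K) \<and> (\<forall>n. \<forall>g\<in>simps H n. t n (G n g) = e n g)"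
  show "G = ?F"
  proof
    fix n show "G n = ?F n"
    proof (rule extensionalityI[of _ "simps H n"])
      show "G n \<in> extensional (simps H n)" using G by (auto simp: sisos_def dest: smaps_ext)
      fix g assume g: "g \<in> simps H n"
      then have "G n g \<in> simps K n" using G smaps_in[of G H "opp K" g n] by (auto simp: sisos_def opp)
      then show "G n g = ?F n g" using inj[of "G n g" n "\<Phi> n g"] G g \<Phi> eq by simp
    qed simp
  qed
qed

lemma join_map_mon: "\<alpha> \<in> mon i i' \<Longrightarrow> \<beta> \<in> mon j j' \<Longrightarrow> join_map i j i' \<alpha> \<beta> \<in> mon (i + j + 1) (i' + j' + 1)"
  by (auto simp: mon_iff join_map_def intro!: diff_le_mono)

lemma HomL_act: "act (HomL S X Y) m n \<alpha> g =
    smap_comp (std (Suc m)) g (std_map (Suc m) (Suc n) (join_map m 0 n \<alpha> (constm 0 0)))"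
  and HomR_act: "act (HomR S X Y) m n \<alpha> g =
    smap_comp (std (Suc m)) g (std_map (Suc m) (Suc n) (join_map 0 m 0 (constm 0 0) \<alpha>))"
  by (simp_all add: HomL_def HomR_def)

text \<open>The reflection of \<open>\<alpha>' * id\<close> on \<open>\<Delta>\<^sup>m * \<Delta>\<^sup>0\<close>, where \<open>\<alpha>'\<close> is the reflection of \<open>\<alpha>\<close>, is \<open>id * \<alpha>\<close>
  on \<open>\<Delta>\<^sup>0 * \<Delta>\<^sup>m\<close>. This is where the opposite simplicial set enters.\<close>

lemma reflect_join_map:
  assumes \<alpha>: "\<alpha> \<in> mon m n"
  shows "reflect (Suc m) (Suc n) (join_map m 0 n (reflect m n \<alpha>) (constm 0 0)) =
    join_map 0 m 0 (constm 0 0) \<alpha>"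
proof (rule extensionalityI[of _ "{..Suc m}"])
  fix k assume "k \<in> {..Suc m}"
  then show "reflect (Suc m) (Suc n) (join_map m 0 n (reflect m n \<alpha>) (constm 0 0)) k =
    join_map 0 m 0 (constm 0 0) \<alpha> k"
    using mon_le[OF \<alpha>, of "k - 1"] by (cases k) (auto simp: join_map_def Suc_diff_le)
qed (auto simp: reflect_def join_map_def)

lemma HomR_iso_HomL:
  assumes C: "is_scat C" "x \<in> obs C" "y \<in> obs C"
  shows "\<exists>!F. F \<in> sisos (HomR (cnerve C) (cnerve_obj C x) (cnerve_obj C y))
                        (opp (HomL (cnerve C) (cnerve_obj C x) (cnerve_obj C y))) \<and>
            (\<forall>n. \<forall>g\<in>simps (HomR (cnerve C) (cnerve_obj C x) (cnerve_obj C y)) n.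
               Q_transpose C n 0 (F n g) =
               smap_comp (Qspace n 0) (Q_transpose C 0 n g) (tau_Q n 0))"
proof (rule unique_iso)
  let ?H = "HomR (cnerve C) (cnerve_obj C x) (cnerve_obj C y)"
  let ?K = "HomL (cnerve C) (cnerve_obj C x) (cnerve_obj C y)"
  let ?\<Phi> = "\<lambda>n. reversal.flip_map (std (Suc n)) (\<lambda>\<alpha> k. n < \<alpha> k) (\<lambda>p. reflect p (Suc n)) C x y"
  let ?\<Psi> = "\<lambda>n. reversal.flip_map (std (Suc n)) (\<lambda>\<alpha> k. 0 < \<alpha> k) (\<lambda>p. reflect p (Suc n)) C x y"
  have pair: "join_pair n 0 (Suc n)" for n by unfold_locales auto
  have pair': "join_pair 0 n (Suc n)" for n by unfold_locales auto
  have H: "simps ?H n = bipartite_sset.bip_maps (std (Suc n)) (\<lambda>\<alpha> k. 0 < \<alpha> k) C x y" for n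
    by (rule HomR_simps) (unfold_locales, simp)
  have K: "simps ?K n = bipartite_sset.bip_maps (std (Suc n)) (\<lambda>\<alpha> k. n < \<alpha> k) C x y" for n
    by (rule HomL_simps) (unfold_locales, simp)
  fix n
  interpret J: join_pair n 0 "Suc n" by (rule pair)
  interpret J': join_pair 0 n "Suc n" by (rule pair')
  show "?\<Phi> n g \<in> simps ?K n \<and> ?\<Psi> n (?\<Phi> n g) = g" if "g \<in> simps ?H n" for g
    using that unfolding H K using J.flip_map_bip[OF C] J.flip_flip_map[OF C] by blast
  show "?\<Psi> n h \<in> simps ?H n \<and> ?\<Phi> n (?\<Psi> n h) = h" if "h \<in> simps ?K n" for h
    using that unfolding H K using J.inv.flip_map_bip[OF C] J'.flip_flip_map[OF C] by blast
  show "h = h'" if "h \<in> simps ?K n" "h' \<in> simps ?K n" "Q_transpose C n 0 h = Q_transpose C n 0 h'" for h h'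
    using that J.fw.transpose_inj[OF C] unfolding K J.fw.Q_transpose_eq[OF C] by blast
  show "Q_transpose C n 0 (?\<Phi> n g) = smap_comp (Qspace n 0) (Q_transpose C 0 n g) (tau_Q n 0)"
    if "g \<in> simps ?H n" for g
    using that J.transpose_flip_map_eq[OF C] unfolding H J.fw.Q_transpose_eq[OF C] J.bw.Q_transpose_eq[OF C]
    by blast
  fix m \<alpha> g assume \<alpha>: "\<alpha> \<in> mon m n" and g: "g \<in> simps ?H n"
  interpret M: join_pair m 0 "Suc m" by (rule pair)
  let ?l = "join_map m 0 n (reflect m n \<alpha>) (constm 0 0)" and ?r = "join_map 0 m 0 (constm 0 0) \<alpha>"
  have l: "?l \<in> mon (Suc m) (Suc n)"
    using join_map_mon[OF reflect_mon[OF \<alpha>], of "constm 0 0" 0 0] by (simp add: mon_const)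
  have r: "?r \<in> mon (Suc m) (Suc n)"
    using join_map_mon[OF _ \<alpha>, of "constm 0 0" 0 0] by (simp add: mon_const)
  have l_side: "n < ?l k \<longleftrightarrow> m < k" if "k \<le> Suc m" for k
    using that by (auto simp: join_map_def)
  have r_side: "0 < ?r k \<longleftrightarrow> 0 < k" if "k \<le> Suc m" for k
    using that by (auto simp: join_map_def)
  note natural = flip_map_natural[OF M.reversal_axioms J.reversal_axioms C std_map_smaps[OF l] _ std_map_smaps[OF r]]
  show "act ?H m n \<alpha> g \<in> simps ?H m \<and> ?\<Phi> m (act ?H m n \<alpha> g) = act ?K m n (reflect m n \<alpha>) (?\<Phi> n g)"
    unfolding H HomR_act HomL_act
  proof (intro conjI natural)
    show "g \<in> J.bw.bip_maps C x y" using g unfolding H .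
    then show "g \<in> J.bw.bip_maps C x y" .
  qed (auto simp: std_map_def compose_eq l_side r_side mon_le reflect_mon reflect_compose[OF l] reflect_join_map[OF \<alpha>])
qed

lemma Hom_iso_Hom:
  assumes C: "is_scat C" "x \<in> obs C" "y \<in> obs C"
  shows "\<exists>!F. F \<in> sisos (Hom (cnerve C) (cnerve_obj C x) (cnerve_obj C y))
                        (opp (Hom (cnerve C) (cnerve_obj C x) (cnerve_obj C y))) \<and>
            (\<forall>n. \<forall>g\<in>simps (Hom (cnerve C) (cnerve_obj C x) (cnerve_obj C y)) n.
               W_transpose C n (F n g) =
               smap_comp (Wspace n) (W_transpose C n g) (rho n))"
proof (rule unique_iso)
  let ?H = "Hom (cnerve C) (cnerve_obj C x) (cnerve_obj C y)"
  let ?\<Phi> = "\<lambda>n. reversal.flip_map (cyl n) (\<lambda>s k. 0 < snd s k) (suspension.\<theta> n) C x y"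
  note H = suspension.Hom_simps[of C x y]
  fix n
  interpret N: suspension n .
  show inv: "?\<Phi> n g \<in> simps ?H n \<and> ?\<Phi> n (?\<Phi> n g) = g" if "g \<in> simps ?H n" for g
    using that unfolding H using N.rev.flip_map_bip[OF C] N.rev.flip_flip_map[OF C] by blast
  show "?\<Phi> n g \<in> simps ?H n \<and> ?\<Phi> n (?\<Phi> n g) = g" if "g \<in> simps ?H n" for g
    using that by (rule inv)
  show "h = h'" if "h \<in> simps ?H n" "h' \<in> simps ?H n" "W_transpose C n h = W_transpose C n h'" for h h'
    using that N.transpose_inj[OF C] unfolding H N.W_transpose_eq[OF C] by blast
  show "W_transpose C n (?\<Phi> n g) = smap_comp (Wspace n) (W_transpose C n g) (rho n)"
    if "g \<in> simps ?H n" for g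
    using that N.transpose_flip_map_eq[OF C] unfolding H N.W_transpose_eq[OF C] by blast
  fix m \<alpha> g assume \<alpha>: "\<alpha> \<in> mon m n" and g: "g \<in> simps ?H n"
  interpret M: suspension m .
  let ?cyl_map = "\<lambda>\<alpha> p. \<lambda>s\<in>simps (cyl m) p. (std_map m n \<alpha> p (fst s), snd s)"
  have act: "act ?H m n \<alpha> g = smap_comp (cyl m) g (?cyl_map \<alpha>)" for \<alpha> g
    by (simp add: Hom_def)
  have smap: "?cyl_map \<alpha> \<in> smaps (cyl m) (cyl n)" if "\<alpha> \<in> mon m n" for \<alpha>
    by (rule smapsI)
      (use smaps_in[OF std_map_smaps[OF that]] smaps_act[OF std_map_smaps[OF that]] in
        \<open>auto simp: mem_Times_iff mon_comp\<close>)
  note natural = flip_map_natural[OF M.rev.reversal_axioms N.rev.reversal_axioms C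
      smap[OF reflect_mon[OF \<alpha>]] _ smap[OF \<alpha>]]
  show "act ?H m n \<alpha> g \<in> simps ?H m \<and> ?\<Phi> m (act ?H m n \<alpha> g) = act ?H m n (reflect m n \<alpha>) (?\<Phi> n g)"
    unfolding H act
  proof (intro conjI natural)
    show "g \<in> N.bip_maps C x y" using g unfolding H .
    then show "g \<in> N.bip_maps C x y" .
  qed (auto simp: std_map_def N.\<theta>_def M.\<theta>_def reflect_mon reflect_compose[OF reflect_mon[OF \<alpha>]]
      reflect_reflect[OF \<alpha>])
qed

theorem corollary3p13:
  fixes C :: "('o, 'm) scat" and x y :: 'o
  assumes "kan_enriched C" and "x \<in> obs C" and "y \<in> obs C"
  shows "(\<exists>!F. F \<in> sisos (HomR (cnerve C) (cnerve_obj C x) (cnerve_obj C y))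
                        (opp (HomL (cnerve C) (cnerve_obj C x) (cnerve_obj C y))) \<and>
            (\<forall>n. \<forall>g\<in>simps (HomR (cnerve C) (cnerve_obj C x) (cnerve_obj C y)) n.
               Q_transpose C n 0 (F n g) =
               smap_comp (Qspace n 0) (Q_transpose C 0 n g) (tau_Q n 0))) \<and>
         (\<exists>!F. F \<in> sisos (Hom (cnerve C) (cnerve_obj C x) (cnerve_obj C y))
                        (opp (Hom (cnerve C) (cnerve_obj C x) (cnerve_obj C y))) \<and>
            (\<forall>n. \<forall>g\<in>simps (Hom (cnerve C) (cnerve_obj C x) (cnerve_obj C y)) n.
               W_transpose C n (F n g) =
               smap_comp (Wspace n) (W_transpose C n g) (rho n)))"
proof -
  have "is_scat C" using assms(1) by (simp add: kan_enriched_def)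
  note C = this assms(2,3)
  show ?thesis by (rule conjI[OF HomR_iso_HomL[OF C] Hom_iso_Hom[OF C]])
qed

end
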